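(* Let $u$ be the solution of the constrained parabolic problem (CP) and let $U\in\mathcal P^b(I;\mathcal U)$ be the solution of the time-discrete constrained problem (DCP) (both defined in the context). Assume that $u\in H^m(I;\mathcal U)$ for an integer $m$ with $1\le m\le q$. Then $$\|u(T)-U(T)\|_{\mathcal H}+\|u-U\|_{L^2(I;\mathcal U)}\le c\Big(\sum_{n=1}^N k_n^{2m}\,\|u^{(m)}\|_{L^2(I_n;\mathcal U)}^2\Big)^{1/2}\le c\,k^m\,\|u^{(m)}\|_{L^2(I;\mathcal U)}$$ for some constant $c>0$ which depends only on $q$, $\gamma$ and $\Gamma$.
   Context: Abstract setting. $\mathcal U,\mathcal H$ are real separable Hilbert spaces with a dense continuous embedding $\mathcal U\hookrightarrow\mathcal H$; $\mathcal Q$ is a real Hilbert space; $b:\mathcal U\times\mathcal Q\to\mathbb R$ is a continuous bilinear form with operator $B:\mathcal U\to\mathcal Q'$, $(Bu)(r)=b(u,r)$, and $B$ is assumed surjective. $\mathcal V:=\ker B\subset\mathcal U$, with norm $\|\cdot\|_{\mathcal U}$. $a:\mathcal U\times\mathcal U\to\mathbb R$ is a symmetric bilinear form with $|a(u,v)|\le\Gamma\|u\|_{\mathcal U}\|v\|_{\mathcal U}$ for $u,v\in\mathcal U$ and $a(v,v)\ge\gamma\|v\|_{\mathcal U}^2$ for $v\in\mathcal V$, where $\gamma,\Gamma>0$; $(Au)(v)=a(u,v)$. $a$ and $b$ do not depend on time. $I=(0,T)$. An element $w\in\mathcal H$ acts as an element of $\mathcal V'$ by $v\mapsto(w,v)_{\mathcal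 H}$. $W^1(\mathcal U;\mathcal V')=\{u\in L^2(I;\mathcal U): u'\in L^2(I;\mathcal V')\}$. (CP): given $f\in L^2(I;\mathcal V')$, $g\in L^2(I;\mathcal Q')$, $u_0\in\mathcal H$, $u\in W^1(\mathcal U;\mathcal V')$ satisfies $u(0)=u_0$, $u'+Au=f$ in $L^2(I;\mathcal V')$, and $Bu=g$ in $L^2(I;\mathcal Q')$. Time discretization. $q\ge1$ is an integer; $0=t_0<\dots<t_N=T$, $I_n=(t_{n-1},t_n]$, $k_n=t_n-t_{n-1}$, $k=\max_nk_n\le1$. For a Hilbert space $\hat{\mathcal H}$, $\mathcal P^b(I;\hat{\mathcal H})$ is the space of functions on $I$ whose restriction to each $I_n$ is a polynomial of degree $\le q-1$ with values in $\hat{\mathcal H}$, and $H^{1,b}(I;\hat{\mathcal H})$ the space of functions whose restriction to each $I_n$ lies in $H^1(I_n;\hat{\mathcal H})$. For such a function $Y$: $Y^n=Y|_{I_n}(t_n)$, $Y_+^{n-1}=\lim_{t\downarrow t_{n-1}}Y|_{I_n}(t)$, $[Y]^n=Y^n_+-Y^n$ ($1\le n\le N-1$), and $Y'$ is the derivative taken on each $I_n$ separately. Set $$D_{\mathcal H}(Y,X)=\sum_{n=1}^N\int_{I_n}(Y',X)_{\mathcal H}+\sum_{n=1}^{N-1}([Y]^n,X^n_+)_{\mathcal H}+(Y^0_+,X^0_+)_{\mathcal H},\qquad K(Y,X)=D_{\mathcal H}(Y,X)+\int_I a(Y,X).$$ $L^2_c(I;\hat{\mathcal H})$ denotes functions in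 $L^2(I;\hat{\mathcal H})$ whose restriction to each $I_n$ is continuous at $t_n$. The projection $\mathcal I_q:L_c^2(I;\hat{\mathcal H})\to\mathcal P^b(I;\hat{\mathcal H})$ is defined on each $I_n$ by $(\mathcal I_q\phi)|_{I_n}(t_n)=\phi|_{I_n}(t_n)$ and $\int_{I_n}(\mathcal I_q\phi-\phi)\psi=0$ for all scalar polynomials $\psi$ of degree $\le q-2$ (only the first condition if $q=1$). (DCP): $U\in\mathcal P^b(I;\mathcal U)$ satisfies $K(U,X)=\int_I f(X)+(u_0,X_+^0)_{\mathcal H}$ for all $X\in\mathcal P^b(I;\mathcal V)$, and $\int_I b(U,R)=\int_I(\mathcal I_qg)(R)$ for all $R\in\mathcal P^b(I;\mathcal Q)$ (equivalently $BU=\mathcal I_qg$). *)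

theory Defs
  imports "HOL-Analysis.Analysis" "HOL-Computational_Algebra.Polynomial"
begin

section \<open>Bochner spaces on a set of times\<close>

text \<open>Functions stand for their classes modulo null sets. The spaces \<open>U'\<close>, \<open>Q'\<close> are not instances
  of \<^class>\<open>second_countable_topology\<close>, so strong measurability is spelled out (a.e. limit of
  simple functions) instead of being borrowed from Borel measurability.\<close>

definition L2 :: "real set \<Rightarrow> (real \<Rightarrow> 'b::real_normed_vector) set" where
  "L2 S = {f. (\<exists>s. (\<forall>i. simple_function (lebesgue_on S) (s i)) \<and>
                   (AE t in lebesgue_on S. (\<lambda>i::nat. s i t) \<longlonglongrightarrow> f t)) \<and>
              integrable (lebesgue_on S) (\<lambda>t. (norm (f t))\<^sup>2)}"

definition L2_norm :: "real set \<Rightarrow> (real \<Rightarrow> 'b::real_normed_vector) \<Rightarrow> real" where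
  "L2_norm S f = sqrt (LINT t|lebesgue_on S. (norm (f t))\<^sup>2)"

definition test_functions :: "real set \<Rightarrow> (real \<Rightarrow> real) set" where
  "test_functions S = {\<phi>. (\<forall>j t. (deriv ^^ j) \<phi> field_differentiable at t) \<and>
                          (\<exists>C. compact C \<and> C \<subseteq> S \<and> (\<forall>t. t \<notin> C \<longrightarrow> \<phi> t = 0))}"

definition is_weak_deriv ::
  "real set \<Rightarrow> nat \<Rightarrow> (real \<Rightarrow> 'b::{banach, second_countable_topology}) \<Rightarrow> (real \<Rightarrow> 'b) \<Rightarrow> bool" where
  "is_weak_deriv S j u w \<longleftrightarrow>
     (\<forall>\<phi>\<in>test_functions S.
        (LINT t|lebesgue_on S. (deriv ^^ j) \<phi> t *\<^sub>R u t)
        = (- 1) ^ j *\<^sub>R (LINT t|lebesgue_on S. \<phi> t *\<^sub>R w t))"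

definition Hm :: "real set \<Rightarrow> nat \<Rightarrow> (real \<Rightarrow> 'b::{banach, second_countable_topology}) set" where
  "Hm S m = {u \<in> L2 S. \<forall>j\<in>{1..m}. \<exists>w\<in>L2 S. is_weak_deriv S j u w}"

definition weak_deriv ::
  "real set \<Rightarrow> nat \<Rightarrow> (real \<Rightarrow> 'b::{banach, second_countable_topology}) \<Rightarrow> real \<Rightarrow> 'b" where
  "weak_deriv S j u = (SOME w. w \<in> L2 S \<and> is_weak_deriv S j u w)"

text \<open>The value at \<open>x\<close> of the continuous representative of \<open>u\<close>; it exists for \<open>u \<in> Hm S m\<close>, \<open>m \<ge> 1\<close>,
  and \<open>S\<close> a bounded open interval.\<close>

definition trace_at :: "real set \<Rightarrow> (real \<Rightarrow> 'b::real_normed_vector) \<Rightarrow> real \<Rightarrow> 'b" where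
  "trace_at S u x = (THE y. \<exists>v. continuous_on (closure S) v \<and>
                               (AE t in lebesgue_on S. v t = u t) \<and> v x = y)"

section \<open>The dual of a subspace\<close>

text \<open>An element of \<open>V'\<close> is a function on the ambient space of which only the values on \<open>V\<close> matter;
  two of them are equal in \<open>V'\<close> when they agree on \<open>V\<close>.\<close>

definition dual_of :: "'u::real_normed_vector set \<Rightarrow> ('u \<Rightarrow> real) set" where
  "dual_of V = {\<phi>. (\<forall>x\<in>V. \<forall>y\<in>V. \<phi> (x + y) = \<phi> x + \<phi> y) \<and>
                   (\<forall>r. \<forall>x\<in>V. \<phi> (r *\<^sub>R x) = r * \<phi> x) \<and>
                   (\<exists>C. \<forall>x\<in>V. \<bar>\<phi> x\<bar> \<le> C * norm x)}"

definition dual_norm :: "'u::real_normed_vector set \<Rightarrow> ('u \<Rightarrow> real) \<Rightarrow> real" where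
  "dual_norm V \<phi> = (SUP v\<in>{v\<in>V. norm v \<le> 1}. \<bar>\<phi> v\<bar>)"

definition L2_dual :: "real set \<Rightarrow> 'u::real_normed_vector set \<Rightarrow> (real \<Rightarrow> 'u \<Rightarrow> real) set" where
  "L2_dual S V = {f. (AE t in lebesgue_on S. f t \<in> dual_of V) \<and>
     (\<exists>s. (\<forall>i. simple_function (lebesgue_on S) (s i) \<and> (\<forall>t\<in>S. s i t \<in> dual_of V)) \<and>
          (AE t in lebesgue_on S. (\<lambda>i::nat. dual_norm V (\<lambda>v. s i t v - f t v)) \<longlonglongrightarrow> 0)) \<and>
     integrable (lebesgue_on S) (\<lambda>t. (dual_norm V (f t))\<^sup>2)}"

text \<open>The weak derivative in \<open>V'\<close> of a function with values in \<open>H\<close>, where \<open>w \<in> H\<close> acts on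
  \<open>v \<in> V \<subseteq> U\<close> by \<open>w \<bullet> E v\<close> with \<open>E\<close> the embedding of \<open>U\<close> in \<open>H\<close>. The equality of the two integrals
  in \<open>V'\<close> is evaluated at each \<open>v\<close>.\<close>

definition is_weak_deriv_dual ::
  "real set \<Rightarrow> ('u::real_normed_vector \<Rightarrow> 'h::real_inner) \<Rightarrow> 'u set \<Rightarrow> (real \<Rightarrow> 'h) \<Rightarrow> (real \<Rightarrow> 'u \<Rightarrow> real) \<Rightarrow> bool"
  where
  "is_weak_deriv_dual S E V y w \<longleftrightarrow>
     (\<forall>\<phi>\<in>test_functions S. \<forall>v\<in>V.
        (LINT t|lebesgue_on S. deriv \<phi> t * (y t \<bullet> E v)) = - (LINT t|lebesgue_on S. \<phi> t * w t v))"

text \<open>For \<open>u \<in> W\<^sup>1(U;V')\<close> the value \<open>u(0)\<close> is in general only defined in \<open>V'\<close>, through the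
  continuous representative in \<open>C([0,T];V')\<close>.\<close>

definition dual_value_at ::
  "real set \<Rightarrow> ('u::real_normed_vector \<Rightarrow> 'h::real_inner) \<Rightarrow> 'u set \<Rightarrow> (real \<Rightarrow> 'h) \<Rightarrow> real \<Rightarrow> 'h \<Rightarrow> bool"
  where
  "dual_value_at S E V y x y0 \<longleftrightarrow>
     (\<exists>z. (\<forall>t\<in>closure S. z t \<in> dual_of V \<and>
             ((\<lambda>s. dual_norm V (\<lambda>v. z s v - z t v)) \<longlongrightarrow> 0) (at t within closure S)) \<and>
          (AE t in lebesgue_on S. \<forall>v\<in>V. z t v = y t \<bullet> E v) \<and>
          (\<forall>v\<in>V. z x v = y0 \<bullet> E v))"

section \<open>The constrained parabolic problem\<close>

definition B_op :: "('u::real_normed_vector \<Rightarrow> 'q::real_normed_vector \<Rightarrow> real) \<Rightarrow> 'u \<Rightarrow> ('q \<Rightarrow>\<^sub>L real)" where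
  "B_op b u = Blinfun (b u)"

definition ker_B :: "('u::real_normed_vector \<Rightarrow> 'q::real_normed_vector \<Rightarrow> real) \<Rightarrow> 'u set" where
  "ker_B b = {u. B_op b u = 0}"

definition CP ::
  "('u::real_inner \<Rightarrow> 'h::real_inner) \<Rightarrow> ('u \<Rightarrow> 'u \<Rightarrow> real) \<Rightarrow> ('u \<Rightarrow> 'q::real_inner \<Rightarrow> real) \<Rightarrow> real \<Rightarrow>
   (real \<Rightarrow> 'u \<Rightarrow> real) \<Rightarrow> (real \<Rightarrow> ('q \<Rightarrow>\<^sub>L real)) \<Rightarrow> 'h \<Rightarrow> (real \<Rightarrow> 'u) \<Rightarrow> bool" where
  "CP E a b T f g u0 u \<longleftrightarrow>
     u \<in> L2 {0<..<T} \<and>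
     (\<exists>u'\<in>L2_dual {0<..<T} (ker_B b).
        is_weak_deriv_dual {0<..<T} E (ker_B b) (\<lambda>t. E (u t)) u' \<and>
        (AE t in lebesgue_on {0<..<T}. \<forall>v\<in>ker_B b. u' t v + a (u t) v = f t v)) \<and>
     dual_value_at {0<..<T} E (ker_B b) (\<lambda>t. E (u t)) 0 u0 \<and>
     (AE t in lebesgue_on {0<..<T}. B_op b (u t) = g t)"

section \<open>The time discretization\<close>

definition Ivl :: "(nat \<Rightarrow> real) \<Rightarrow> nat \<Rightarrow> real set" where
  "Ivl \<tau> n = {\<tau> (n - 1)<..\<tau> n}"

definition step :: "(nat \<Rightarrow> real) \<Rightarrow> nat \<Rightarrow> real" where
  "step \<tau> n = \<tau> n - \<tau> (n - 1)"

definition max_step :: "(nat \<Rightarrow> real) \<Rightarrow> nat \<Rightarrow> real" where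
  "max_step \<tau> N = Max (step \<tau> ` {1..N})"

definition is_mesh :: "real \<Rightarrow> nat \<Rightarrow> (nat \<Rightarrow> real) \<Rightarrow> bool" where
  "is_mesh T N \<tau> \<longleftrightarrow> N \<ge> 1 \<and> \<tau> 0 = 0 \<and> \<tau> N = T \<and> (\<forall>n\<in>{1..N}. \<tau> (n - 1) < \<tau> n) \<and> max_step \<tau> N \<le> 1"

text \<open>\<open>Pb \<tau> N q S\<close>: piecewise polynomials of degree at most \<open>q - 1\<close> with values in the subspace \<open>S\<close>;
  only the values on \<open>(0,T]\<close> are relevant.\<close>

definition Pb :: "(nat \<Rightarrow> real) \<Rightarrow> nat \<Rightarrow> nat \<Rightarrow> 'b::real_normed_vector set \<Rightarrow> (real \<Rightarrow> 'b) set" where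
  "Pb \<tau> N q S = {Y. \<forall>n\<in>{1..N}. \<exists>c. (\<forall>j<q. c j \<in> S) \<and>
                     (\<forall>t\<in>Ivl \<tau> n. Y t = (\<Sum>j<q. t ^ j *\<^sub>R c j))}"

definition right_lim :: "(real \<Rightarrow> 'b::real_normed_vector) \<Rightarrow> real \<Rightarrow> 'b" where
  "right_lim Y t = Lim (at_right t) Y"

text \<open>Only used for piecewise polynomials, whose derivative on each interval is the classical one.\<close>

definition D_form :: "(nat \<Rightarrow> real) \<Rightarrow> nat \<Rightarrow> (real \<Rightarrow> 'h::real_inner) \<Rightarrow> (real \<Rightarrow> 'h) \<Rightarrow> real" where
  "D_form \<tau> N Y X =
     (\<Sum>n=1..N. LINT t|lebesgue_on (Ivl \<tau> n). vector_derivative Y (at t within Ivl \<tau> n) \<bullet> X t)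
     + (\<Sum>n=1..N-1. (right_lim Y (\<tau> n) - Y (\<tau> n)) \<bullet> right_lim X (\<tau> n))
     + right_lim Y (\<tau> 0) \<bullet> right_lim X (\<tau> 0)"

definition K_form ::
  "('u::real_inner \<Rightarrow> 'h::real_inner) \<Rightarrow> ('u \<Rightarrow> 'u \<Rightarrow> real) \<Rightarrow> real \<Rightarrow> (nat \<Rightarrow> real) \<Rightarrow> nat \<Rightarrow>
   (real \<Rightarrow> 'u) \<Rightarrow> (real \<Rightarrow> 'u) \<Rightarrow> real" where
  "K_form E a T \<tau> N Y X =
     D_form \<tau> N (\<lambda>t. E (Y t)) (\<lambda>t. E (X t)) + (LINT t|lebesgue_on {0<..<T}. a (Y t) (X t))"

text \<open>\<open>is_Iq \<tau> N q \<phi> p\<close>: \<open>p\<close> is the projection \<open>I\<^sub>q \<phi>\<close>. The value \<open>\<phi>|\<^bsub>I\<^sub>n\<^esub>(t\<^sub>n)\<close> is that of a representative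
  of \<open>\<phi>\<close> which is continuous at \<open>t\<^sub>n\<close>, so that \<open>is_Iq\<close> depends only on the class of \<open>\<phi>\<close>. The moments
  are taken with the gauge integral, which is available for values in any normed space and agrees
  with the Bochner integral for Bochner integrable functions with values in a Banach space.
  For \<open>q = 1\<close> no \<open>\<psi>\<close> qualifies.\<close>

definition is_Iq ::
  "(nat \<Rightarrow> real) \<Rightarrow> nat \<Rightarrow> nat \<Rightarrow> (real \<Rightarrow> 'b::real_normed_vector) \<Rightarrow> (real \<Rightarrow> 'b) \<Rightarrow> bool" where
  "is_Iq \<tau> N q \<phi> p \<longleftrightarrow>
     p \<in> Pb \<tau> N q UNIV \<and>
     (\<forall>n\<in>{1..N}.
        (\<exists>\<phi>'. (AE t in lebesgue_on (Ivl \<tau> n). \<phi>' t = \<phi> t) \<and>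
              continuous (at (\<tau> n) within Ivl \<tau> n) \<phi>' \<and> p (\<tau> n) = \<phi>' (\<tau> n)) \<and>
        (\<forall>\<psi> :: real poly. degree \<psi> + 2 \<le> q \<longrightarrow>
           ((\<lambda>t. poly \<psi> t *\<^sub>R (p t - \<phi> t)) has_integral 0) (Ivl \<tau> n)))"

definition DCP ::
  "('u::real_inner \<Rightarrow> 'h::real_inner) \<Rightarrow> ('u \<Rightarrow> 'u \<Rightarrow> real) \<Rightarrow> ('u \<Rightarrow> 'q::real_inner \<Rightarrow> real) \<Rightarrow> real \<Rightarrow>
   (nat \<Rightarrow> real) \<Rightarrow> nat \<Rightarrow> nat \<Rightarrow>
   (real \<Rightarrow> 'u \<Rightarrow> real) \<Rightarrow> (real \<Rightarrow> ('q \<Rightarrow>\<^sub>L real)) \<Rightarrow> 'h \<Rightarrow> (real \<Rightarrow> 'u) \<Rightarrow> bool" where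
  "DCP E a b T \<tau> N q f g u0 U \<longleftrightarrow>
     U \<in> Pb \<tau> N q UNIV \<and>
     (\<forall>X\<in>Pb \<tau> N q (ker_B b).
        K_form E a T \<tau> N U X
        = (LINT t|lebesgue_on {0<..<T}. f t (X t)) + u0 \<bullet> E (right_lim X 0)) \<and>
     (\<exists>Iqg. is_Iq \<tau> N q g Iqg \<and>
        (\<forall>R\<in>Pb \<tau> N q UNIV.
           (LINT t|lebesgue_on {0<..<T}. b (U t) (R t))
           = (LINT t|lebesgue_on {0<..<T}. blinfun_apply (Iqg t) (R t))))"

text \<open>The constant of the error bound. The spaces \<open>U\<close>, \<open>H\<close>, \<open>Q\<close> are types, and types cannot be
  quantified below an existential quantifier over the constant; an explicit function of \<open>q\<close>, \<open>\<gamma>\<close>, \<open>\<Gamma>\<close>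
  expresses that the constant depends on nothing else. It is the product of the constant \<open>q\<close> in
  \<open>\<parallel>u - I\<^sub>q u\<parallel> \<le> q k\<^sub>n\<^sup>m \<parallel>u\<^sup>(\<^sup>m\<^sup>)\<parallel>\<close> on \<open>I\<^sub>n\<close> and of the stability constants of the scheme in
  \<open>L\<^sup>2(I;U)\<close> and at time \<open>T\<close>.\<close>

definition err_const :: "nat \<Rightarrow> real \<Rightarrow> real \<Rightarrow> real" where
  "err_const q \<gamma> \<Gamma> = real q * (1 + \<Gamma> / \<gamma> + \<Gamma> / sqrt (2 * \<gamma>))"

end

theory Submission imports Defs begin

text \<open>Let \<open>v\<close> be the continuous representative of \<open>u\<close> and \<open>p = I\<^sub>q v\<close>. On each interval \<open>v - p\<close> vanishes
  at the right end point and is orthogonal to the polynomials of degree at most \<open>q - 2\<close>, so that by an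
  integration by parts \<open>D(v - p, X) = 0\<close> for every piecewise polynomial \<open>X\<close>. Moreover \<open>Bp = I\<^sub>q g = BU\<close>,
  hence \<open>\<chi> = U - p\<close> takes its values in the kernel of \<open>B\<close> and is itself an admissible test function:
  \<open>K(\<chi>, \<chi>) = \<integral> a(v - p, \<chi>)\<close>. Coercivity of \<open>a\<close> on the kernel and \<open>D(\<chi>, \<chi>) \<ge> \<bar>\<chi>(T)\<bar>\<^sup>2 / 2\<close> bound \<open>\<chi>\<close> in
  \<open>L\<^sup>2(I; U)\<close> and at time \<open>T\<close> by the interpolation error \<open>v - p\<close>, which is estimated on each interval
  separately and vanishes at \<open>T\<close>.\<close>

section \<open>Integrals over subsets of the line\<close>

text \<open>Three points shape the proof. (1) The equation and the constraint hold in
  \<open>V'\<close> and \<open>Q'\<close>, so they are tested with fixed vectors. A fixed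
  \<open>r\<close> turns the constraint into an identity of real polynomials. In the equation, chi
  is built from finitely many coefficient vectors of the kernel, so finitely many null sets suffice;
  the initial condition too is known only on the kernel, where chi lives. (2) The interpolation
  constant must not depend on the space. The interpolant is therefore built from its derivative, a
  projection in a weighted norm that does not enlarge that norm, and Poincare inequalities with
  explicit constants supply the powers of the step; the resulting constant on each interval is 1.
  (3) With e the interpolation error, x the L2 norm of chi and h the norm of chi(T), the energy
  argument gives h^2/2 + \<gamma> x^2 \<le> \<Gamma> e x. Dropping h yields x \<le>
  (\<Gamma>/\<gamma>) e; maximising \<Gamma> e x - \<gamma> x^2 over x yields h \<le> \<Gamma> e /
  sqrt(2 \<gamma>). Together with e itself, from the triangle inequality, these are the three
  summands in \<open>err_const\<close>.\<close>

lemma integral_lebesgue_on_indicator: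
  fixes f :: "real \<Rightarrow> 'a::{banach, second_countable_topology}"
  assumes "S \<in> sets lebesgue"
  shows "integral\<^sup>L (lebesgue_on S) f = (LINT x:S|lebesgue. f x)"
  using assms by (simp add: integral_restrict_space set_lebesgue_integral_def)

lemma integrable_lebesgue_on_iff:
  fixes f :: "real \<Rightarrow> 'a::{banach, second_countable_topology}"
  assumes "S \<in> sets lebesgue"
  shows "integrable (lebesgue_on S) f \<longleftrightarrow> set_integrable lebesgue S f"
  using assms by (simp add: integrable_restrict_space set_integrable_def)

lemma integrable_lebesgue_on_subset:
  fixes f :: "real \<Rightarrow> 'a::{banach, second_countable_topology}"
  assumes "integrable (lebesgue_on S) f" "R \<subseteq> S" "S \<in> sets lebesgue" "R \<in> sets lebesgue"
  shows "integrable (lebesgue_on R) f"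
  using assms by (metis integrable_lebesgue_on_iff set_integrable_subset)

lemma AE_lebesgue_on_subset:
  assumes "AE t in lebesgue_on S. P t" "R \<subseteq> S" "S \<in> sets lebesgue" "R \<in> sets lebesgue"
  shows "AE t in lebesgue_on R. P t"
  using assms by (auto simp: AE_restrict_space_iff elim!: eventually_mono)

lemma borel_measurable_lebesgue_on_subset:
  fixes f :: "real \<Rightarrow> 'a::topological_space"
  assumes "f \<in> borel_measurable (lebesgue_on S)" "R \<subseteq> S"
  shows "f \<in> borel_measurable (lebesgue_on R)"
  using assms by (rule measurable_restrict_mono)

text \<open>Intervals with the same end points differ by at most two points; this moves
  almost-everywhere statements between their open, half-open and closed versions.\<close>

lemma AE_lebesgue_on_insert:
  assumes "AE t in lebesgue_on S. P t" "S \<in> sets lebesgue" "R \<in> sets lebesgue" "R - S \<subseteq> N" "finite N"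
  shows "AE t in lebesgue_on R. P t"
proof -
  have "N \<in> null_sets lebesgue"
    using \<open>finite N\<close> by (simp add: negligible_finite flip: negligible_iff_null_sets)
  then have "AE t in lebesgue. t \<notin> N" by (rule AE_not_in)
  moreover have "AE t in lebesgue. t \<in> S \<longrightarrow> P t"
    using assms by (simp add: AE_restrict_space_iff)
  ultimately have "AE t in lebesgue. t \<in> R \<longrightarrow> P t"
    by eventually_elim (use assms in auto)
  then show ?thesis using assms by (simp add: AE_restrict_space_iff)
qed

text \<open>Lebesgue measure is complete, so a change on a null set preserves measurability;
  measurability of \<open>g\<close> is a conclusion here, not an assumption.\<close>

lemma borel_measurable_lebesgue_on_cong_AE:
  fixes f :: "real \<Rightarrow> 'a::topological_space"
  assumes "f \<in> borel_measurable (lebesgue_on S)" "AE t in lebesgue_on S. f t = g t" "S \<in> sets lebesgue"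
  shows "g \<in> borel_measurable (lebesgue_on S)"
proof (rule measurableI)
  fix A :: "'a set" assume "A \<in> sets borel"
  have "g -` A \<inter> S \<in> sets lebesgue"
  proof (rule completion.in_sets_AE)
    show "f -` A \<inter> S \<in> sets lebesgue"
      using measurable_sets[OF assms(1) \<open>A \<in> sets borel\<close>] assms(3)
      by (simp add: sets_restrict_space_iff)
    have "AE t in lebesgue. t \<in> S \<longrightarrow> f t = g t" using assms by (simp add: AE_restrict_space_iff)
    then show "AE t in lebesgue. (t \<in> f -` A \<inter> S) = (t \<in> g -` A \<inter> S)"
      by eventually_elim auto
  qed auto
  then show "g -` A \<inter> space (lebesgue_on S) \<in> sets (lebesgue_on S)"
    using assms(3) by (simp add: sets_restrict_space_iff)
qed auto

lemma borel_measurable_lebesgue_on_AE_LIMSEQ: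
  fixes f :: "real \<Rightarrow> 'a::{banach, second_countable_topology}"
  assumes [measurable]: "\<And>i. s i \<in> borel_measurable (lebesgue_on S)"
    and lim: "AE t in lebesgue_on S. (\<lambda>i::nat. s i t) \<longlonglongrightarrow> f t" and S: "S \<in> sets lebesgue"
  shows "f \<in> borel_measurable (lebesgue_on S)"
proof (rule borel_measurable_lebesgue_on_cong_AE[OF _ _ S])
  show "(\<lambda>t. lim (\<lambda>i. s i t)) \<in> borel_measurable (lebesgue_on S)" by measurable
  show "AE t in lebesgue_on S. lim (\<lambda>i. s i t) = f t"
    using lim by eventually_elim (rule limI)
qed

text \<open>Nothing is assumed about \<open>f\<close>: since \<open>N\<close> is null, measurability
  on \<open>S\<close> and on \<open>R\<close> are equivalent, and where it fails both integrals take
  the default value 0.\<close>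

lemma
  fixes f :: "real \<Rightarrow> 'a::{banach, second_countable_topology}"
  assumes "S \<in> sets lebesgue" "R \<in> sets lebesgue" "S - R \<subseteq> N" "R - S \<subseteq> N" "finite N"
  shows integral_lebesgue_on_finite_diff:
      "integral\<^sup>L (lebesgue_on S) f = integral\<^sup>L (lebesgue_on R) f"
    and integrable_lebesgue_on_finite_diff:
      "integrable (lebesgue_on S) f \<longleftrightarrow> integrable (lebesgue_on R) f"
    and borel_measurable_lebesgue_on_finite_diff:
      "f \<in> borel_measurable (lebesgue_on S) \<longleftrightarrow> f \<in> borel_measurable (lebesgue_on R)"
proof -
  let ?g = "\<lambda>x. indicat_real S x *\<^sub>R f x" and ?h = "\<lambda>x. indicat_real R x *\<^sub>R f x"
  have "N \<in> null_sets lebesgue"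
    using \<open>finite N\<close> by (simp add: negligible_finite flip: negligible_iff_null_sets)
  then have ae: "AE t in lebesgue. t \<notin> N" by (rule AE_not_in)
  have meas: "(\<lambda>x. indicat_real R x *\<^sub>R f x) \<in> borel_measurable lebesgue"
    if "(\<lambda>x. indicat_real S x *\<^sub>R f x) \<in> borel_measurable lebesgue" "S - R \<subseteq> N" "R - S \<subseteq> N" for S R
  proof -
    have "countable N" using \<open>finite N\<close> by (rule countable_finite)
    have eq: "indicat_real S x = indicat_real R x" if "x \<notin> N" for x
      using that \<open>S - R \<subseteq> N\<close> \<open>R - S \<subseteq> N\<close> by (auto simp: indicator_def)
    show ?thesis
      by (intro measurable_discrete_difference[OF that(1) \<open>countable N\<close>])
        (simp_all add: eq)
  qed
  show m: "f \<in> borel_measurable (lebesgue_on S) \<longleftrightarrow> f \<in> borel_measurable (lebesgue_on R)"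
    using meas[of S R] meas[of R S] assms by (metis Int_UNIV_right borel_measurable_restrict_space_iff space_completion space_lborel space_borel)
  have eq: "AE x in lebesgue. ?g x = ?h x"
  proof -
    have "indicat_real S x = indicat_real R x" if "x \<notin> N" for x
    proof -
      have "x \<in> S \<longleftrightarrow> x \<in> R" using that assms(3,4) by blast
      then show ?thesis by (simp add: indicator_def)
    qed
    then show ?thesis using ae by (auto elim!: eventually_mono)
  qed
  show "integral\<^sup>L (lebesgue_on S) f = integral\<^sup>L (lebesgue_on R) f"
  proof (cases "f \<in> borel_measurable (lebesgue_on S)")
    case True
    with m have "f \<in> borel_measurable (lebesgue_on R)" by blast
    with True have "?g \<in> borel_measurable lebesgue" "?h \<in> borel_measurable lebesgue"
      using assms by (simp_all add: borel_measurable_restrict_space_iff)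
    then have "integral\<^sup>L lebesgue ?g = integral\<^sup>L lebesgue ?h"
      using eq by (rule integral_cong_AE)
    then show ?thesis
      using assms by (simp add: integral_restrict_space)
  next
    case False
    with m have "f \<notin> borel_measurable (lebesgue_on R)" by blast
    with False show ?thesis
      by (metis borel_measurable_integrable not_integrable_integral_eq)
  qed
  show "integrable (lebesgue_on S) f \<longleftrightarrow> integrable (lebesgue_on R) f"
  proof (cases "f \<in> borel_measurable (lebesgue_on S)")
    case True
    with m have "f \<in> borel_measurable (lebesgue_on R)" by blast
    with True have "?g \<in> borel_measurable lebesgue" "?h \<in> borel_measurable lebesgue"
      using assms by (simp_all add: borel_measurable_restrict_space_iff)
    then have "integrable lebesgue ?g = integrable lebesgue ?h"
      using eq by (rule integrable_cong_AE)
    then show ?thesis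
      using assms by (simp add: integrable_restrict_space)
  next
    case False
    with m have "f \<notin> borel_measurable (lebesgue_on R)" by blast
    with False show ?thesis
      by (metis borel_measurable_integrable)
  qed
qed

lemma integral_lebesgue_on_combine:
  fixes f :: "real \<Rightarrow> 'a::{banach, second_countable_topology}"
  assumes "integrable (lebesgue_on {a..b}) f" "a \<le> c" "c \<le> b"
  shows "integral\<^sup>L (lebesgue_on {a..b}) f
    = integral\<^sup>L (lebesgue_on {a..c}) f + integral\<^sup>L (lebesgue_on {c..b}) f"
proof -
  have 1: "integral\<^sup>L (lebesgue_on {c..b}) f = integral\<^sup>L (lebesgue_on {c<..b}) f"
    by (rule integral_lebesgue_on_finite_diff[where N="{c}"]) auto
  have "{a..b} = {a..c} \<union> {c<..b}" using assms by auto
  moreover have "(LINT x:{a..c} \<union> {c<..b}|lebesgue. f x)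
     = (LINT x:{a..c}|lebesgue. f x) + (LINT x:{c<..b}|lebesgue. f x)"
  proof (rule set_integral_Un)
    show "set_integrable lebesgue {a..c} f" "set_integrable lebesgue {c<..b} f"
      using assms by (auto intro!: set_integrable_subset[of lebesgue "{a..b}" f] simp: integrable_lebesgue_on_iff)
  qed auto
  ultimately show ?thesis
    unfolding 1 by (simp add: integral_lebesgue_on_indicator)
qed

lemma measure_lebesgue_on_Icc [simp]: "a \<le> b \<Longrightarrow> measure (lebesgue_on {a..b}) {a..b} = b - (a::real)"
  by (simp add: measure_restrict_space)

lemma finite_measure_lebesgue_on_Icc: "finite_measure (lebesgue_on {a..b::real})"
  by (rule finite_measure_lebesgue_on) simp

lemma continuous_on_borel_measurable_lebesgue_on:
  fixes f :: "real \<Rightarrow> 'a::topological_space"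
  assumes "continuous_on S f"
  shows "f \<in> borel_measurable (lebesgue_on S)"
proof -
  have "f \<in> borel_measurable (restrict_space borel S)"
    by (rule borel_measurable_continuous_on_restrict[OF assms])
  moreover have "(\<lambda>x. x) \<in> measurable (lebesgue_on S) (restrict_space borel S)"
    by (rule measurable_restrict_space3) (auto intro: measurable_completion)
  ultimately have "(\<lambda>x. f x) \<in> borel_measurable (lebesgue_on S)"
    by (rule measurable_compose[rotated])
  then show ?thesis by simp
qed

lemma continuous_on_integrable_lebesgue_on:
  fixes f :: "real \<Rightarrow> 'a::{banach, second_countable_topology}"
  assumes "continuous_on {a..b} f"
  shows "integrable (lebesgue_on {a..b}) f"
proof -
  interpret finite_measure "lebesgue_on {a..b}" by (rule finite_measure_lebesgue_on_Icc)
  have "bounded (f ` {a..b})"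
    using compact_continuous_image[OF assms] by (simp add: compact_imp_bounded)
  then obtain B where "\<And>x. x \<in> {a..b} \<Longrightarrow> norm (f x) \<le> B" unfolding bounded_iff by blast
  then show ?thesis
    by (intro integrable_const_bound[where B=B] continuous_on_borel_measurable_lebesgue_on assms)
      (auto intro!: AE_I2)
qed

lemma integrable_continuous_scaleR:
  fixes f :: "real \<Rightarrow> 'a::{banach, second_countable_topology}" and \<phi> :: "real \<Rightarrow> real"
  assumes "continuous_on {a..b} \<phi>" "integrable (lebesgue_on {a..b}) f"
  shows "integrable (lebesgue_on {a..b}) (\<lambda>t. \<phi> t *\<^sub>R f t)"
proof -
  have "bounded (\<phi> ` {a..b})"
    using compact_continuous_image[OF assms(1)] by (simp add: compact_imp_bounded)
  then obtain B where B: "\<And>x. x \<in> {a..b} \<Longrightarrow> norm (\<phi> x) \<le> B" unfolding bounded_iff by blast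
  have [measurable]: "\<phi> \<in> borel_measurable (lebesgue_on {a..b})"
    by (rule continuous_on_borel_measurable_lebesgue_on[OF assms(1)])
  have [measurable]: "f \<in> borel_measurable (lebesgue_on {a..b})"
    using assms(2) by auto
  show ?thesis
  proof (rule Bochner_Integration.integrable_bound)
    show "integrable (lebesgue_on {a..b}) (\<lambda>t. B *\<^sub>R f t)" using assms(2) by simp
    show "AE t in lebesgue_on {a..b}. norm (\<phi> t *\<^sub>R f t) \<le> norm (B *\<^sub>R f t)"
      using B by (intro AE_I2) (auto intro!: mult_right_mono intro: order_trans[OF _ abs_ge_self])
  qed simp
qed

lemma integral_lebesgue_on_FTC:
  fixes F :: "real \<Rightarrow> real"
  assumes "a \<le> b" "\<And>t. a \<le> t \<Longrightarrow> t \<le> b \<Longrightarrow> (F has_real_derivative F' t) (at t)" "continuous_on {a..b} F'"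
  shows "integral\<^sup>L (lebesgue_on {a..b}) F' = F b - F a"
proof -
  have "(F' has_integral (F b - F a)) {a..b}"
    using assms by (intro fundamental_theorem_of_calculus)
      (auto simp: has_real_derivative_iff_has_vector_derivative has_vector_derivative_at_within)
  moreover have "(F' has_integral integral\<^sup>L (lebesgue_on {a..b}) F') {a..b}"
    using continuous_on_integrable_lebesgue_on[OF assms(3)]
    by (rule has_integral_integral_lebesgue_on) simp
  ultimately show ?thesis by (rule has_integral_unique[symmetric])
qed

text \<open>The sets over which the integral vanishes contain the intervals and are stable under
  complements and countable disjoint unions, hence include all Borel sets; a Lebesgue set differs
  from its Borel \<open>main_part\<close> by a null set.\<close>

lemma AE_eq_0_if_interval_integrals_0:
  fixes f :: "real \<Rightarrow> 'a::{banach, second_countable_topology}"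
  assumes f: "integrable (lebesgue_on {a..b}) f" "a \<le> b"
    and 0: "\<And>x y. a \<le> x \<Longrightarrow> x \<le> y \<Longrightarrow> y \<le> b \<Longrightarrow> integral\<^sup>L (lebesgue_on {x..y}) f = 0"
  shows "AE t in lebesgue_on {a..b}. f t = 0"
proof -
  define F where "F = (\<lambda>x. indicat_real {a..b} x *\<^sub>R f x)"
  have F: "integrable lebesgue F"
    using f by (simp add: F_def integrable_restrict_space)
  have Fset: "set_integrable lebesgue A F" if "A \<in> sets lebesgue" for A
    using F that unfolding set_integrable_def by (rule integrable_mult_indicator[rotated])
  have F_UNIV: "integral\<^sup>L lebesgue F = 0"
    using 0[of a b] f by (simp add: F_def integral_restrict_space)
  have borel: "(LINT x:A|lebesgue. F x) = 0" if "A \<in> sets borel" for A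
    using that
  proof (induction rule: borel_set_induct)
    case (interval c d)
    have "(LINT x:{c..d}|lebesgue. F x) = (LINT x:{max a c..min b d}|lebesgue. f x)"
      unfolding set_lebesgue_integral_def F_def
      by (intro Bochner_Integration.integral_cong) (auto simp: indicator_def)
    also have "\<dots> = 0"
    proof (cases "max a c \<le> min b d")
      case True
      then show ?thesis using 0[of "max a c" "min b d"] by (simp add: integral_lebesgue_on_indicator)
    next
      case False
      then have "{max a c..min b d} = {}" by (auto simp: not_le)
      then show ?thesis by (simp add: set_lebesgue_integral_def)
    qed
    finally show ?case .
  next
    case (compl A)
    have "(LINT x:A \<union> -A|lebesgue. F x) = (LINT x:A|lebesgue. F x) + (LINT x:-A|lebesgue. F x)"
      using compl by (intro set_integral_Un Fset) auto
    then show ?case using F_UNIV compl by (simp add: set_lebesgue_integral_def)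
  next
    case (union A)
    have "(LINT x:(\<Union>i. A i)|lebesgue. F x) = (\<Sum>i. (LINT x:(A i)|lebesgue. F x))"
      using union by (intro lebesgue_integral_countable_add Fset) (auto simp: disjoint_family_on_def)
    then show ?case using union by simp
  qed (simp add: set_lebesgue_integral_def)
  interpret finite_measure "lebesgue_on {a..b}" by (rule finite_measure_lebesgue_on_Icc)
  show ?thesis
  proof (rule density_zero[OF f(1)])
    fix A :: "real set" assume "A \<in> sets (lebesgue_on {a..b})"
    then have A: "A \<in> sets lebesgue" "A \<subseteq> {a..b}"
      by (auto simp: sets_restrict_space_iff)
    then have "AE x in lborel. x \<in> main_part lborel A \<longleftrightarrow> x \<in> A"
      by (intro AE_in_main_part)
    then have ae: "AE x in lebesgue. x \<in> main_part lborel A \<longleftrightarrow> x \<in> A"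
      by (rule AE_completion)
    have mp: "main_part lborel A \<in> sets borel"
      using main_part_sets[OF A(1)] by simp
    then have "main_part lborel A \<in> sets lebesgue"
      by auto
    then have "(LINT x:A|lebesgue. F x) = (LINT x:main_part lborel A|lebesgue. F x)"
      unfolding set_lebesgue_integral_def using F A ae
      by (intro integral_cong_AE borel_measurable_scaleR borel_measurable_indicator)
         (auto simp: indicator_def elim!: eventually_mono)
    moreover have "(LINT x:A|lebesgue_on {a..b}. f x) = (LINT x:A|lebesgue. F x)"
      unfolding set_lebesgue_integral_def F_def using A
      by (auto simp: integral_restrict_space indicator_def intro!: Bochner_Integration.integral_cong)
    ultimately show "(LINT x:A|lebesgue_on {a..b}. f x) = 0" using borel[OF mp] by simp
  qed
qed

section \<open>Square integrable functions\<close>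

text \<open>The integral of \<open>(t * f - g)\<close> squared is a quadratic polynomial in
  \<open>t\<close> without negative values, which bounds its discriminant.\<close>

lemma
  fixes f g :: "'a \<Rightarrow> real"
  assumes [measurable]: "f \<in> borel_measurable M" "g \<in> borel_measurable M"
    and f2: "integrable M (\<lambda>x. (f x)\<^sup>2)" and g2: "integrable M (\<lambda>x. (g x)\<^sup>2)"
  shows integrable_mult_square_integrable: "integrable M (\<lambda>x. f x * g x)"
    and Cauchy_Schwarz_integral:
      "(\<integral>x. f x * g x \<partial>M)\<^sup>2 \<le> (\<integral>x. (f x)\<^sup>2 \<partial>M) * (\<integral>x. (g x)\<^sup>2 \<partial>M)"
proof -
  show fg: "integrable M (\<lambda>x. f x * g x)"
  proof (rule Bochner_Integration.integrable_bound)
    show "integrable M (\<lambda>x. (f x)\<^sup>2 + (g x)\<^sup>2)" using f2 g2 by simp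
    have "\<bar>y * z\<bar> \<le> \<bar>y\<^sup>2 + z\<^sup>2\<bar>" for y z :: real
    proof -
      have "0 \<le> \<bar>y\<bar> * \<bar>z\<bar>" "2 * (\<bar>y\<bar> * \<bar>z\<bar>) \<le> y\<^sup>2 + z\<^sup>2"
        using sum_squares_bound[of "\<bar>y\<bar>" "\<bar>z\<bar>"] by (simp_all add: mult.assoc)
      then show ?thesis unfolding abs_mult by linarith
    qed
    then show "AE x in M. norm (f x * g x) \<le> norm ((f x)\<^sup>2 + (g x)\<^sup>2)" by simp
  qed simp
  define A B C where "A = (\<integral>x. (f x)\<^sup>2 \<partial>M)" "B = (\<integral>x. (g x)\<^sup>2 \<partial>M)" "C = (\<integral>x. f x * g x \<partial>M)"
  have "t\<^sup>2 * A - 2 * t * C + B \<ge> 0" for t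
  proof -
    have "(\<integral>x. (t * f x - g x)\<^sup>2 \<partial>M) = (\<integral>x. t\<^sup>2 * (f x)\<^sup>2 - 2 * t * (f x * g x) + (g x)\<^sup>2 \<partial>M)"
      by (simp add: power2_diff power_mult_distrib algebra_simps)
    also have "\<dots> = t\<^sup>2 * A - 2 * t * C + B"
      unfolding A_B_C_def using f2 g2 fg by simp
    finally show ?thesis using Bochner_Integration.integral_nonneg[of M "\<lambda>x. (t * f x - g x)\<^sup>2"] by simp
  qed
  note q = this
  have "A \<ge> 0" unfolding A_B_C_def by simp
  show "C\<^sup>2 \<le> A * B"
  proof (cases "A = 0")
    case True
    have "C = 0"
    proof (rule ccontr)
      assume "C \<noteq> 0"
      \<comment> \<open>With \<open>A = 0\<close> the quadratic is \<open>B - 2 * t * C\<close>,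
        which equals -1 at this \<open>t\<close>.\<close>
      then show False using q[of "(B + 1) / (2 * C)"] True by simp
    qed
    then show ?thesis using True by simp
  next
    case False
    with \<open>A \<ge> 0\<close> have "A > 0" by simp
    \<comment> \<open>\<open>C / A\<close> minimises the quadratic.\<close>
    with q[of "C / A"] show ?thesis
      by (simp add: power2_eq_square field_simps)
  qed
qed

text \<open>Working form of \<open>L2\<close>: Borel measurability replaces the approximating simple
  functions, which makes sums, restrictions and bounded linear images easy to handle.\<close>

definition square_integrable_on :: "(real \<Rightarrow> 'a::real_normed_vector) \<Rightarrow> real set \<Rightarrow> bool"
  (infixr "square'_integrable'_on" 46) where
  "f square_integrable_on S \<longleftrightarrow>
     f \<in> borel_measurable (lebesgue_on S) \<and> integrable (lebesgue_on S) (\<lambda>t. (norm (f t))\<^sup>2)"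

lemma square_integrable_on_subset:
  assumes "f square_integrable_on S" "R \<subseteq> S" "S \<in> sets lebesgue" "R \<in> sets lebesgue"
  shows "f square_integrable_on R"
  using assms borel_measurable_lebesgue_on_subset[OF _ assms(2), of f]
    integrable_lebesgue_on_subset[OF _ assms(2-4), of "\<lambda>t. (norm (f t))\<^sup>2"]
  unfolding square_integrable_on_def by blast

lemma square_integrable_on_finite_diff:
  fixes f :: "real \<Rightarrow> 'a::{banach, second_countable_topology}"
  assumes "S \<in> sets lebesgue" "R \<in> sets lebesgue" "S - R \<subseteq> N" "R - S \<subseteq> N" "finite N"
  shows "f square_integrable_on S \<longleftrightarrow> f square_integrable_on R"
  by (simp add: square_integrable_on_def integrable_lebesgue_on_finite_diff[OF assms]
      borel_measurable_lebesgue_on_finite_diff[OF assms])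

lemma square_integrable_on_bound:
  assumes "f square_integrable_on S" "g \<in> borel_measurable (lebesgue_on S)"
    "AE t in lebesgue_on S. norm (g t) \<le> C * norm (f t)"
  shows "g square_integrable_on S"
  unfolding square_integrable_on_def
proof (safe intro!: assms)
  have [measurable]: "g \<in> borel_measurable (lebesgue_on S)" by (rule assms)
  show "integrable (lebesgue_on S) (\<lambda>t. (norm (g t))\<^sup>2)"
  proof (rule Bochner_Integration.integrable_bound)
    show "integrable (lebesgue_on S) (\<lambda>t. C\<^sup>2 * (norm (f t))\<^sup>2)"
      using assms by (simp add: square_integrable_on_def)
    show "AE t in lebesgue_on S. norm ((norm (g t))\<^sup>2) \<le> norm (C\<^sup>2 * (norm (f t))\<^sup>2)"
      using assms(3)
    proof eventually_elim
      case (elim t)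
      then have "(norm (g t))\<^sup>2 \<le> (C * norm (f t))\<^sup>2" by (intro power_mono) auto
      then show ?case by (simp add: power_mult_distrib)
    qed
  qed measurable
qed

lemma square_integrable_on_add:
  fixes f g :: "real \<Rightarrow> 'a::{banach, second_countable_topology}"
  assumes "f square_integrable_on S" "g square_integrable_on S"
  shows "(\<lambda>t. f t + g t) square_integrable_on S"
  unfolding square_integrable_on_def
proof
  have [measurable]: "f \<in> borel_measurable (lebesgue_on S)" "g \<in> borel_measurable (lebesgue_on S)"
    using assms by (auto simp: square_integrable_on_def)
  show "(\<lambda>t. f t + g t) \<in> borel_measurable (lebesgue_on S)" by measurable
  show "integrable (lebesgue_on S) (\<lambda>t. (norm (f t + g t))\<^sup>2)"
  proof (rule Bochner_Integration.integrable_bound)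
    show "integrable (lebesgue_on S) (\<lambda>t. 2 * (norm (f t))\<^sup>2 + 2 * (norm (g t))\<^sup>2)"
      using assms by (simp add: square_integrable_on_def)
    have "(norm (x + y))\<^sup>2 \<le> 2 * (norm x)\<^sup>2 + 2 * (norm y)\<^sup>2" for x y :: 'a
    proof -
      have "(norm (x + y))\<^sup>2 \<le> (norm x + norm y)\<^sup>2" by (intro power_mono norm_triangle_ineq) auto
      then show ?thesis using sum_squares_bound[of "norm x" "norm y"] by (simp add: power2_sum)
    qed
    then show "AE t in lebesgue_on S. norm ((norm (f t + g t))\<^sup>2)
        \<le> norm (2 * (norm (f t))\<^sup>2 + 2 * (norm (g t))\<^sup>2)" by simp
  qed measurable
qed

lemma square_integrable_on_bounded_linear:
  assumes "bounded_linear h" "f square_integrable_on S"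
  shows "(\<lambda>t. h (f t)) square_integrable_on S"
proof -
  obtain K where K: "\<And>x. norm (h x) \<le> norm x * K"
    using bounded_linear.bounded[OF assms(1)] by blast
  show ?thesis
  proof (rule square_integrable_on_bound[OF assms(2), where C=K])
    have h: "h \<in> borel_measurable borel"
      using linear_continuous_on[OF assms(1)] by (intro borel_measurable_continuous_onI)
    show "(\<lambda>t. h (f t)) \<in> borel_measurable (lebesgue_on S)"
      using assms(2) unfolding square_integrable_on_def by (intro measurable_compose[OF _ h]) blast
    show "AE t in lebesgue_on S. norm (h (f t)) \<le> K * norm (f t)" using K by (simp add: mult.commute)
  qed
qed

lemma square_integrable_on_minus:
  "f square_integrable_on S \<Longrightarrow> (\<lambda>t. - f t) square_integrable_on S"
  by (rule square_integrable_on_bounded_linear[OF bounded_linear_minus[OF bounded_linear_ident]])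

lemma square_integrable_on_diff:
  fixes f g :: "real \<Rightarrow> 'a::{banach, second_countable_topology}"
  assumes "f square_integrable_on S" "g square_integrable_on S"
  shows "(\<lambda>t. f t - g t) square_integrable_on S"
  using square_integrable_on_add[OF assms(1) square_integrable_on_minus[OF assms(2)]] by simp

lemma continuous_on_square_integrable_on:
  fixes f :: "real \<Rightarrow> 'a::{banach, second_countable_topology}"
  assumes "continuous_on {a..b} f"
  shows "f square_integrable_on {a..b}"
  unfolding square_integrable_on_def
  by (auto intro!: continuous_on_borel_measurable_lebesgue_on continuous_on_integrable_lebesgue_on
      continuous_intros assms)

lemma square_integrable_on_cong_AE:
  fixes f g :: "real \<Rightarrow> 'a::{banach, second_countable_topology}"
  assumes "f square_integrable_on S" "g \<in> borel_measurable (lebesgue_on S)"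
    "AE t in lebesgue_on S. g t = f t"
  shows "g square_integrable_on S"
  by (rule square_integrable_on_bound[OF assms(1,2), where C=1]) (use assms(3) in auto)

lemma square_integrable_on_integrable:
  fixes f :: "real \<Rightarrow> 'a::{banach, second_countable_topology}"
  assumes "f square_integrable_on S" "S \<in> lmeasurable"
  shows "integrable (lebesgue_on S) f"
proof (rule Bochner_Integration.integrable_bound)
  interpret finite_measure "lebesgue_on S" by (rule finite_measure_lebesgue_on[OF assms(2)])
  show "integrable (lebesgue_on S) (\<lambda>t. 1 + (norm (f t))\<^sup>2)"
    using assms by (simp add: square_integrable_on_def)
  have "x \<le> 1 + x\<^sup>2" for x :: real
    using sum_squares_bound[of x 1] zero_le_power2[of x] unfolding power_one by linarith
  then show "AE t in lebesgue_on S. norm (f t) \<le> norm (1 + (norm (f t))\<^sup>2)" by simp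
qed (use assms in \<open>simp add: square_integrable_on_def\<close>)

lemma L2_norm_nonneg [simp]: "L2_norm S f \<ge> 0"
  by (simp add: L2_norm_def)

lemma L2_norm_power2: "(L2_norm S f)\<^sup>2 = (LINT t|lebesgue_on S. (norm (f t))\<^sup>2)"
  by (simp add: L2_norm_def)

lemma
  fixes f :: "real \<Rightarrow> 'a::real_normed_vector" and g :: "real \<Rightarrow> 'b::real_normed_vector"
  assumes "f square_integrable_on S" "g square_integrable_on S"
  shows integrable_norm_mult_square_integrable: "integrable (lebesgue_on S) (\<lambda>t. norm (f t) * norm (g t))"
    and integral_norm_mult_le: "(LINT t|lebesgue_on S. norm (f t) * norm (g t)) \<le> L2_norm S f * L2_norm S g"
proof -
  have m: "(\<lambda>t. norm (f t)) \<in> borel_measurable (lebesgue_on S)"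
    "(\<lambda>t. norm (g t)) \<in> borel_measurable (lebesgue_on S)"
    "integrable (lebesgue_on S) (\<lambda>t. (norm (f t))\<^sup>2)" "integrable (lebesgue_on S) (\<lambda>t. (norm (g t))\<^sup>2)"
    using assms by (auto simp: square_integrable_on_def)
  show "integrable (lebesgue_on S) (\<lambda>t. norm (f t) * norm (g t))"
    by (rule integrable_mult_square_integrable[OF m])
  have "(LINT t|lebesgue_on S. norm (f t) * norm (g t))\<^sup>2 \<le> (L2_norm S f * L2_norm S g)\<^sup>2"
    using Cauchy_Schwarz_integral[OF m] by (simp add: power_mult_distrib L2_norm_power2)
  then show "(LINT t|lebesgue_on S. norm (f t) * norm (g t)) \<le> L2_norm S f * L2_norm S g"
    by (rule power2_le_imp_le) simp
qed

lemma integrable_inner_square_integrable: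
  fixes f g :: "real \<Rightarrow> 'a::{real_inner, second_countable_topology}"
  assumes "f square_integrable_on S" "g square_integrable_on S"
  shows "integrable (lebesgue_on S) (\<lambda>t. f t \<bullet> g t)"
proof (rule Bochner_Integration.integrable_bound[OF integrable_norm_mult_square_integrable[OF assms]])
  show "(\<lambda>t. f t \<bullet> g t) \<in> borel_measurable (lebesgue_on S)"
    using assms by (auto simp: square_integrable_on_def)
qed (simp add: Cauchy_Schwarz_ineq2)

lemma L2_norm_triangle:
  fixes f g :: "real \<Rightarrow> 'a::{banach, second_countable_topology}"
  assumes f: "f square_integrable_on S" and g: "g square_integrable_on S"
  shows "L2_norm S (\<lambda>t. f t + g t) \<le> L2_norm S f + L2_norm S g"
proof (rule power2_le_imp_le)
  have i: "integrable (lebesgue_on S) (\<lambda>t. (norm (f t))\<^sup>2)" "integrable (lebesgue_on S) (\<lambda>t. (norm (g t))\<^sup>2)"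
    using f g by (auto simp: square_integrable_on_def)
  note i = i integrable_norm_mult_square_integrable[OF f g]
  have "(L2_norm S (\<lambda>t. f t + g t))\<^sup>2
      \<le> (LINT t|lebesgue_on S. (norm (f t))\<^sup>2 + (norm (g t))\<^sup>2 + 2 * (norm (f t) * norm (g t)))"
    unfolding L2_norm_power2
  proof (rule integral_mono)
    show "integrable (lebesgue_on S) (\<lambda>t. (norm (f t + g t))\<^sup>2)"
      using square_integrable_on_add[OF f g] by (simp add: square_integrable_on_def)
    have "(norm (x + y))\<^sup>2 \<le> (norm x + norm y)\<^sup>2" for x y :: 'a
      by (intro power_mono norm_triangle_ineq) auto
    then show "(norm (f t + g t))\<^sup>2 \<le> (norm (f t))\<^sup>2 + (norm (g t))\<^sup>2 + 2 * (norm (f t) * norm (g t))" for t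
      by (simp add: power2_sum mult.assoc)
  qed (use i in simp)
  also have "\<dots> = (L2_norm S f)\<^sup>2 + (L2_norm S g)\<^sup>2 + 2 * (LINT t|lebesgue_on S. norm (f t) * norm (g t))"
    using i by (simp add: L2_norm_power2)
  also have "\<dots> \<le> (L2_norm S f)\<^sup>2 + (L2_norm S g)\<^sup>2 + 2 * (L2_norm S f * L2_norm S g)"
    using integral_norm_mult_le[OF f g] by simp
  finally show "(L2_norm S (\<lambda>t. f t + g t))\<^sup>2 \<le> (L2_norm S f + L2_norm S g)\<^sup>2"
    by (simp add: power2_sum mult.assoc)
qed simp

lemma L2_norm_cong_AE:
  assumes "f \<in> borel_measurable (lebesgue_on S)" "g \<in> borel_measurable (lebesgue_on S)"
    "AE t in lebesgue_on S. f t = g t"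
  shows "L2_norm S f = L2_norm S g"
proof -
  have [measurable]: "f \<in> borel_measurable (lebesgue_on S)" "g \<in> borel_measurable (lebesgue_on S)"
    by fact+
  have "(LINT t|lebesgue_on S. (norm (f t))\<^sup>2) = (LINT t|lebesgue_on S. (norm (g t))\<^sup>2)"
    by (rule integral_cong_AE) (use assms(3) in auto)
  then show ?thesis by (simp add: L2_norm_def)
qed

lemma L2_norm_finite_diff:
  assumes "S \<in> sets lebesgue" "R \<in> sets lebesgue" "S - R \<subseteq> N" "R - S \<subseteq> N" "finite N"
  shows "L2_norm S f = L2_norm R f"
  by (simp add: L2_norm_def integral_lebesgue_on_finite_diff[OF assms])

lemma L2_square_integrable_on:
  fixes f :: "real \<Rightarrow> 'a::{banach, second_countable_topology}"
  assumes "f \<in> L2 S" "S \<in> sets lebesgue"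
  shows "f square_integrable_on S"
proof -
  obtain s where s: "\<And>i. simple_function (lebesgue_on S) (s i)"
    and lim: "AE t in lebesgue_on S. (\<lambda>i::nat. s i t) \<longlonglongrightarrow> f t"
    and int: "integrable (lebesgue_on S) (\<lambda>t. (norm (f t))\<^sup>2)"
    using assms by (auto simp: L2_def)
  have "f \<in> borel_measurable (lebesgue_on S)"
  proof (rule borel_measurable_lebesgue_on_AE_LIMSEQ)
    show "\<And>i. s i \<in> borel_measurable (lebesgue_on S)"
      using s by (rule borel_measurable_simple_function)
  qed (use lim assms in auto)
  then show ?thesis using int by (simp add: square_integrable_on_def)
qed

section \<open>Antiderivatives and integration by parts\<close>

text \<open>Absolute continuity with density \<open>w\<close>, encoded by the integral identity
  instead of pointwise derivatives: \<open>v\<close> is pinned down at every point of the interval,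
  while \<open>w\<close> matters only up to null sets.\<close>

definition antideriv ::
  "real \<Rightarrow> real \<Rightarrow> (real \<Rightarrow> 'a::{banach, second_countable_topology}) \<Rightarrow> (real \<Rightarrow> 'a) \<Rightarrow> bool" where
  "antideriv a b v w \<longleftrightarrow> integrable (lebesgue_on {a..b}) w \<and>
     (\<forall>x y. a \<le> x \<longrightarrow> x \<le> y \<longrightarrow> y \<le> b \<longrightarrow> v y - v x = integral\<^sup>L (lebesgue_on {x..y}) w)"

lemma antideriv_integrable: "antideriv a b v w \<Longrightarrow> integrable (lebesgue_on {a..b}) w"
  by (simp add: antideriv_def)

lemma antiderivD:
  "antideriv a b v w \<Longrightarrow> a \<le> x \<Longrightarrow> x \<le> y \<Longrightarrow> y \<le> b \<Longrightarrow>
    v y - v x = integral\<^sup>L (lebesgue_on {x..y}) w"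
  by (simp add: antideriv_def)

lemma antideriv_subinterval:
  assumes "antideriv a b v w" "a \<le> c" "d \<le> b"
  shows "antideriv c d v w"
  unfolding antideriv_def
proof safe
  show "integrable (lebesgue_on {c..d}) w"
    by (rule integrable_lebesgue_on_subset[OF antideriv_integrable[OF assms(1)]]) (use assms in auto)
qed (use assms in \<open>auto intro!: antiderivD\<close>)

lemma antideriv_bounded_linear:
  assumes "bounded_linear h" "antideriv a b v w"
  shows "antideriv a b (\<lambda>t. h (v t)) (\<lambda>t. h (w t))"
  unfolding antideriv_def
proof safe
  show "integrable (lebesgue_on {a..b}) (\<lambda>t. h (w t))"
    by (rule integrable_bounded_linear[OF assms(1) antideriv_integrable[OF assms(2)]])
  fix x y assume xy: "a \<le> x" "x \<le> y" "y \<le> b"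
  have "integrable (lebesgue_on {x..y}) w"
    using antideriv_subinterval[OF assms(2) xy(1,3)] by (rule antideriv_integrable)
  then have "integral\<^sup>L (lebesgue_on {x..y}) (\<lambda>t. h (w t)) = h (integral\<^sup>L (lebesgue_on {x..y}) w)"
    by (rule integral_bounded_linear[OF assms(1)])
  then show "h (v y) - h (v x) = integral\<^sup>L (lebesgue_on {x..y}) (\<lambda>t. h (w t))"
    using antiderivD[OF assms(2) xy] by (simp flip: linear_diff[OF bounded_linear.linear[OF assms(1)]])
qed

lemma antideriv_diff:
  assumes "antideriv a b v w" "antideriv a b v' w'"
  shows "antideriv a b (\<lambda>t. v t - v' t) (\<lambda>t. w t - w' t)"
  unfolding antideriv_def
proof safe
  show "integrable (lebesgue_on {a..b}) (\<lambda>t. w t - w' t)"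
    using assms by (intro Bochner_Integration.integrable_diff antideriv_integrable)
  fix x y assume xy: "a \<le> x" "x \<le> y" "y \<le> b"
  have "integrable (lebesgue_on {x..y}) w" "integrable (lebesgue_on {x..y}) w'"
    using antideriv_subinterval[OF _ xy(1,3)] assms antideriv_integrable by blast+
  then have "integral\<^sup>L (lebesgue_on {x..y}) (\<lambda>t. w t - w' t) = (v y - v x) - (v' y - v' x)"
    using antiderivD[OF assms(1) xy] antiderivD[OF assms(2) xy] by simp
  then show "v y - v' y - (v x - v' x) = integral\<^sup>L (lebesgue_on {x..y}) (\<lambda>t. w t - w' t)"
    by simp
qed

lemma antideriv_indefinite_integral:
  fixes w :: "real \<Rightarrow> 'a::{banach, second_countable_topology}"
  assumes "integrable (lebesgue_on {a..b}) w"
  shows "antideriv a b (\<lambda>x. c + integral\<^sup>L (lebesgue_on {a..x}) w) w"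
  unfolding antideriv_def
proof safe
  fix x y assume xy: "a \<le> x" "x \<le> y" "y \<le> b"
  have "integrable (lebesgue_on {a..y}) w"
    by (rule integrable_lebesgue_on_subset[OF assms]) (use xy in auto)
  from integral_lebesgue_on_combine[OF this xy(1,2)]
  show "c + integral\<^sup>L (lebesgue_on {a..y}) w - (c + integral\<^sup>L (lebesgue_on {a..x}) w)
      = integral\<^sup>L (lebesgue_on {x..y}) w" by simp
qed (rule assms)

lemma antideriv_cong_AE:
  assumes "antideriv a b v w" "w' \<in> borel_measurable (lebesgue_on {a..b})"
    "AE t in lebesgue_on {a..b}. w' t = w t"
  shows "antideriv a b v w'"
  unfolding antideriv_def
proof safe
  have w: "w \<in> borel_measurable (lebesgue_on {a..b})"
    using antideriv_integrable[OF assms(1)] by simp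
  show "integrable (lebesgue_on {a..b}) w'"
    using antideriv_integrable[OF assms(1)] integrable_cong_AE[OF assms(2) w assms(3)] by simp
  fix x y assume xy: "a \<le> x" "x \<le> y" "y \<le> b"
  have "integral\<^sup>L (lebesgue_on {x..y}) w' = integral\<^sup>L (lebesgue_on {x..y}) w"
  proof (rule integral_cong_AE)
    show "w' \<in> borel_measurable (lebesgue_on {x..y})" "w \<in> borel_measurable (lebesgue_on {x..y})"
      using borel_measurable_lebesgue_on_subset[of _ "{a..b}" "{x..y}"] assms(2) w xy by auto
    show "AE t in lebesgue_on {x..y}. w' t = w t"
      by (rule AE_lebesgue_on_subset[OF assms(3)]) (use xy in auto)
  qed
  then show "v y - v x = integral\<^sup>L (lebesgue_on {x..y}) w'"
    using antiderivD[OF assms(1) xy] by simp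
qed

lemma antideriv_continuous_on:
  assumes "antideriv a b v w"
  shows "continuous_on {a..b} v"
proof (cases "a \<le> b")
  case True
  have int: "integrable (lebesgue_on {a..b}) w" by (rule antideriv_integrable[OF assms])
  \<comment> \<open>The integral up to \<open>x\<close> becomes an integral over the fixed interval
    with a cut-off in the integrand; dominated convergence with majorant \<open>norm (w t)\<close>
    then applies, the only doubtful point being \<open>t = x\<close>.\<close>
  have "continuous_on {a..b} (\<lambda>x. integral\<^sup>L (lebesgue_on {a..b}) (\<lambda>t. indicat_real {..x} t *\<^sub>R w t))"
    unfolding continuous_on_eq_continuous_within
  proof
    fix x assume "x \<in> {a..b}"
    show "continuous (at x within {a..b}) (\<lambda>x. integral\<^sup>L (lebesgue_on {a..b}) (\<lambda>t. indicat_real {..x} t *\<^sub>R w t))"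
      unfolding continuous_within tendsto_at_iff_sequentially comp_def
    proof safe
      fix X :: "nat \<Rightarrow> real" assume X: "\<forall>i. X i \<in> {a..b} - {x}" "X \<longlonglongrightarrow> x"
      show "(\<lambda>n. integral\<^sup>L (lebesgue_on {a..b}) (\<lambda>t. indicat_real {..X n} t *\<^sub>R w t))
        \<longlonglongrightarrow> integral\<^sup>L (lebesgue_on {a..b}) (\<lambda>t. indicat_real {..x} t *\<^sub>R w t)"
      proof (rule integral_dominated_convergence[where w="\<lambda>t. norm (w t)"])
        have "AE t in lebesgue_on {a..b}. t \<noteq> x"
          by (rule AE_lebesgue_on_insert[where S="{a..b} - {x}" and N="{x}"])
            (auto intro!: AE_I2)
        then show "AE t in lebesgue_on {a..b}. (\<lambda>n. indicat_real {..X n} t *\<^sub>R w t) \<longlonglongrightarrow> indicat_real {..x} t *\<^sub>R w t"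
        proof eventually_elim
          case (elim t)
          have "\<forall>\<^sub>F n in sequentially. indicat_real {..X n} t = indicat_real {..x} t"
          proof (cases "t < x")
            case True
            then have "\<forall>\<^sub>F n in sequentially. t < X n" using X(2) by (intro order_tendstoD)
            then show ?thesis by eventually_elim (use True in auto)
          next
            case False
            with elim have "x < t" by simp
            then have "\<forall>\<^sub>F n in sequentially. X n < t" using X(2) by (intro order_tendstoD)
            then show ?thesis by eventually_elim (use \<open>x < t\<close> in auto)
          qed
          then have "\<forall>\<^sub>F n in sequentially. indicat_real {..X n} t *\<^sub>R w t = indicat_real {..x} t *\<^sub>R w t"
            by eventually_elim simp
          then show ?case by (rule tendsto_eventually)
        qed
        have [measurable]: "w \<in> borel_measurable (lebesgue_on {a..b})" using int by simp
        have [measurable]: "(\<lambda>t. t) \<in> borel_measurable (lebesgue_on {a..b})"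
          using id_borel_measurable_lebesgue_on[of "{a..b}"] by (simp add: id_def)
        have m: "(\<lambda>t. indicat_real {..x} t *\<^sub>R w t) \<in> borel_measurable (lebesgue_on {a..b})" for x
          unfolding indicator_def atMost_iff by measurable
        show "(\<lambda>t. indicat_real {..x} t *\<^sub>R w t) \<in> borel_measurable (lebesgue_on {a..b})"
          "\<And>i. (\<lambda>t. indicat_real {..X i} t *\<^sub>R w t) \<in> borel_measurable (lebesgue_on {a..b})"
          by (rule m)+
        show "integrable (lebesgue_on {a..b}) (\<lambda>t. norm (w t))" using int by simp
      qed (auto simp: indicator_def)
    qed
  qed
  then have "continuous_on {a..b} (\<lambda>x. v a + integral\<^sup>L (lebesgue_on {a..b}) (\<lambda>t. indicat_real {..x} t *\<^sub>R w t))"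
    by (intro continuous_intros)
  moreover have "v a + integral\<^sup>L (lebesgue_on {a..b}) (\<lambda>t. indicat_real {..x} t *\<^sub>R w t) = v x"
    if "x \<in> {a..b}" for x
  proof -
    have "integral\<^sup>L (lebesgue_on {a..b}) (\<lambda>t. indicat_real {..x} t *\<^sub>R w t)
        = integral\<^sup>L (lebesgue_on {a..x}) w"
      using that by (auto simp: integral_restrict_space indicator_def intro!: Bochner_Integration.integral_cong)
    then show ?thesis using antiderivD[OF assms, of a x] that by (simp add: algebra_simps)
  qed
  ultimately show ?thesis by (metis (no_types, lifting) continuous_on_cong)
qed simp

lemma antideriv_square_integrable_on:
  "antideriv a b v w \<Longrightarrow> v square_integrable_on {a..b}"
  by (intro continuous_on_square_integrable_on antideriv_continuous_on)

text \<open>Fubini for the product of \<open>\<phi>' t\<close> and \<open>w s\<close> on the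
  triangle \<open>s \<le> t\<close>. Integrating first in \<open>t\<close> gives
  \<open>(\<phi> b - \<phi> s) *\<^sub>R w s\<close>, integrating first in \<open>s\<close> gives
  \<open>\<phi>' t *\<^sub>R (v t - v a)\<close>.\<close>

lemma integral_by_parts:
  fixes \<phi> :: "real \<Rightarrow> real"
  assumes v: "antideriv a b v w" and "a \<le> b"
    and \<phi>: "\<And>t. (\<phi> has_real_derivative \<phi>' t) (at t)" "continuous_on UNIV \<phi>'"
  shows "integral\<^sup>L (lebesgue_on {a..b}) (\<lambda>t. \<phi>' t *\<^sub>R v t)
    = \<phi> b *\<^sub>R v b - \<phi> a *\<^sub>R v a - integral\<^sup>L (lebesgue_on {a..b}) (\<lambda>t. \<phi> t *\<^sub>R w t)"
proof -
  let ?M = "lebesgue_on {a..b}"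
  have w: "integrable ?M w" by (rule antideriv_integrable[OF v])
  have cont: "continuous_on S \<phi>'" "continuous_on S \<phi>" for S
    using \<phi> by (auto intro: continuous_on_subset DERIV_continuous_on has_field_derivative_at_within)
  interpret finite_measure ?M by (rule finite_measure_lebesgue_on_Icc)
  interpret pair_sigma_finite ?M ?M ..
  have [measurable]: "w \<in> borel_measurable ?M" using w by simp
  have [measurable]: "\<phi>' \<in> borel_measurable ?M" by (intro continuous_on_borel_measurable_lebesgue_on cont)
  have [measurable]: "(\<lambda>t. t) \<in> borel_measurable ?M"
    using id_borel_measurable_lebesgue_on[of "{a..b}"] by (simp add: id_def)
  define F where "F = (\<lambda>(t, s). (if s \<le> t then \<phi>' t else 0) *\<^sub>R w s)"
  have Fm [measurable]: "F \<in> borel_measurable (?M \<Otimes>\<^sub>M ?M)"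
    unfolding F_def by measurable
  have "integrable (?M \<Otimes>\<^sub>M ?M) F"
  proof (rule Fubini_integrable[OF Fm])
    have "integrable ?M (\<lambda>t. norm (\<phi>' t) * (\<integral>s. norm (w s) \<partial>?M))"
      by (intro integrable_mult_left integrable_norm continuous_on_integrable_lebesgue_on cont)
    then show "integrable ?M (\<lambda>t. \<integral>s. norm (F (t, s)) \<partial>?M)"
    proof (rule Bochner_Integration.integrable_bound)
      show "AE t in ?M. norm (\<integral>s. norm (F (t, s)) \<partial>?M) \<le> norm (norm (\<phi>' t) * (\<integral>s. norm (w s) \<partial>?M))"
      proof (rule AE_I2)
        fix t
        have "(\<integral>s. norm (F (t, s)) \<partial>?M) \<le> (\<integral>s. norm (\<phi>' t) * norm (w s) \<partial>?M)"
          using w by (intro integral_mono') (auto simp: F_def)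
        then show "norm (\<integral>s. norm (F (t, s)) \<partial>?M) \<le> norm (norm (\<phi>' t) * (\<integral>s. norm (w s) \<partial>?M))"
          by (simp add: abs_mult)
      qed
    qed measurable
    show "AE t in ?M. integrable ?M (\<lambda>s. F (t, s))"
    proof (rule AE_I2)
      fix t
      have "integrable ?M (\<lambda>s. \<phi>' t *\<^sub>R w s)" using w by simp
      then show "integrable ?M (\<lambda>s. F (t, s))"
        by (rule Bochner_Integration.integrable_bound) (auto simp: F_def)
    qed
  qed
  then have fub: "(\<integral>s. (\<integral>t. F (t, s) \<partial>?M) \<partial>?M) = (\<integral>t. (\<integral>s. F (t, s) \<partial>?M) \<partial>?M)"
    by (intro Fubini_integral) (simp add: case_prod_unfold)
  have inner1: "(\<integral>t. F (t, s) \<partial>?M) = (\<phi> b - \<phi> s) *\<^sub>R w s" if "s \<in> {a..b}" for s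
  proof -
    have "(\<integral>t. F (t, s) \<partial>?M) = (\<integral>t. (if s \<le> t then \<phi>' t else 0) \<partial>?M) *\<^sub>R w s"
      unfolding F_def prod.case
    proof (rule integral_scaleR_left)
      have "integrable ?M \<phi>'" by (intro continuous_on_integrable_lebesgue_on cont)
      then show "integrable ?M (\<lambda>t. if s \<le> t then \<phi>' t else 0)"
        by (rule Bochner_Integration.integrable_bound) auto
    qed
    also have "(\<integral>t. (if s \<le> t then \<phi>' t else 0) \<partial>?M) = integral\<^sup>L (lebesgue_on {s..b}) \<phi>'"
      using that by (auto simp: integral_restrict_space indicator_def intro!: Bochner_Integration.integral_cong)
    also have "\<dots> = \<phi> b - \<phi> s"
      using that by (intro integral_lebesgue_on_FTC \<phi> cont) auto
    finally show ?thesis .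
  qed
  have inner2: "(\<integral>s. F (t, s) \<partial>?M) = \<phi>' t *\<^sub>R (v t - v a)" if "t \<in> {a..b}" for t
  proof -
    have "(\<integral>s. F (t, s) \<partial>?M) = \<phi>' t *\<^sub>R (\<integral>s. indicat_real {..t} s *\<^sub>R w s \<partial>?M)"
      unfolding F_def prod.case integral_scaleR_right[symmetric]
      by (intro Bochner_Integration.integral_cong) (auto simp: indicator_def)
    also have "(\<integral>s. indicat_real {..t} s *\<^sub>R w s \<partial>?M) = integral\<^sup>L (lebesgue_on {a..t}) w"
      using that by (auto simp: integral_restrict_space indicator_def intro!: Bochner_Integration.integral_cong)
    finally show ?thesis using antiderivD[OF v, of a t] that by simp
  qed
  have "(\<integral>s. (\<phi> b - \<phi> s) *\<^sub>R w s \<partial>?M) = (\<integral>s. (\<integral>t. F (t, s) \<partial>?M) \<partial>?M)"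
    by (rule Bochner_Integration.integral_cong) (simp_all add: inner1)
  also have "\<dots> = (\<integral>t. \<phi>' t *\<^sub>R (v t - v a) \<partial>?M)"
    unfolding fub by (rule Bochner_Integration.integral_cong) (simp_all add: inner2)
  finally have eq: "(\<integral>s. (\<phi> b - \<phi> s) *\<^sub>R w s \<partial>?M) = (\<integral>t. \<phi>' t *\<^sub>R (v t - v a) \<partial>?M)" .
  have i: "integrable ?M (\<lambda>s. \<phi> s *\<^sub>R w s)" "integrable ?M (\<lambda>t. \<phi>' t *\<^sub>R v t)" "integrable ?M \<phi>'"
    by (intro integrable_continuous_scaleR cont w)
      (intro continuous_on_integrable_lebesgue_on continuous_intros cont antideriv_continuous_on[OF v])+
  have rhs: "(\<integral>s. (\<phi> b - \<phi> s) *\<^sub>R w s \<partial>?M) = \<phi> b *\<^sub>R (v b - v a) - (\<integral>s. \<phi> s *\<^sub>R w s \<partial>?M)"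
    using w i antiderivD[OF v, of a b] \<open>a \<le> b\<close> by (simp add: scaleR_left_diff_distrib)
  have lhs: "(\<integral>t. \<phi>' t *\<^sub>R (v t - v a) \<partial>?M) = (\<integral>t. \<phi>' t *\<^sub>R v t \<partial>?M) - (\<phi> b - \<phi> a) *\<^sub>R v a"
  proof -
    have "(\<integral>t. \<phi>' t *\<^sub>R (v t - v a) \<partial>?M) = (\<integral>t. \<phi>' t *\<^sub>R v t \<partial>?M) - (\<integral>t. \<phi>' t *\<^sub>R v a \<partial>?M)"
      using i by (simp add: scaleR_right_diff_distrib)
    also have "(\<integral>t. \<phi>' t *\<^sub>R v a \<partial>?M) = (\<integral>t. \<phi>' t \<partial>?M) *\<^sub>R v a"
      using i by simp
    also have "(\<integral>t. \<phi>' t \<partial>?M) = \<phi> b - \<phi> a"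
      using \<open>a \<le> b\<close> by (intro integral_lebesgue_on_FTC \<phi> cont) auto
    finally show ?thesis .
  qed
  have "(\<integral>t. \<phi>' t *\<^sub>R v t \<partial>?M)
      = \<phi> b *\<^sub>R (v b - v a) - (\<integral>s. \<phi> s *\<^sub>R w s \<partial>?M) + (\<phi> b - \<phi> a) *\<^sub>R v a"
    unfolding rhs[symmetric] eq lhs by simp
  also have "\<dots> = \<phi> b *\<^sub>R v b - \<phi> a *\<^sub>R v a - (\<integral>s. \<phi> s *\<^sub>R w s \<partial>?M)"
    by (simp add: scaleR_right_diff_distrib scaleR_left_diff_distrib)
  finally show ?thesis .
qed

section \<open>Test functions and weak derivatives\<close>

text \<open>For \<open>p = 1\<close> this is the classical smooth function exp(-c/t), flat at 0. The
  polynomial in 1/t closes the family under differentiation, and letting \<open>c\<close> tend to 0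
  produces indicators.\<close>

definition flat_exp :: "real \<Rightarrow> real poly \<Rightarrow> real \<Rightarrow> real" where
  "flat_exp c p t = (if t > 0 then poly p (1 / t) * exp (- c / t) else 0)"

lemma poly_times_exp_tendsto_0:
  fixes c :: real
  assumes "c > 0"
  shows "((\<lambda>s. poly p s * exp (- (c * s))) \<longlongrightarrow> 0) at_top"
proof -
  have 1: "((\<lambda>s. s ^ i * exp (- (c * s))) \<longlongrightarrow> 0) at_top" for i
  proof -
    have "filterlim (\<lambda>s. c * s) at_top at_top"
      using assms by (intro filterlim_tendsto_pos_mult_at_top[OF tendsto_const] filterlim_ident)
    then have "((\<lambda>s. (c * s) ^ i / exp (c * s)) \<longlongrightarrow> 0) at_top"
      by (rule filterlim_compose[OF tendsto_power_div_exp_0])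
    then have "((\<lambda>s. (c * s) ^ i / exp (c * s) / c ^ i) \<longlongrightarrow> 0 / c ^ i) at_top"
      by (intro tendsto_divide tendsto_const) (use assms in auto)
    moreover have "(c * s) ^ i / exp (c * s) / c ^ i = s ^ i * exp (- (c * s))" for s
      using assms by (simp add: power_mult_distrib exp_minus field_simps)
    ultimately show ?thesis by simp
  qed
  have "((\<lambda>s. \<Sum>i\<le>degree p. coeff p i * (s ^ i * exp (- (c * s)))) \<longlongrightarrow> (\<Sum>i\<le>degree p. coeff p i * 0)) at_top"
    by (intro tendsto_sum tendsto_mult tendsto_const 1)
  then show ?thesis
    by (simp add: poly_altdef sum_distrib_right mult.assoc)
qed

text \<open>For positive \<open>t\<close> the chain rule brings out the factor 1/t^2, which is
  \<open>[:0, 0, 1:]\<close> evaluated at 1/t.\<close>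

lemma flat_exp_has_real_derivative:
  assumes "c > 0"
  shows "(flat_exp c p has_real_derivative flat_exp c ([:0, 0, 1:] * (smult c p - pderiv p)) t) (at t)"
proof (cases t "0::real" rule: linorder_cases)
  case less
  have "((\<lambda>_. 0) has_real_derivative 0) (at t)" by simp
  then have "(flat_exp c p has_real_derivative 0) (at t)"
    by (rule has_field_derivative_transform_within_open[where S="{..<0}"]) (use less in \<open>auto simp: flat_exp_def\<close>)
  then show ?thesis using less by (simp add: flat_exp_def)
next
  case greater
  have "((\<lambda>t. poly p (1 / t) * exp (- c / t)) has_real_derivative
      flat_exp c ([:0, 0, 1:] * (smult c p - pderiv p)) t) (at t)"
    using greater
    by (auto intro!: derivative_eq_intros simp: flat_exp_def power2_eq_square field_simps)
  then show ?thesis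
    by (rule has_field_derivative_transform_within_open[where S="{0<..}"]) (use greater in \<open>auto simp: flat_exp_def\<close>)
next
  case equal
  have "((\<lambda>y. (flat_exp c p y - flat_exp c p 0) / (y - 0)) \<longlongrightarrow> 0) (at 0)"
  proof (rule filterlim_split_at)
    have "\<forall>\<^sub>F y in at_left 0. (flat_exp c p y - flat_exp c p 0) / (y - 0) = 0"
      by (auto simp: flat_exp_def eventually_at_filter)
    then show "((\<lambda>y. (flat_exp c p y - flat_exp c p 0) / (y - 0)) \<longlongrightarrow> 0) (at_left 0)"
      by (rule tendsto_eventually)
    \<comment> \<open>The difference quotient at 0 contributes one further factor 1/y, hence
      \<open>[:0, 1:] * p\<close>; the exponential beats every polynomial in 1/y.\<close>
    have "((\<lambda>y. poly ([:0, 1:] * p) (inverse y) * exp (- (c * inverse y))) \<longlongrightarrow> 0) (at_right 0)"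
      by (rule filterlim_compose[OF poly_times_exp_tendsto_0[OF assms] filterlim_inverse_at_top_right])
    then show "((\<lambda>y. (flat_exp c p y - flat_exp c p 0) / (y - 0)) \<longlongrightarrow> 0) (at_right 0)"
      by (rule Lim_transform_eventually)
        (auto simp: flat_exp_def eventually_at_filter divide_inverse mult_ac)
  qed
  then show ?thesis unfolding equal has_field_derivative_iff by (simp add: flat_exp_def)
qed

text \<open>Large enough to contain bumps and their linear combinations, and closed under
  differentiation; smoothness of every order thus follows from one induction over the
  generators.\<close>

inductive_set flat_exp_algebra :: "(real \<Rightarrow> real) set" where
  right: "c > 0 \<Longrightarrow> (\<lambda>t. flat_exp c p (t - x)) \<in> flat_exp_algebra"
| left: "c > 0 \<Longrightarrow> (\<lambda>t. flat_exp c p (x - t)) \<in> flat_exp_algebra"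
| add: "f \<in> flat_exp_algebra \<Longrightarrow> g \<in> flat_exp_algebra \<Longrightarrow> (\<lambda>t. f t + g t) \<in> flat_exp_algebra"
| mult: "f \<in> flat_exp_algebra \<Longrightarrow> g \<in> flat_exp_algebra \<Longrightarrow> (\<lambda>t. f t * g t) \<in> flat_exp_algebra"
| cmult: "f \<in> flat_exp_algebra \<Longrightarrow> (\<lambda>t. r * f t) \<in> flat_exp_algebra"

lemma flat_exp_algebra_derivative:
  "f \<in> flat_exp_algebra \<Longrightarrow> \<exists>f'\<in>flat_exp_algebra. \<forall>t. (f has_real_derivative f' t) (at t)"
proof (induction rule: flat_exp_algebra.induct)
  case (right c p x)
  let ?q = "[:0, 0, 1:] * (smult c p - pderiv p)"
  have "((\<lambda>t. flat_exp c p (t - x)) has_real_derivative flat_exp c ?q (t - x) * 1) (at t)" for t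
    by (rule DERIV_chain2[OF flat_exp_has_real_derivative[OF right]]) (auto intro!: derivative_eq_intros)
  then have "((\<lambda>t. flat_exp c p (t - x)) has_real_derivative flat_exp c ?q (t - x)) (at t)" for t
    unfolding mult_1_right .
  moreover have "(\<lambda>t. flat_exp c ?q (t - x)) \<in> flat_exp_algebra"
    by (rule flat_exp_algebra.right[OF right])
  ultimately show ?case by (intro bexI[where x="\<lambda>t. flat_exp c ?q (t - x)"] allI)
next
  case (left c p x)
  let ?q = "[:0, 0, 1:] * (smult c p - pderiv p)"
  have "((\<lambda>t. flat_exp c p (x - t)) has_real_derivative flat_exp c ?q (x - t) * (-1)) (at t)" for t
    by (rule DERIV_chain2[OF flat_exp_has_real_derivative[OF left]]) (auto intro!: derivative_eq_intros)
  then have "((\<lambda>t. flat_exp c p (x - t)) has_real_derivative (-1) * flat_exp c ?q (x - t)) (at t)" for t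
    unfolding mult.commute[of _ "-1 :: real"] .
  moreover have "(\<lambda>t. (-1) * flat_exp c ?q (x - t)) \<in> flat_exp_algebra"
    by (rule flat_exp_algebra.cmult[OF flat_exp_algebra.left[OF left]])
  ultimately show ?case by (intro bexI[where x="\<lambda>t. (-1) * flat_exp c ?q (x - t)"] allI)
next
  case (add f g)
  then obtain f' g' where "f' \<in> flat_exp_algebra" "\<forall>t. (f has_real_derivative f' t) (at t)"
    "g' \<in> flat_exp_algebra" "\<forall>t. (g has_real_derivative g' t) (at t)" by blast
  then show ?case
    by (intro bexI[where x="\<lambda>t. f' t + g' t"] allI DERIV_add flat_exp_algebra.add) simp_all
next
  case (mult f g)
  then obtain f' g' where "f' \<in> flat_exp_algebra" "\<forall>t. (f has_real_derivative f' t) (at t)"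
    "g' \<in> flat_exp_algebra" "\<forall>t. (g has_real_derivative g' t) (at t)" by blast
  with mult.hyps show ?case
    by (intro bexI[where x="\<lambda>t. f' t * g t + g' t * f t"] allI DERIV_mult
        flat_exp_algebra.add[OF flat_exp_algebra.mult flat_exp_algebra.mult]) simp_all
next
  case (cmult f r)
  then obtain f' where "f' \<in> flat_exp_algebra" "\<forall>t. (f has_real_derivative f' t) (at t)" by blast
  then show ?case
    by (intro bexI[where x="\<lambda>t. r * f' t"] allI DERIV_cmult flat_exp_algebra.cmult) simp_all
qed

lemma funpow_deriv_flat_exp_algebra:
  "f \<in> flat_exp_algebra \<Longrightarrow> (deriv ^^ j) f \<in> flat_exp_algebra"
proof (induction j arbitrary: f)
  case (Suc j)
  then obtain f' where f': "f' \<in> flat_exp_algebra" "\<forall>t. (f has_real_derivative f' t) (at t)"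
    using flat_exp_algebra_derivative by blast
  then have "deriv f = f'" by (auto intro: DERIV_imp_deriv)
  with Suc.IH[OF f'(1)] show ?case by (simp add: funpow_swap1)
qed simp

lemma flat_exp_algebra_continuous:
  assumes "f \<in> flat_exp_algebra" shows "continuous_on S f"
proof -
  obtain f' where "\<And>t. (f has_real_derivative f' t) (at t)"
    using flat_exp_algebra_derivative[OF assms] by blast
  then show ?thesis by (rule DERIV_continuous_on[OF has_field_derivative_at_within])
qed

text \<open>Off the support of \<open>G\<close> an antiderivative is constant on either side; mean
  value zero makes the two constants equal, so subtracting that constant leaves a function with
  compact support.\<close>

lemma test_function_antiderivative:
  assumes G: "G \<in> flat_exp_algebra" and supp: "\<And>t. t \<notin> {c..d} \<Longrightarrow> G t = 0"
    and "a < c" "c \<le> d" "d < b" and int: "integral\<^sup>L (lebesgue_on {a..b}) G = 0"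
  obtains \<phi> where "\<phi> \<in> test_functions {a<..<b}" "\<And>t. (\<phi> has_real_derivative G t) (at t)"
    "\<phi> a = 0" "\<phi> b = 0"
proof -
  \<comment> \<open>The antiderivative is taken on the whole line because
    \<open>test_functions\<close> demands smoothness at every real point, also outside
    \<open>(a,b)\<close>.\<close>
  have "\<exists>F. \<forall>x :: real. (-\<infinity>::ereal) < ereal x \<longrightarrow> ereal x < (\<infinity>::ereal) \<longrightarrow> (F has_vector_derivative G x) (at x)"
  proof (rule einterval_antiderivative)
    show "isCont G x" for x
      using flat_exp_algebra_continuous[OF G, of UNIV] by (simp add: continuous_on_eq_continuous_at)
  qed simp
  then obtain F where F: "\<And>x. (F has_real_derivative G x) (at x)"
    by (auto simp: has_real_derivative_iff_has_vector_derivative)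
  define \<phi> where "\<phi> = (\<lambda>t. F t - F a)"
  have \<phi>: "(\<phi> has_real_derivative G t) (at t)" for t
    unfolding \<phi>_def by (auto intro!: derivative_eq_intros F)
  have FTC: "F y - F x = integral\<^sup>L (lebesgue_on {x..y}) G" if "x \<le> y" for x y
    by (rule integral_lebesgue_on_FTC[symmetric]) (use that F flat_exp_algebra_continuous[OF G] in auto)
  have const: "F x = F y" if "x \<le> y" "y \<le> c \<or> d \<le> x" for x y
  proof -
    have "AE t in lebesgue_on {x..y}. G t = 0"
      by (rule AE_lebesgue_on_insert[where S="{x..y} - {c, d}" and N="{c, d}"])
        (use supp that in \<open>auto intro!: AE_I2\<close>)
    then have "integral\<^sup>L (lebesgue_on {x..y}) G = 0" by (rule integral_eq_zero_AE)
    with FTC[OF that(1)] show ?thesis by simp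
  qed
  have ab: "F b = F a" using FTC[of a b] int assms by simp
  show ?thesis
  proof
    have zero: "\<phi> t = 0" if "t \<notin> {c..d}" for t
    proof (cases "t < c")
      case True
      then have "F t = F a"
        using const[of t a] const[of a t, symmetric] assms by (meson less_imp_le linear order_trans)
      then show ?thesis by (simp add: \<phi>_def)
    next
      case False
      with that have "d < t" by auto
      then have "F t = F b"
        using const[of t b] const[of b t, symmetric] assms by (meson less_imp_le linear order_trans)
      then show ?thesis using ab by (simp add: \<phi>_def)
    qed
    have smooth: "(deriv ^^ j) \<phi> field_differentiable at t" for j t
    proof (cases j)
      case 0
      then show ?thesis using \<phi>[of t] by (auto simp: field_differentiable_def)
    next
      case (Suc i)
      have "deriv \<phi> = G" using \<phi> by (auto intro: DERIV_imp_deriv)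
      then have "(deriv ^^ j) \<phi> = (deriv ^^ i) G" by (simp add: Suc funpow_swap1)
      then show ?thesis
        using flat_exp_algebra_derivative[OF funpow_deriv_flat_exp_algebra[OF G, of i]]
        by (auto simp: field_differentiable_def)
    qed
    have "compact {c..d}" "{c..d} \<subseteq> {a<..<b}" using assms by auto
    with zero smooth show "\<phi> \<in> test_functions {a<..<b}"
      unfolding test_functions_def by blast
  qed (use \<phi> ab in \<open>auto simp: \<phi>_def\<close>)
qed

text \<open>Only the decay parameter \<open>1 / Suc k\<close> depends on \<open>k\<close>: the
  functions vanish off the same interval for all \<open>k\<close>, stay bounded by 1, and tend to
  the indicator of \<open>(x,y)\<close>.\<close>

definition smooth_indicator :: "real \<Rightarrow> real \<Rightarrow> nat \<Rightarrow> real \<Rightarrow> real" where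
  "smooth_indicator x y k t
    = flat_exp (1 / real (Suc k)) 1 (t - x) * flat_exp (1 / real (Suc k)) 1 (y - t)"

lemma smooth_indicator_algebra: "smooth_indicator x y k \<in> flat_exp_algebra"
proof -
  have "smooth_indicator x y k
      = (\<lambda>t. flat_exp (1 / real (Suc k)) 1 (t - x) * flat_exp (1 / real (Suc k)) 1 (y - t))"
    by (simp add: fun_eq_iff smooth_indicator_def)
  then show ?thesis
    by (simp only:, intro flat_exp_algebra.mult[OF flat_exp_algebra.right flat_exp_algebra.left]) simp_all
qed

lemma smooth_indicator_eq_0: "t \<notin> {x<..<y} \<Longrightarrow> smooth_indicator x y k t = 0"
  by (auto simp: smooth_indicator_def flat_exp_def)

lemma smooth_indicator_bounds: "\<bar>smooth_indicator x y k t\<bar> \<le> 1"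
proof -
  have "0 \<le> flat_exp (1 / real (Suc k)) 1 s" "flat_exp (1 / real (Suc k)) 1 s \<le> 1" for s
    by (auto simp: flat_exp_def)
  then show ?thesis
    unfolding smooth_indicator_def by (simp add: mult_le_one)
qed

lemma smooth_indicator_tendsto:
  "(\<lambda>k. smooth_indicator x y k t) \<longlonglongrightarrow> indicat_real {x<..<y} t"
proof (cases "t \<in> {x<..<y}")
  case True
  have "(\<lambda>k. exp (- (1 / real (Suc k)) / s)) \<longlonglongrightarrow> exp (- 0 / s)" for s :: real
    unfolding divide_inverse[of _ s]
    by (intro tendsto_exp tendsto_mult tendsto_minus tendsto_const LIMSEQ_Suc[OF lim_1_over_n])
  then have "(\<lambda>k. exp (- (1 / real (Suc k)) / (t - x)) * exp (- (1 / real (Suc k)) / (y - t)))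
      \<longlonglongrightarrow> exp (- 0 / (t - x)) * exp (- 0 / (y - t))"
    by (intro tendsto_mult)
  then show ?thesis using True by (simp add: smooth_indicator_def flat_exp_def)
next
  case False
  then show ?thesis by (simp add: smooth_indicator_eq_0)
qed

lemma integral_smooth_indicator_tendsto:
  fixes z :: "real \<Rightarrow> 'a::{banach, second_countable_topology}"
  assumes "integrable (lebesgue_on {a..b}) z" "a \<le> x" "y \<le> b"
  shows "(\<lambda>k. integral\<^sup>L (lebesgue_on {a..b}) (\<lambda>t. smooth_indicator x y k t *\<^sub>R z t))
    \<longlonglongrightarrow> integral\<^sup>L (lebesgue_on {x..y}) z"
proof -
  have [measurable]: "z \<in> borel_measurable (lebesgue_on {a..b})" using assms(1) by simp
  have [measurable]: "smooth_indicator x y k \<in> borel_measurable (lebesgue_on {a..b})" for k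
    by (intro continuous_on_borel_measurable_lebesgue_on flat_exp_algebra_continuous smooth_indicator_algebra)
  have [measurable]: "(\<lambda>t. t) \<in> borel_measurable (lebesgue_on {a..b})"
    using id_borel_measurable_lebesgue_on[of "{a..b}"] by (simp add: id_def)
  have "(\<lambda>k. integral\<^sup>L (lebesgue_on {a..b}) (\<lambda>t. smooth_indicator x y k t *\<^sub>R z t))
    \<longlonglongrightarrow> integral\<^sup>L (lebesgue_on {a..b}) (\<lambda>t. indicat_real {x<..<y} t *\<^sub>R z t)"
  proof (rule integral_dominated_convergence[where w="\<lambda>t. norm (z t)"])
    show "(\<lambda>t. indicat_real {x<..<y} t *\<^sub>R z t) \<in> borel_measurable (lebesgue_on {a..b})"
      unfolding indicator_def greaterThanLessThan_iff by measurable
    show "AE t in lebesgue_on {a..b}. norm (smooth_indicator x y k t *\<^sub>R z t) \<le> norm (z t)" for k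
      using smooth_indicator_bounds[of x y k] by (simp add: mult_left_le_one_le)
    show "AE t in lebesgue_on {a..b}. (\<lambda>k. smooth_indicator x y k t *\<^sub>R z t) \<longlonglongrightarrow> indicat_real {x<..<y} t *\<^sub>R z t"
      by (intro AE_I2 tendsto_scaleR smooth_indicator_tendsto tendsto_const)
  qed (use assms in auto)
  also have "integral\<^sup>L (lebesgue_on {a..b}) (\<lambda>t. indicat_real {x<..<y} t *\<^sub>R z t)
      = integral\<^sup>L (lebesgue_on {x<..<y}) z"
    using assms by (auto simp: integral_restrict_space indicator_def intro!: Bochner_Integration.integral_cong)
  also have "\<dots> = integral\<^sup>L (lebesgue_on {x..y}) z"
    by (rule integral_lebesgue_on_finite_diff[where N="{x, y}"]) auto
  finally show ?thesis .
qed

text \<open>Different limits would force \<open>f\<close> and \<open>g\<close> to differ at all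
  points near \<open>x\<close>, against equality almost everywhere on an interval of positive
  length. \<open>S\<close> may lie on one side of \<open>x\<close>, so this covers end
  points.\<close>

lemma tendsto_AE_unique:
  fixes f g :: "real \<Rightarrow> 'a::metric_space"
  assumes "(f \<longlongrightarrow> l) (at x within S)" "(g \<longlongrightarrow> m) (at x within S)"
    and ae: "AE t in lebesgue_on S. f t = g t" and S: "S \<in> sets lebesgue"
    and nontriv: "\<And>e. e > 0 \<Longrightarrow> \<exists>c d. c < d \<and> {c..d} \<subseteq> S \<inter> ball x e"
  shows "l = m"
proof (rule ccontr)
  assume "l \<noteq> m"
  define e where "e = dist l m / 2"
  have "e > 0" using \<open>l \<noteq> m\<close> by (simp add: e_def)
  have "\<forall>\<^sub>F t in at x within S. dist (f t) l < e" "\<forall>\<^sub>F t in at x within S. dist (g t) m < e"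
    using assms(1,2) \<open>e > 0\<close> by (auto dest: tendstoD)
  then have "\<forall>\<^sub>F t in at x within S. f t \<noteq> g t"
  proof eventually_elim
    case (elim t)
    then show ?case using dist_triangle2[of l m "f t"] by (auto simp: e_def dist_commute)
  qed
  then obtain r where r: "r > 0" "\<And>t. t \<in> S \<Longrightarrow> t \<noteq> x \<Longrightarrow> dist t x < r \<Longrightarrow> f t \<noteq> g t"
    unfolding eventually_at by blast
  obtain c d where cd: "c < d" "{c..d} \<subseteq> S \<inter> ball x r" using nontriv[OF r(1)] by blast
  have "AE t in lebesgue_on {c..d}. f t = g t"
    by (rule AE_lebesgue_on_subset[OF ae]) (use cd S in auto)
  moreover have "AE t in lebesgue_on {c..d}. t \<noteq> x"
    by (rule AE_lebesgue_on_insert[where S="{c..d} - {x}" and N="{x}"]) (auto intro!: AE_I2)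
  moreover have "AE t in lebesgue_on {c..d}. t \<noteq> x \<longrightarrow> f t \<noteq> g t"
  proof (rule AE_I2, rule impI)
    fix t assume "t \<in> space (lebesgue_on {c..d})" "t \<noteq> x"
    then have "t \<in> S \<inter> ball x r" using cd(2) by auto
    then show "f t \<noteq> g t" using r(2)[of t] \<open>t \<noteq> x\<close> by (simp add: dist_commute)
  qed
  ultimately have "AE t in lebesgue_on {c..d}. False" by eventually_elim auto
  then have "AE t in lebesgue_on {c..d}. (1 :: real) = 0" by eventually_elim simp
  then have "integral\<^sup>L (lebesgue_on {c..d}) (\<lambda>_. 1 :: real) = 0" by (rule integral_eq_zero_AE)
  with \<open>c < d\<close> show False by simp
qed

lemma continuous_on_AE_eq:
  fixes f g :: "real \<Rightarrow> 'a::metric_space"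
  assumes "continuous_on {a..b} f" "continuous_on {a..b} g" "a < b"
    and "AE t in lebesgue_on {a..b}. f t = g t" and x: "x \<in> {a..b}"
  shows "f x = g x"
proof (rule tendsto_AE_unique)
  show "(f \<longlongrightarrow> f x) (at x within {a..b})" "(g \<longlongrightarrow> g x) (at x within {a..b})"
    using assms by (auto simp: continuous_on_def)
  fix e :: real assume "e > 0"
  show "\<exists>c d. c < d \<and> {c..d} \<subseteq> {a..b} \<inter> ball x e"
  proof (cases "x < b")
    case True
    then show ?thesis using \<open>e > 0\<close> x
      by (intro exI[of _ x] exI[of _ "min b (x + e / 2)"]) (auto simp: dist_real_def)
  next
    case False
    then show ?thesis using \<open>e > 0\<close> x \<open>a < b\<close>
      by (intro exI[of _ "max a (x - e / 2)"] exI[of _ x]) (auto simp: dist_real_def)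
  qed
qed (use assms in auto)

text \<open>Du Bois-Reymond: for \<open>z = u - \<integral>w\<close> the integral of \<open>\<phi>' z\<close> vanishes for every test function \<open>\<phi>\<close>.
  The derivative \<open>\<phi>'\<close> may be a combination with mean value zero of smoothed indicators of two intervals,
  so that in the limit the mean value of \<open>z\<close> is the same on all intervals.\<close>

theorem weak_derivative_antideriv:
  fixes u w :: "real \<Rightarrow> 'a::{banach, second_countable_topology}"
  assumes "a < b" and u: "integrable (lebesgue_on {a..b}) u" and w: "integrable (lebesgue_on {a..b}) w"
    and weak: "\<And>\<phi>. \<phi> \<in> test_functions {a<..<b} \<Longrightarrow>
      integral\<^sup>L (lebesgue_on {a..b}) (\<lambda>t. deriv \<phi> t *\<^sub>R u t)
        = - integral\<^sup>L (lebesgue_on {a..b}) (\<lambda>t. \<phi> t *\<^sub>R w t)"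
  obtains v where "antideriv a b v w" "AE t in lebesgue_on {a..b}. u t = v t"
proof -
  let ?M = "lebesgue_on {a..b}"
  define W where "W = (\<lambda>x. 0 + integral\<^sup>L (lebesgue_on {a..x}) w)"
  have W: "antideriv a b W w" unfolding W_def by (rule antideriv_indefinite_integral[OF w])
  have Wint: "integrable ?M W"
    by (rule continuous_on_integrable_lebesgue_on[OF antideriv_continuous_on[OF W]])
  define z where "z = (\<lambda>t. u t - W t)"
  have z: "integrable ?M z" unfolding z_def using u Wint by simp
  have Gz: "(\<integral>t. G t *\<^sub>R z t \<partial>?M) = 0"
    if G: "G \<in> flat_exp_algebra" and supp: "\<And>t. t \<notin> {c..d} \<Longrightarrow> G t = 0"
      and order: "a < c" "c \<le> d" "d < b" and int: "integral\<^sup>L ?M G = 0" for G c d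
  proof -
    obtain \<phi> where \<phi>: "\<phi> \<in> test_functions {a<..<b}" "\<And>t. (\<phi> has_real_derivative G t) (at t)"
      "\<phi> a = 0" "\<phi> b = 0"
      using test_function_antiderivative[OF G supp order int] by metis
    have "deriv \<phi> = G" using \<phi> by (auto intro: DERIV_imp_deriv)
    with weak[OF \<phi>(1)] have "(\<integral>t. G t *\<^sub>R u t \<partial>?M) = - (\<integral>t. \<phi> t *\<^sub>R w t \<partial>?M)" by simp
    moreover have "(\<integral>t. G t *\<^sub>R W t \<partial>?M) = - (\<integral>t. \<phi> t *\<^sub>R w t \<partial>?M)"
      using integral_by_parts[OF W _ \<phi>(2) flat_exp_algebra_continuous[OF G]] \<phi>(3,4) \<open>a < b\<close> by simp
    moreover have "integrable ?M (\<lambda>t. G t *\<^sub>R u t)" "integrable ?M (\<lambda>t. G t *\<^sub>R W t)"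
      by (intro integrable_continuous_scaleR flat_exp_algebra_continuous[OF G] u Wint)+
    ultimately show ?thesis by (simp add: z_def scaleR_right_diff_distrib)
  qed
  \<comment> \<open>The middle third serves as reference interval: it lies strictly inside
    \<open>(a,b)\<close>, where test functions are available, and the mean \<open>r\<close> of
    \<open>z\<close> over it is compared with the mean over every other inner interval.\<close>
  define x' y' where "x' = (2 * a + b) / 3" "y' = (a + 2 * b) / 3"
  have x'y': "a < x'" "x' < y'" "y' < b" using \<open>a < b\<close> by (auto simp: x'_y'_def)
  define r where "r = inverse (y' - x') *\<^sub>R integral\<^sup>L (lebesgue_on {x'..y'}) z"
  have mean: "integral\<^sup>L (lebesgue_on {x..y}) z = (y - x) *\<^sub>R r" if xy: "a < x" "x \<le> y" "y < b" for x y
  proof -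
    let ?\<psi> = "smooth_indicator x y" and ?\<psi>' = "smooth_indicator x' y'"
    note alg = smooth_indicator_algebra
    have int: "integrable ?M (smooth_indicator x y k)" for x y k
      by (intro continuous_on_integrable_lebesgue_on flat_exp_algebra_continuous alg)
    have intz: "integrable ?M (\<lambda>t. smooth_indicator x y k t *\<^sub>R z t)" for x y k
      by (intro integrable_continuous_scaleR flat_exp_algebra_continuous alg z)
    have eq: "integral\<^sup>L ?M (?\<psi>' k) *\<^sub>R (\<integral>t. ?\<psi> k t *\<^sub>R z t \<partial>?M)
        = integral\<^sup>L ?M (?\<psi> k) *\<^sub>R (\<integral>t. ?\<psi>' k t *\<^sub>R z t \<partial>?M)" for k
    proof -
      \<comment> \<open>Each bump is multiplied by the integral of the other one, so that the
        difference has mean value zero.\<close>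
      let ?c = "integral\<^sup>L ?M (?\<psi>' k)" and ?d = "integral\<^sup>L ?M (?\<psi> k)"
      have "(\<integral>t. (?c * ?\<psi> k t + (- ?d) * ?\<psi>' k t) *\<^sub>R z t \<partial>?M) = 0"
      proof (rule Gz[where c="min x x'" and d="max y y'"])
        show "(\<lambda>t. ?c * ?\<psi> k t + - ?d * ?\<psi>' k t) \<in> flat_exp_algebra"
          by (intro flat_exp_algebra.add[OF flat_exp_algebra.cmult flat_exp_algebra.cmult] alg)
        show "?c * ?\<psi> k t + - ?d * ?\<psi>' k t = 0" if "t \<notin> {min x x'..max y y'}" for t
        proof -
          have "t \<notin> {x<..<y}" "t \<notin> {x'<..<y'}" using that by auto
          then show ?thesis by (simp add: smooth_indicator_eq_0)
        qed
        show "(\<integral>t. ?c * ?\<psi> k t + - ?d * ?\<psi>' k t \<partial>?M) = 0"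
          using int[of x y k] int[of x' y' k] by simp
      qed (use xy x'y' in auto)
      moreover have "(\<integral>t. (?c * ?\<psi> k t + (- ?d) * ?\<psi>' k t) *\<^sub>R z t \<partial>?M)
        = ?c *\<^sub>R (\<integral>t. ?\<psi> k t *\<^sub>R z t \<partial>?M) - ?d *\<^sub>R (\<integral>t. ?\<psi>' k t *\<^sub>R z t \<partial>?M)"
        using intz[of x y k] intz[of x' y' k]
        by (simp add: scaleR_left_diff_distrib flip: scaleR_scaleR)
      ultimately show ?thesis by simp
    qed
    have one: "integrable ?M (\<lambda>_. 1 :: real)" by (rule continuous_on_integrable_lebesgue_on) simp
    have lim: "(\<lambda>k. integral\<^sup>L ?M (smooth_indicator x y k)) \<longlonglongrightarrow> y - x" if "a \<le> x" "x \<le> y" "y \<le> b" for x y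
      using integral_smooth_indicator_tendsto[OF one that(1,3)] that by simp
    have "(\<lambda>k. integral\<^sup>L ?M (?\<psi>' k) *\<^sub>R (\<integral>t. ?\<psi> k t *\<^sub>R z t \<partial>?M))
        \<longlonglongrightarrow> (y' - x') *\<^sub>R integral\<^sup>L (lebesgue_on {x..y}) z"
      using xy x'y' by (intro tendsto_scaleR lim integral_smooth_indicator_tendsto z) auto
    moreover have "(\<lambda>k. integral\<^sup>L ?M (?\<psi>' k) *\<^sub>R (\<integral>t. ?\<psi> k t *\<^sub>R z t \<partial>?M))
        \<longlonglongrightarrow> (y - x) *\<^sub>R integral\<^sup>L (lebesgue_on {x'..y'}) z"
      unfolding eq using xy x'y' by (intro tendsto_scaleR lim integral_smooth_indicator_tendsto z) auto
    ultimately have "(y' - x') *\<^sub>R integral\<^sup>L (lebesgue_on {x..y}) z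
        = (y - x) *\<^sub>R integral\<^sup>L (lebesgue_on {x'..y'}) z"
      by (rule LIMSEQ_unique)
    then have "inverse (y' - x') *\<^sub>R (y' - x') *\<^sub>R integral\<^sup>L (lebesgue_on {x..y}) z
        = inverse (y' - x') *\<^sub>R (y - x) *\<^sub>R integral\<^sup>L (lebesgue_on {x'..y'}) z"
      by simp
    then show ?thesis using x'y' by (simp add: r_def mult.commute)
  qed
  have zr: "integrable ?M (\<lambda>t. z t - r)"
    by (rule Bochner_Integration.integrable_diff[OF z continuous_on_integrable_lebesgue_on]) simp
  define V where "V = (\<lambda>x. 0 + integral\<^sup>L (lebesgue_on {a..x}) (\<lambda>t. z t - r))"
  have V: "antideriv a b V (\<lambda>t. z t - r)" unfolding V_def by (rule antideriv_indefinite_integral[OF zr])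
  have Vle: "V x = V y" if "a < x" "x \<le> y" "y < b" for x y
  proof -
    have "integrable (lebesgue_on {x..y}) z"
      by (rule integrable_lebesgue_on_subset[OF z]) (use that in auto)
    moreover have "integrable (lebesgue_on {x..y}) (\<lambda>_. r)"
      by (rule continuous_on_integrable_lebesgue_on) simp
    ultimately have "integral\<^sup>L (lebesgue_on {x..y}) (\<lambda>t. z t - r) = 0"
      using mean[OF that] that by simp
    then show ?thesis using antiderivD[OF V, of x y] that by simp
  qed
  \<comment> \<open>The mean value identity concerns intervals strictly inside \<open>(a,b)\<close>;
    continuity of \<open>V\<close> extends it to those that touch \<open>a\<close> or
    \<open>b\<close>.\<close>
  have Vconst: "V x = V x'" if "x \<in> {a..b}" for x
  proof (rule continuous_constant_on_closure[where S="{a<..<b}"])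
    show "continuous_on (closure {a<..<b}) V" "x \<in> closure {a<..<b}"
      using antideriv_continuous_on[OF V] that \<open>a < b\<close> by auto
    show "V t = V x'" if "t \<in> {a<..<b}" for t
    proof (cases "t \<le> x'")
      case True
      then show ?thesis using Vle[of t x'] that x'y' by auto
    next
      case False
      then show ?thesis using Vle[of x' t] that x'y' by auto
    qed
  qed
  have "AE t in ?M. z t - r = 0"
  proof (rule AE_eq_0_if_interval_integrals_0[OF zr])
    fix x y assume "a \<le> x" "x \<le> y" "y \<le> b"
    then show "integral\<^sup>L (lebesgue_on {x..y}) (\<lambda>t. z t - r) = 0"
      using antiderivD[OF V, of x y] Vconst[of x] Vconst[of y] by simp
  qed (use \<open>a < b\<close> in simp)
  then have "AE t in ?M. u t = r + W t"
    by eventually_elim (simp add: z_def algebra_simps)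
  moreover have "antideriv a b (\<lambda>t. r + W t) w"
    using antideriv_indefinite_integral[OF w, of r] by (simp add: W_def)
  ultimately show ?thesis using that by blast
qed

text \<open>The continuous functions \<open>v\<close> and \<open>v'\<close> agree everywhere on the
  interval, so the difference of the densities has integral zero over every subinterval.\<close>

lemma antideriv_unique_AE:
  assumes "antideriv a b v w" "antideriv a b v' w'" "a < b" "AE t in lebesgue_on {a..b}. v t = v' t"
  shows "AE t in lebesgue_on {a..b}. w t = w' t"
proof -
  have eq: "v t = v' t" if "t \<in> {a..b}" for t
    by (rule continuous_on_AE_eq[OF antideriv_continuous_on[OF assms(1)] antideriv_continuous_on[OF assms(2)] assms(3,4) that])
  have "antideriv a b (\<lambda>t. v t - v' t) (\<lambda>t. w t - w' t)" by (rule antideriv_diff[OF assms(1,2)])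
  then have "AE t in lebesgue_on {a..b}. w t - w' t = 0"
    using assms(3) eq
    by (intro AE_eq_0_if_interval_integrals_0) (auto simp: antideriv_integrable antiderivD[symmetric])
  then show ?thesis by simp
qed

lemma deriv_test_functions:
  assumes "\<phi> \<in> test_functions {a<..<b}"
  shows "deriv \<phi> \<in> test_functions {a<..<b}"
proof -
  obtain C where C: "compact C" "C \<subseteq> {a<..<b}" "\<And>t. t \<notin> C \<Longrightarrow> \<phi> t = 0"
    and smooth: "\<And>j t. (deriv ^^ j) \<phi> field_differentiable at t"
    using assms by (auto simp: test_functions_def)
  have "deriv \<phi> t = 0" if "t \<notin> C" for t
  proof (rule DERIV_imp_deriv)
    have "((\<lambda>_. 0) has_real_derivative 0) (at t)" by simp
    then show "(\<phi> has_real_derivative 0) (at t)"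
      by (rule has_field_derivative_transform_within_open[where S="- C"])
        (use C that in \<open>auto simp: open_Compl compact_imp_closed\<close>)
  qed
  moreover have "(deriv ^^ j) (deriv \<phi>) field_differentiable at t" for j t
    using smooth[of "Suc j" t] by (simp add: funpow_swap1)
  ultimately show ?thesis using C(1,2) unfolding test_functions_def by blast
qed

text \<open>\<open>Hm\<close> relates every weak derivative directly to \<open>u\<close>. Testing
  order \<open>j\<close> with the derivative of a test function shows that consecutive orders are
  weak derivatives of each other, and each pair is then turned into an \<open>antideriv\<close>
  relation.\<close>

theorem Hm_antideriv_chain:
  fixes u :: "real \<Rightarrow> 'a::{banach, second_countable_topology}"
  assumes "a < b" "1 \<le> m" and u: "u \<in> Hm {a<..<b} m"
  obtains v where "\<And>j. j < m \<Longrightarrow> antideriv a b (v j) (v (Suc j))"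
    "AE t in lebesgue_on {a..b}. u t = v 0 t"
    "v m = weak_deriv {a<..<b} m u" "v m square_integrable_on {a..b}"
proof -
  let ?I = "{a<..<b}"
  have fin: "?I \<in> sets lebesgue" "{a..b} \<in> sets lebesgue" "?I - {a..b} \<subseteq> {a, b}"
    "{a..b} - ?I \<subseteq> {a, b}" "finite {a, b}" by auto
  have ex: "\<exists>w. w \<in> L2 ?I \<and> is_weak_deriv ?I j u w" if "j \<in> {1..m}" for j
    using u that by (auto simp: Hm_def)
  define W where "W = (\<lambda>j. if j = 0 then u else weak_deriv ?I j u)"
  have W: "W j \<in> L2 ?I \<and> is_weak_deriv ?I j u (W j)" if "j \<le> m" for j
  proof (cases "j = 0")
    case True
    then show ?thesis using u by (auto simp: W_def Hm_def is_weak_deriv_def)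
  next
    case False
    then show ?thesis using someI_ex[OF ex[of j]] that by (simp add: W_def weak_deriv_def)
  qed
  have Wsq: "W j square_integrable_on {a..b}" if "j \<le> m" for j
    using L2_square_integrable_on[of "W j" ?I] W[OF that] square_integrable_on_finite_diff[OF fin] by auto
  have Wint: "integrable (lebesgue_on {a..b}) (W j)" if "j \<le> m" for j
    using square_integrable_on_integrable[OF Wsq[OF that]] by simp
  have "\<exists>v. antideriv a b v (W (Suc j)) \<and> (AE t in lebesgue_on {a..b}. W j t = v t)" if "j < m" for j
  proof -
    have weak: "integral\<^sup>L (lebesgue_on {a..b}) (\<lambda>t. deriv \<phi> t *\<^sub>R W j t)
        = - integral\<^sup>L (lebesgue_on {a..b}) (\<lambda>t. \<phi> t *\<^sub>R W (Suc j) t)"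
      if \<phi>: "\<phi> \<in> test_functions ?I" for \<phi>
    proof -
      \<comment> \<open>The same integral is the order \<open>j\<close> identity for
        \<open>deriv \<phi>\<close> and the order \<open>Suc j\<close> identity for
        \<open>\<phi>\<close>; multiplying by the sign once more cancels it.\<close>
      have "(-1) ^ j *\<^sub>R (LINT t|lebesgue_on ?I. deriv \<phi> t *\<^sub>R W j t)
          = (LINT t|lebesgue_on ?I. (deriv ^^ j) (deriv \<phi>) t *\<^sub>R u t)"
        using W[of j] deriv_test_functions[OF \<phi>] \<open>j < m\<close> by (simp add: is_weak_deriv_def)
      also have "\<dots> = (-1) ^ Suc j *\<^sub>R (LINT t|lebesgue_on ?I. \<phi> t *\<^sub>R W (Suc j) t)"
        using W[of "Suc j"] \<phi> \<open>j < m\<close> by (simp add: is_weak_deriv_def funpow_swap1)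
      finally have "(-1) ^ j *\<^sub>R (-1) ^ j *\<^sub>R (LINT t|lebesgue_on ?I. deriv \<phi> t *\<^sub>R W j t)
          = (-1) ^ j *\<^sub>R (-1) ^ Suc j *\<^sub>R (LINT t|lebesgue_on ?I. \<phi> t *\<^sub>R W (Suc j) t)" by simp
      then have "(LINT t|lebesgue_on ?I. deriv \<phi> t *\<^sub>R W j t)
          = - (LINT t|lebesgue_on ?I. \<phi> t *\<^sub>R W (Suc j) t)"
        by (simp flip: power_mult_distrib)
      then show ?thesis by (simp add: integral_lebesgue_on_finite_diff[OF fin])
    qed
    have "j \<le> m" "Suc j \<le> m" using \<open>j < m\<close> by auto
    then show ?thesis
      using weak_derivative_antideriv[OF \<open>a < b\<close> Wint Wint weak] by blast
  qed
  then obtain y where y: "\<And>j. j < m \<Longrightarrow> antideriv a b (y j) (W (Suc j))"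
    "\<And>j. j < m \<Longrightarrow> AE t in lebesgue_on {a..b}. W j t = y j t" by metis
  \<comment> \<open>Below order \<open>m\<close> the continuous representatives are taken; at order
    \<open>m\<close> the chosen weak derivative itself, so that the final bound speaks literally of
    \<open>weak_deriv\<close>.\<close>
  define v where "v = (\<lambda>j. if j < m then y j else W m)"
  have "antideriv a b (v j) (v (Suc j))" if "j < m" for j
  proof (cases "Suc j < m")
    case True
    have "antideriv a b (y j) (y (Suc j))"
    proof (rule antideriv_cong_AE[OF y(1)[OF that]])
      show "y (Suc j) \<in> borel_measurable (lebesgue_on {a..b})"
        by (rule continuous_on_borel_measurable_lebesgue_on[OF antideriv_continuous_on[OF y(1)[OF True]]])
      show "AE t in lebesgue_on {a..b}. y (Suc j) t = W (Suc j) t"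
        using y(2)[OF True] by (auto elim: eventually_mono)
    qed
    then show ?thesis using that True by (simp add: v_def)
  next
    case False
    with that have "Suc j = m" by simp
    then show ?thesis using y(1)[OF that] that by (simp add: v_def)
  qed
  moreover have "AE t in lebesgue_on {a..b}. u t = v 0 t"
    using y(2)[of 0] \<open>1 \<le> m\<close> by (simp add: v_def W_def)
  moreover have "v m = weak_deriv ?I m u" using \<open>1 \<le> m\<close> by (simp add: v_def W_def)
  moreover have "v m square_integrable_on {a..b}" using Wsq[of m] by (simp add: v_def)
  ultimately show ?thesis using that by blast
qed

section \<open>Polynomials with vector coefficients\<close>

text \<open>Same coefficient format as in \<open>Pb\<close>, but as an identity on the whole line:
  limits and derivatives at mesh points become those of a smooth function. The degree is below
  \<open>q\<close>, so \<open>vpoly 0\<close> contains only zero.\<close>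

definition vpoly :: "nat \<Rightarrow> (real \<Rightarrow> 'a::real_normed_vector) set" where
  "vpoly q = {f. \<exists>c. \<forall>t. f t = (\<Sum>j<q. t ^ j *\<^sub>R c j)}"

lemma vpolyI: "(\<And>t. f t = (\<Sum>j<q. t ^ j *\<^sub>R c j)) \<Longrightarrow> f \<in> vpoly q"
  by (auto simp: vpoly_def)

lemma vpoly_zero [simp]: "(\<lambda>t. 0) \<in> vpoly q"
  by (rule vpolyI[where c="\<lambda>_. 0"]) simp

lemma vpoly_mono:
  assumes "f \<in> vpoly p" "p \<le> q"
  shows "f \<in> vpoly q"
proof -
  obtain c where c: "\<And>t. f t = (\<Sum>j<p. t ^ j *\<^sub>R c j)" using assms by (auto simp: vpoly_def)
  show ?thesis
  proof (rule vpolyI[where c="\<lambda>j. if j < p then c j else 0"])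
    fix t
    have "(\<Sum>j<q. t ^ j *\<^sub>R (if j < p then c j else 0)) = (\<Sum>j<p. t ^ j *\<^sub>R (if j < p then c j else 0))"
      using assms(2) by (intro sum.mono_neutral_right) auto
    then show "f t = (\<Sum>j<q. t ^ j *\<^sub>R (if j < p then c j else 0))" using c by simp
  qed
qed

lemma vpoly_add:
  assumes "f \<in> vpoly q" "g \<in> vpoly q"
  shows "(\<lambda>t. f t + g t) \<in> vpoly q"
proof -
  obtain c d where "\<And>t. f t = (\<Sum>j<q. t ^ j *\<^sub>R c j)" "\<And>t. g t = (\<Sum>j<q. t ^ j *\<^sub>R d j)"
    using assms by (auto simp: vpoly_def)
  then show ?thesis
    by (intro vpolyI[where c="\<lambda>j. c j + d j"]) (simp add: scaleR_add_right sum.distrib)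
qed

lemma vpoly_sum:
  "finite I \<Longrightarrow> (\<And>i. i \<in> I \<Longrightarrow> f i \<in> vpoly q) \<Longrightarrow> (\<lambda>t. \<Sum>i\<in>I. f i t) \<in> vpoly q"
  by (induction I rule: finite_induct) (auto intro: vpoly_add)

lemma vpoly_const: "0 < q \<Longrightarrow> (\<lambda>t. x) \<in> vpoly q"
  by (rule vpoly_mono[where p=1], rule vpolyI[where c="\<lambda>_. x"]) auto

lemma vpoly_poly_scaleR:
  assumes "degree p < q"
  shows "(\<lambda>t. poly p t *\<^sub>R x) \<in> vpoly q"
proof (rule vpoly_mono[OF vpolyI])
  show "poly p t *\<^sub>R x = (\<Sum>j<Suc (degree p). t ^ j *\<^sub>R (coeff p j *\<^sub>R x))" for t
    by (simp add: poly_altdef scaleR_sum_left lessThan_Suc_atMost mult.commute)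
qed (use assms in simp)

lemma antideriv_real:
  assumes "\<And>t. (F has_real_derivative F' t) (at t)" "continuous_on UNIV F'"
  shows "antideriv a b F F'"
  unfolding antideriv_def
proof safe
  have "continuous_on S F'" for S using assms(2) continuous_on_subset by blast
  then show "integrable (lebesgue_on {a..b}) F'"
    "\<And>x y. x \<le> y \<Longrightarrow> F y - F x = integral\<^sup>L (lebesgue_on {x..y}) F'"
    using assms(1) by (auto intro!: continuous_on_integrable_lebesgue_on integral_lebesgue_on_FTC[symmetric])
qed

lemma antideriv_zero [simp]: "antideriv a b (\<lambda>_. c) (\<lambda>_. 0)"
  by (simp add: antideriv_def)

lemma antideriv_add:
  assumes "antideriv a b v w" "antideriv a b v' w'"
  shows "antideriv a b (\<lambda>t. v t + v' t) (\<lambda>t. w t + w' t)"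
  using antideriv_diff[OF assms(1) antideriv_diff[OF antideriv_zero[of a b 0] assms(2)]] by simp

lemma antideriv_sum:
  "finite I \<Longrightarrow> (\<And>i. i \<in> I \<Longrightarrow> antideriv a b (f i) (g i)) \<Longrightarrow>
    antideriv a b (\<lambda>t. \<Sum>i\<in>I. f i t) (\<lambda>t. \<Sum>i\<in>I. g i t)"
  by (induction I rule: finite_induct) (auto intro: antideriv_add)

lemma vpoly_antideriv:
  assumes "f \<in> vpoly q"
  obtains F where "F \<in> vpoly (Suc q)" "antideriv a b F f" "F x = y"
proof -
  obtain c where c: "\<And>t. f t = (\<Sum>j<q. t ^ j *\<^sub>R c j)" using assms by (auto simp: vpoly_def)
  define G where "G = (\<lambda>t. \<Sum>j<q. (t ^ Suc j / real (Suc j)) *\<^sub>R c j)"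
  have "antideriv a b G (\<lambda>t. \<Sum>j<q. t ^ j *\<^sub>R c j)"
    unfolding G_def
  proof (rule antideriv_sum)
    fix j
    have "antideriv a b (\<lambda>t. t ^ Suc j / real (Suc j)) (\<lambda>t. t ^ j)"
    proof (rule antideriv_real)
      show "((\<lambda>t. t ^ Suc j / real (Suc j)) has_real_derivative t ^ j) (at t)" for t
        by (rule DERIV_cong[OF DERIV_cdivide[OF DERIV_pow]]) (simp del: of_nat_Suc)
    qed (intro continuous_intros)
    then show "antideriv a b (\<lambda>t. (t ^ Suc j / real (Suc j)) *\<^sub>R c j) (\<lambda>t. t ^ j *\<^sub>R c j)"
      by (rule antideriv_bounded_linear[OF bounded_linear_scaleR_left])
  qed simp
  then have G: "antideriv a b G f" by (simp flip: c)
  have "G \<in> vpoly (Suc q)"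
    unfolding G_def
  proof (rule vpoly_sum)
    fix j assume "j \<in> {..<q}"
    then have "degree (monom (1 / real (Suc j)) (Suc j)) < Suc q"
      by (intro le_less_trans[OF degree_monom_le]) auto
    from vpoly_poly_scaleR[OF this, of "c j"]
    show "(\<lambda>t. (t ^ Suc j / real (Suc j)) *\<^sub>R c j) \<in> vpoly (Suc q)"
      by (simp add: poly_monom)
  qed simp
  then have "(\<lambda>t. G t + (y - G x)) \<in> vpoly (Suc q)"
    by (rule vpoly_add[OF _ vpoly_const]) simp
  moreover have "antideriv a b (\<lambda>t. G t + (y - G x)) f"
    using antideriv_add[OF G antideriv_zero[of a b "y - G x"]] by simp
  ultimately show ?thesis using that by force
qed

lemma continuous_on_vpoly: "f \<in> vpoly q \<Longrightarrow> continuous_on S f"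
proof -
  assume "f \<in> vpoly q"
  then obtain c where "f = (\<lambda>t. \<Sum>j<q. t ^ j *\<^sub>R c j)" by (auto simp: vpoly_def fun_eq_iff)
  then show ?thesis by (simp only:, intro continuous_intros)
qed

section \<open>Weighted projection onto polynomials\<close>

text \<open>Real polynomials suffice here, because functions with values in a Hilbert space are
  expanded with real polynomials and vector coefficients.\<close>

definition weighted_ip :: "real \<Rightarrow> real \<Rightarrow> real poly \<Rightarrow> real poly \<Rightarrow> real" where
  "weighted_ip a b p r = (LINT t|lebesgue_on {a..b}. (t - a) * (poly p t * poly r t))"

lemma weighted_ip_integrable:
  fixes a b :: real
  shows "integrable (lebesgue_on {a..b}) (\<lambda>t. (t - a) * (poly p t * poly r t))"
  by (intro continuous_on_integrable_lebesgue_on continuous_intros)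

lemma weighted_ip_commute: "weighted_ip a b p r = weighted_ip a b r p"
  unfolding weighted_ip_def by (simp only: mult.commute[of "poly p _"])

lemma weighted_ip_add: "weighted_ip a b (p + p') r = weighted_ip a b p r + weighted_ip a b p' r"
proof -
  have "weighted_ip a b (p + p') r = (LINT t|lebesgue_on {a..b}.
      (t - a) * (poly p t * poly r t) + (t - a) * (poly p' t * poly r t))"
    by (simp add: weighted_ip_def algebra_simps)
  then show ?thesis
    unfolding weighted_ip_def by (simp add: Bochner_Integration.integral_add[OF weighted_ip_integrable weighted_ip_integrable])
qed

lemma weighted_ip_smult: "weighted_ip a b (smult c p) r = c * weighted_ip a b p r"
proof -
  have "weighted_ip a b (smult c p) r = (LINT t|lebesgue_on {a..b}. c * ((t - a) * (poly p t * poly r t)))"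
    by (simp add: weighted_ip_def algebra_simps)
  then show ?thesis unfolding weighted_ip_def by simp
qed

lemma weighted_ip_sum: "finite I \<Longrightarrow> weighted_ip a b (\<Sum>i\<in>I. p i) r = (\<Sum>i\<in>I. weighted_ip a b (p i) r)"
proof (induction I rule: finite_induct)
  case empty
  then show ?case using weighted_ip_smult[of a b 0 0 r] by simp
qed (simp add: weighted_ip_add)

lemma integral_eq_0_continuous:
  fixes f :: "real \<Rightarrow> real"
  assumes "continuous_on {a..b} f" "a < b" "\<And>t. t \<in> {a..b} \<Longrightarrow> f t \<ge> 0"
    "integral\<^sup>L (lebesgue_on {a..b}) f = 0" "t \<in> {a..b}"
  shows "f t = 0"
proof -
  have ae: "AE t in lebesgue_on {a..b}. f t = 0"
  proof -
    have "AE t in lebesgue_on {a..b}. 0 \<le> f t" by (rule AE_I2) (use assms(3) in simp)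
    then show ?thesis
      using integral_nonneg_eq_0_iff_AE[OF continuous_on_integrable_lebesgue_on[OF assms(1)]] assms(4)
      by blast
  qed
  show ?thesis
    by (rule continuous_on_AE_eq[OF assms(1) continuous_on_const assms(2) ae assms(5)])
qed

lemma poly_eq_0_interval:
  fixes p :: "real poly"
  assumes "\<And>t. t \<in> {a<..<b} \<Longrightarrow> poly p t = 0" "a < b"
  shows "p = 0"
proof (rule ccontr)
  assume "p \<noteq> 0"
  then have "finite {t. poly p t = 0}" by (rule poly_roots_finite)
  moreover have "{a<..<b} \<subseteq> {t. poly p t = 0}" using assms(1) by auto
  ultimately have "finite {a<..<b}" by (rule finite_subset[rotated])
  then show False using infinite_Ioo[OF assms(2)] by simp
qed

lemma weighted_ip_pos:
  assumes "a < b" "p \<noteq> 0"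
  shows "weighted_ip a b p p > 0"
proof -
  have nonneg: "t \<in> {a..b} \<Longrightarrow> (t - a) * (poly p t * poly p t) \<ge> 0" for t by simp
  then have "weighted_ip a b p p \<ge> 0"
    unfolding weighted_ip_def by (intro Bochner_Integration.integral_nonneg) simp
  moreover have "weighted_ip a b p p \<noteq> 0"
  proof
    assume "weighted_ip a b p p = 0"
    then have *: "(t - a) * (poly p t * poly p t) = 0" if "t \<in> {a..b}" for t
      using nonneg that \<open>a < b\<close>
      by (intro integral_eq_0_continuous[where f="\<lambda>t. (t - a) * (poly p t * poly p t)"])
        (auto simp: weighted_ip_def intro!: continuous_intros)
    have "p = 0"
    proof (rule poly_eq_0_interval[OF _ \<open>a < b\<close>])
      fix t assume "t \<in> {a<..<b}"
      then show "poly p t = 0" using *[of t] by simp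
    qed
    with \<open>p \<noteq> 0\<close> show False by simp
  qed
  ultimately show ?thesis by simp
qed

text \<open>Subtracting a multiple of the last basis polynomial removes the top coefficient. Degree
  below \<open>d\<close> is expressed by vanishing coefficients so that \<open>d = 0\<close> means
  the zero polynomial.\<close>

lemma graded_polys_span:
  fixes L :: "real poly \<Rightarrow> 'b::real_vector"
  assumes add: "\<And>p r. L (p + r) = L p + L r" and smult: "\<And>c p. L (smult c p) = c *\<^sub>R L p"
    and \<omega>: "\<And>i. i < d \<Longrightarrow> degree (\<omega> i) = i \<and> \<omega> i \<noteq> 0" and zero: "\<And>i. i < d \<Longrightarrow> L (\<omega> i) = 0"
    and p: "\<And>i. d \<le> i \<Longrightarrow> coeff p i = 0"
  shows "L p = 0"
  using \<omega> zero p
proof (induction d arbitrary: p)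
  case 0
  then have "p = 0" by (simp add: poly_eq_iff)
  then show ?case using smult[of 0 0] by simp
next
  case (Suc d)
  let ?c = "coeff p d / lead_coeff (\<omega> d)"
  have \<omega>d: "degree (\<omega> d) = d" "\<omega> d \<noteq> 0" using Suc.prems(1)[of d] by auto
  have "coeff (p + smult (- ?c) (\<omega> d)) i = 0" if "d \<le> i" for i
  proof (cases "i = d")
    case True
    then show ?thesis using \<omega>d by (auto simp: leading_coeff_0_iff[symmetric])
  next
    case False
    with that have "d < i" by simp
    then show ?thesis using Suc.prems(3)[of i] \<omega>d by (simp add: coeff_eq_0)
  qed
  then have "L (p + smult (- ?c) (\<omega> d)) = 0"
    by (rule Suc.IH[rotated 2]) (use Suc.prems(1,2) in simp_all)
  then have "L p + (- ?c) *\<^sub>R L (\<omega> d) = 0" unfolding add smult .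
  then show ?case using Suc.prems(2)[of d] by simp
qed

text \<open>Gram-Schmidt on the monomials; the induction carries orthogonality to all polynomials of
  smaller degree.\<close>

lemma orthogonal_polys:
  assumes "a < b"
  obtains \<omega> :: "nat \<Rightarrow> real poly" where "\<And>i. degree (\<omega> i) = i" "\<And>i. \<omega> i \<noteq> 0"
    "\<And>i j. i \<noteq> j \<Longrightarrow> weighted_ip a b (\<omega> i) (\<omega> j) = 0"
proof -
  let ?P = "\<lambda>d \<omega>. degree \<omega> = d \<and> \<omega> \<noteq> 0 \<and> (\<forall>p. (\<forall>i\<ge>d. coeff p i = 0) \<longrightarrow> weighted_ip a b p \<omega> = 0)"
  have "\<exists>\<omega>. ?P d \<omega>" for d
  proof (induction d rule: less_induct)
    case (less d)
    then obtain \<omega> where \<omega>: "\<And>i. i < d \<Longrightarrow> ?P i (\<omega> i)" by metis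
    have orth: "weighted_ip a b (\<omega> i) (\<omega> j) = 0" if "i \<noteq> j" "i < d" "j < d" for i j
    proof (cases "i < j")
      case True
      then have "\<forall>k\<ge>j. coeff (\<omega> i) k = 0" using \<omega>[OF that(2)] by (auto intro: coeff_eq_0)
      then show ?thesis using \<omega>[OF that(3)] by blast
    next
      case False
      with that have "j < i" by simp
      then have "\<forall>k\<ge>i. coeff (\<omega> j) k = 0" using \<omega>[OF that(3)] by (auto intro: coeff_eq_0)
      then show ?thesis using \<omega>[OF that(2)] weighted_ip_commute by metis
    qed
    \<comment> \<open>The negative of the projection of the monomial onto the polynomials already
      constructed.\<close>
    define s where "s = (\<Sum>i<d. smult (- weighted_ip a b (monom 1 d) (\<omega> i) / weighted_ip a b (\<omega> i) (\<omega> i)) (\<omega> i))"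
    define p where "p = monom 1 d + s"
    have s: "coeff s i = 0" if "d \<le> i" for i
      unfolding s_def coeff_sum
    proof (rule sum.neutral, rule ballI)
      fix j assume "j \<in> {..<d}"
      then have "coeff (\<omega> j) i = 0" using \<omega>[of j] that by (intro coeff_eq_0) auto
      then show "coeff (smult (- weighted_ip a b (monom 1 d) (\<omega> j) / weighted_ip a b (\<omega> j) (\<omega> j)) (\<omega> j)) i = 0"
        by simp
    qed
    have coeff_p: "coeff p i = (if i = d then 1 else 0)" if "d \<le> i" for i
      using s[OF that] that by (simp add: p_def)
    then have "p \<noteq> 0" by (metis coeff_0 order_refl zero_neq_one)
    moreover have "degree p = d"
    proof (rule antisym)
      show "degree p \<le> d" by (rule degree_le) (use coeff_p in auto)
      show "d \<le> degree p" by (rule le_degree) (use coeff_p in auto)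
    qed
    moreover have "weighted_ip a b r p = 0" if r: "\<forall>i\<ge>d. coeff r i = 0" for r
    proof (rule graded_polys_span[where L="\<lambda>r. weighted_ip a b r p" and \<omega>=\<omega> and d=d])
      fix j assume "j < d"
      have pos: "weighted_ip a b (\<omega> j) (\<omega> j) \<noteq> 0"
        using weighted_ip_pos[OF assms, of "\<omega> j"] \<omega>[OF \<open>j < d\<close>] by simp
      have "weighted_ip a b p (\<omega> j) = weighted_ip a b (monom 1 d) (\<omega> j)
          + (\<Sum>i<d. - weighted_ip a b (monom 1 d) (\<omega> i) / weighted_ip a b (\<omega> i) (\<omega> i) * weighted_ip a b (\<omega> i) (\<omega> j))"
        by (simp only: p_def s_def weighted_ip_add weighted_ip_sum[OF finite_lessThan] weighted_ip_smult)
      also have "(\<Sum>i<d. - weighted_ip a b (monom 1 d) (\<omega> i) / weighted_ip a b (\<omega> i) (\<omega> i) * weighted_ip a b (\<omega> i) (\<omega> j))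
          = (\<Sum>i<d. if i = j then - weighted_ip a b (monom 1 d) (\<omega> j) else 0)"
        using orth pos \<open>j < d\<close> by (intro sum.cong) auto
      also have "\<dots> = - weighted_ip a b (monom 1 d) (\<omega> j)" using \<open>j < d\<close> by simp
      finally show "weighted_ip a b (\<omega> j) p = 0" by (simp add: weighted_ip_commute)
    qed (use \<omega> r in \<open>auto simp: weighted_ip_add weighted_ip_smult\<close>)
    ultimately show ?case by blast
  qed
  then obtain \<omega> where \<omega>: "\<And>i. ?P i (\<omega> i)" by metis
  have lt: "weighted_ip a b (\<omega> i) (\<omega> j) = 0" if "i < j" for i j
  proof -
    have "\<forall>k\<ge>j. coeff (\<omega> i) k = 0" using \<omega>[of i] that by (auto intro: coeff_eq_0)
    then show ?thesis using \<omega>[of j] by blast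
  qed
  show ?thesis
  proof (rule that[of \<omega>])
    fix i j :: nat assume "i \<noteq> j"
    then show "weighted_ip a b (\<omega> i) (\<omega> j) = 0"
      using lt[of i j] lt[of j i] weighted_ip_commute[of a b "\<omega> i" "\<omega> j"] by (cases "i < j") auto
  qed (use \<omega> in auto)
qed

text \<open>Fourier expansion in orthogonal real polynomials, with vector coefficients
  \<open>c i\<close>. The error is orthogonal to \<open>\<phi>\<close> itself, so Pythagoras bounds
  its weighted norm by that of \<open>r\<close>.\<close>

lemma weighted_projection:
  fixes r :: "real \<Rightarrow> 'a::{real_inner, banach, second_countable_topology}"
  assumes "a < b" and r: "r square_integrable_on {a..b}"
  obtains \<phi> where "\<phi> \<in> vpoly d"
    "\<And>\<psi>. (\<forall>i\<ge>d. coeff \<psi> i = 0) \<Longrightarrow> (LINT t|lebesgue_on {a..b}. ((t - a) * poly \<psi> t) *\<^sub>R (r t - \<phi> t)) = 0"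
    "(LINT t|lebesgue_on {a..b}. (t - a) * (norm (r t - \<phi> t))\<^sup>2)
      \<le> (LINT t|lebesgue_on {a..b}. (t - a) * (norm (r t))\<^sup>2)"
proof -
  let ?M = "lebesgue_on {a..b}"
  obtain \<omega> :: "nat \<Rightarrow> real poly" where \<omega>: "\<And>i. degree (\<omega> i) = i" "\<And>i. \<omega> i \<noteq> 0"
    "\<And>i j. i \<noteq> j \<Longrightarrow> weighted_ip a b (\<omega> i) (\<omega> j) = 0"
    using orthogonal_polys[OF \<open>a < b\<close>] by metis
  have pos: "weighted_ip a b (\<omega> i) (\<omega> i) > 0" for i by (rule weighted_ip_pos[OF \<open>a < b\<close> \<omega>(2)])
  have rint: "integrable ?M r" by (rule square_integrable_on_integrable[OF r]) simp
  have ri: "integrable ?M (\<lambda>t. ((t - a) * poly p t) *\<^sub>R r t)" for p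
    by (intro integrable_continuous_scaleR continuous_intros rint)
  define c where "c i = inverse (weighted_ip a b (\<omega> i) (\<omega> i)) *\<^sub>R (\<integral>t. ((t - a) * poly (\<omega> i) t) *\<^sub>R r t \<partial>?M)" for i
  define \<phi> where "\<phi> t = (\<Sum>i<d. poly (\<omega> i) t *\<^sub>R c i)" for t
  have \<phi>: "\<phi> \<in> vpoly d"
    unfolding \<phi>_def[abs_def] by (intro vpoly_sum vpoly_poly_scaleR) (auto simp: \<omega>)
  have \<phi>sq: "\<phi> square_integrable_on {a..b}"
    by (rule continuous_on_square_integrable_on[OF continuous_on_vpoly[OF \<phi>]])
  define e where "e t = r t - \<phi> t" for t
  have e: "e square_integrable_on {a..b}"
    unfolding e_def[abs_def] by (rule square_integrable_on_diff[OF r \<phi>sq])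
  have eint: "integrable ?M e" by (rule square_integrable_on_integrable[OF e]) simp
  have ei: "integrable ?M (\<lambda>t. ((t - a) * poly p t) *\<^sub>R e t)" for p
    by (intro integrable_continuous_scaleR continuous_intros eint)
  have orth: "(\<integral>t. ((t - a) * poly \<psi> t) *\<^sub>R e t \<partial>?M) = 0" if "\<forall>i\<ge>d. coeff \<psi> i = 0" for \<psi>
  proof (rule graded_polys_span[where L="\<lambda>p. \<integral>t. ((t - a) * poly p t) *\<^sub>R e t \<partial>?M" and \<omega>=\<omega> and d=d])
    show "(\<integral>t. ((t - a) * poly (p + p') t) *\<^sub>R e t \<partial>?M)
        = (\<integral>t. ((t - a) * poly p t) *\<^sub>R e t \<partial>?M) + (\<integral>t. ((t - a) * poly p' t) *\<^sub>R e t \<partial>?M)" for p p'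
    proof -
      have "(\<lambda>t. ((t - a) * poly (p + p') t) *\<^sub>R e t)
          = (\<lambda>t. ((t - a) * poly p t) *\<^sub>R e t + ((t - a) * poly p' t) *\<^sub>R e t)"
        by (simp add: fun_eq_iff distrib_left scaleR_add_left)
      then show ?thesis by (simp only: Bochner_Integration.integral_add[OF ei ei])
    qed
    show "(\<integral>t. ((t - a) * poly (smult k p) t) *\<^sub>R e t \<partial>?M) = k *\<^sub>R (\<integral>t. ((t - a) * poly p t) *\<^sub>R e t \<partial>?M)" for k p
    proof -
      have "(\<lambda>t. ((t - a) * poly (smult k p) t) *\<^sub>R e t) = (\<lambda>t. k *\<^sub>R (((t - a) * poly p t) *\<^sub>R e t))"
        by (simp add: fun_eq_iff mult.left_commute)
      then show ?thesis by (simp only: integral_scaleR_right)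
    qed
    fix j assume "j < d"
    have "(\<integral>t. ((t - a) * poly (\<omega> j) t) *\<^sub>R \<phi> t \<partial>?M)
        = (\<integral>t. (\<Sum>i<d. ((t - a) * (poly (\<omega> j) t * poly (\<omega> i) t)) *\<^sub>R c i) \<partial>?M)"
      by (simp add: \<phi>_def scaleR_sum_right mult.assoc)
    also have "\<dots> = (\<Sum>i<d. weighted_ip a b (\<omega> j) (\<omega> i) *\<^sub>R c i)"
      unfolding weighted_ip_def using weighted_ip_integrable
      by (subst Bochner_Integration.integral_sum) (auto intro!: sum.cong)
    also have "\<dots> = (\<Sum>i<d. if i = j then weighted_ip a b (\<omega> j) (\<omega> j) *\<^sub>R c j else 0)"
      using \<omega>(3) by (intro sum.cong) auto
    also have "\<dots> = (\<integral>t. ((t - a) * poly (\<omega> j) t) *\<^sub>R r t \<partial>?M)"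
      using \<open>j < d\<close> pos[of j] by (simp add: c_def)
    finally have *: "(\<integral>t. ((t - a) * poly (\<omega> j) t) *\<^sub>R \<phi> t \<partial>?M) = (\<integral>t. ((t - a) * poly (\<omega> j) t) *\<^sub>R r t \<partial>?M)" .
    have "integrable ?M (\<lambda>t. ((t - a) * poly (\<omega> j) t) *\<^sub>R \<phi> t)"
      by (intro continuous_on_integrable_lebesgue_on continuous_intros continuous_on_vpoly[OF \<phi>])
    then show "(\<integral>t. ((t - a) * poly (\<omega> j) t) *\<^sub>R e t \<partial>?M) = 0"
      using ri[of "\<omega> j"] * by (simp add: e_def scaleR_right_diff_distrib)
  qed (use that \<omega> in auto)
  have energy: "(\<integral>t. (t - a) * (norm (e t))\<^sup>2 \<partial>?M) \<le> (\<integral>t. (t - a) * (norm (r t))\<^sup>2 \<partial>?M)"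
  proof -
    have cont: "continuous_on {a..b} (\<lambda>t. t - a)" by (intro continuous_intros)
    have wi: "integrable ?M (\<lambda>t. (t - a) * f t)" if "integrable ?M f" for f :: "real \<Rightarrow> real"
      using integrable_continuous_scaleR[OF cont that] by simp
    have i: "integrable ?M (\<lambda>t. (t - a) * (norm (e t))\<^sup>2)" "integrable ?M (\<lambda>t. (t - a) * (norm (\<phi> t))\<^sup>2)"
      "integrable ?M (\<lambda>t. (t - a) * (e t \<bullet> \<phi> t))"
      using e \<phi>sq by (auto intro!: wi integrable_inner_square_integrable simp: square_integrable_on_def)
    have "(\<integral>t. (t - a) * (e t \<bullet> \<phi> t) \<partial>?M) = (\<integral>t. (\<Sum>i<d. (((t - a) * poly (\<omega> i) t) *\<^sub>R e t) \<bullet> c i) \<partial>?M)"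
      by (simp add: \<phi>_def inner_sum_right sum_distrib_left mult.assoc)
    also have "\<dots> = (\<Sum>i<d. (\<integral>t. ((t - a) * poly (\<omega> i) t) *\<^sub>R e t \<partial>?M) \<bullet> c i)"
    proof (subst Bochner_Integration.integral_sum)
      show "integrable ?M (\<lambda>t. (((t - a) * poly (\<omega> i) t) *\<^sub>R e t) \<bullet> c i)" for i
        by (rule integrable_inner_left) (use ei in blast)
      show "(\<Sum>i<d. \<integral>t. (((t - a) * poly (\<omega> i) t) *\<^sub>R e t) \<bullet> c i \<partial>?M)
          = (\<Sum>i<d. (\<integral>t. ((t - a) * poly (\<omega> i) t) *\<^sub>R e t \<partial>?M) \<bullet> c i)"
        using ei by (intro sum.cong refl integral_inner_left) blast
    qed
    also have "\<dots> = 0"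
    proof (rule sum.neutral, rule ballI)
      fix i assume "i \<in> {..<d}"
      then have "(\<integral>t. ((t - a) * poly (\<omega> i) t) *\<^sub>R e t \<partial>?M) = 0"
        using \<omega>(1) by (intro orth) (auto intro: coeff_eq_0)
      then show "(\<integral>t. ((t - a) * poly (\<omega> i) t) *\<^sub>R e t \<partial>?M) \<bullet> c i = 0" by simp
    qed
    finally have cross: "(\<integral>t. (t - a) * (e t \<bullet> \<phi> t) \<partial>?M) = 0" .
    have "(\<integral>t. (t - a) * (norm (r t))\<^sup>2 \<partial>?M)
        = (\<integral>t. (t - a) * (norm (e t))\<^sup>2 + 2 * ((t - a) * (e t \<bullet> \<phi> t)) + (t - a) * (norm (\<phi> t))\<^sup>2 \<partial>?M)"
    proof (rule Bochner_Integration.integral_cong)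
      fix t
      have "r t = e t + \<phi> t" by (simp add: e_def)
      then have "(norm (r t))\<^sup>2 = (norm (e t))\<^sup>2 + 2 * (e t \<bullet> \<phi> t) + (norm (\<phi> t))\<^sup>2"
        by (simp add: power2_norm_eq_inner inner_add inner_commute)
      then show "(t - a) * (norm (r t))\<^sup>2
          = (t - a) * (norm (e t))\<^sup>2 + 2 * ((t - a) * (e t \<bullet> \<phi> t)) + (t - a) * (norm (\<phi> t))\<^sup>2"
        by (simp add: algebra_simps)
    qed simp
    also have "\<dots> = (\<integral>t. (t - a) * (norm (e t))\<^sup>2 \<partial>?M) + (\<integral>t. (t - a) * (norm (\<phi> t))\<^sup>2 \<partial>?M)"
      using i cross by simp
    finally show ?thesis
      using Bochner_Integration.integral_nonneg[of ?M "\<lambda>t. (t - a) * (norm (\<phi> t))\<^sup>2"] by simp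
  qed
  show ?thesis
    by (rule that[OF \<phi>]) (use orth energy in \<open>simp_all only: e_def\<close>)
qed

section \<open>Interpolation on one interval\<close>

lemma x_times_ln_tendsto_0: "((\<lambda>x::real. x * ln x) \<longlongrightarrow> 0) (at_right 0)"
proof -
  have "((\<lambda>x::real. - (ln (inverse x) / inverse x)) \<longlongrightarrow> - 0) (at_right 0)"
    by (intro tendsto_minus filterlim_compose[OF ln_x_over_x_tendsto_0 filterlim_inverse_at_top_right])
  moreover have "\<forall>\<^sub>F x::real in at_right 0. - (ln (inverse x) / inverse x) = x * ln x"
    unfolding eventually_at_filter by (auto simp: ln_inverse divide_inverse)
  ultimately have "((\<lambda>x::real. x * ln x) \<longlongrightarrow> - 0) (at_right 0)"
    by (rule Lim_transform_eventually)
  then show ?thesis by simp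
qed

text \<open>The integrand is unbounded near \<open>a\<close>, so the fundamental theorem is used on
  the open interval, with continuity of \<open>F\<close> on the closed one; this rests on x ln x
  tending to 0. The branch for \<open>t \<le> a\<close> only fixes the value at the singular
  point.\<close>

lemma has_integral_ln_quotient:
  fixes a b :: real
  assumes "a < b"
  shows "((\<lambda>t. if t \<le> a then 0 else ln (b - a) - ln (t - a)) has_integral (b - a)) {a..b}"
proof -
  define F where "F t = (t - a) * ln (b - a) - (t - a) * ln (t - a) + (t - a)" for t
  have cont: "continuous_on {a..b} F"
    unfolding continuous_on_eq_continuous_within
  proof
    fix x assume x: "x \<in> {a..b}"
    show "continuous (at x within {a..b}) F"
    proof (cases "x = a")
      case True
      have "((\<lambda>t. t - a) \<longlongrightarrow> a - a) (at_right a)" by (intro tendsto_intros)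
      then have "filterlim (\<lambda>t. t - a) (at_right 0) (at_right a)"
        by (auto simp: filterlim_at eventually_at_filter)
      then have "((\<lambda>t. (t - a) * ln (t - a)) \<longlongrightarrow> 0) (at_right a)"
        by (rule filterlim_compose[OF x_times_ln_tendsto_0])
      then have "(F \<longlongrightarrow> (a - a) * ln (b - a) - 0 + (a - a)) (at_right a)"
        unfolding F_def by (intro tendsto_intros)
      then have "(F \<longlongrightarrow> F a) (at_right a)" by (simp add: F_def)
      then show ?thesis
        unfolding continuous_within True using at_within_Icc_at_right[OF assms] by simp
    next
      case False
      with x have "isCont F x"
        unfolding F_def by (auto intro!: continuous_intros)
      then show ?thesis by (rule continuous_at_imp_continuous_at_within)
    qed
  qed
  have "((\<lambda>t. if t \<le> a then 0 else ln (b - a) - ln (t - a)) has_integral (F b - F a)) {a..b}"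
  proof (rule fundamental_theorem_of_calculus_interior)
    fix x assume x: "x \<in> {a<..<b}"
    have "(F has_real_derivative ln (b - a) - ln (x - a)) (at x)"
      unfolding F_def using x by (auto intro!: derivative_eq_intros)
    then show "(F has_vector_derivative (if x \<le> a then 0 else ln (b - a) - ln (x - a))) (at x)"
      using x by (simp add: has_real_derivative_iff_has_vector_derivative)
  qed (use assms cont in auto)
  then show ?thesis by (simp add: F_def)
qed

lemma
  fixes a b :: real
  assumes "a < b"
  shows integrable_ln_quotient: "integrable (lebesgue_on {a..b}) (\<lambda>t. if t \<le> a then 0 else ln (b - a) - ln (t - a))"
    and integral_ln_quotient: "(LINT t|lebesgue_on {a..b}. (if t \<le> a then 0 else ln (b - a) - ln (t - a))) = b - a"
proof -
  have "(\<lambda>t. if t \<le> a then 0 else ln (b - a) - ln (t - a)) absolutely_integrable_on {a..b}"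
    by (rule nonnegative_absolutely_integrable_1)
      (use has_integral_ln_quotient[OF assms] in \<open>auto simp: integrable_on_def\<close>)
  then show i: "integrable (lebesgue_on {a..b}) (\<lambda>t. if t \<le> a then 0 else ln (b - a) - ln (t - a))"
    by (simp add: integrable_lebesgue_on_iff)
  show "(LINT t|lebesgue_on {a..b}. (if t \<le> a then 0 else ln (b - a) - ln (t - a))) = b - a"
    by (rule has_integral_unique[OF has_integral_integral_lebesgue_on[OF i] has_integral_ln_quotient[OF assms]]) simp
qed

lemma integrable_weighted_square:
  fixes f :: "real \<Rightarrow> 'a::{banach, second_countable_topology}"
  assumes "f square_integrable_on {a..b}"
  shows "integrable (lebesgue_on {a..b}) (\<lambda>t. (t - a) * (norm (f t))\<^sup>2)"
proof -
  have "continuous_on {a..b} (\<lambda>t. t - a)" by (intro continuous_intros)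
  moreover have "integrable (lebesgue_on {a..b}) (\<lambda>t. (norm (f t))\<^sup>2)"
    using assms by (simp add: square_integrable_on_def)
  ultimately have "integrable (lebesgue_on {a..b}) (\<lambda>t. (t - a) *\<^sub>R (norm (f t))\<^sup>2)"
    by (rule integrable_continuous_scaleR)
  then show ?thesis by simp
qed

text \<open>Cauchy-Schwarz with the weight \<open>s - a\<close> bounds \<open>\<bar>e(t)\<bar>\<^sup>2\<close> by \<open>ln ((b - a) / (t - a))\<close> times the
  weighted norm of \<open>e'\<close>, and the integral of the logarithm over \<open>[a,b]\<close> is \<open>b - a\<close>.\<close>

lemma weighted_Poincare:
  fixes e :: "real \<Rightarrow> 'a::{banach, second_countable_topology}"
  assumes "a < b" and e: "antideriv a b e e'" and e': "e' square_integrable_on {a..b}" and "e b = 0"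
  shows "(L2_norm {a..b} e)\<^sup>2 \<le> (b - a) * (LINT t|lebesgue_on {a..b}. (t - a) * (norm (e' t))\<^sup>2)"
proof -
  let ?M = "lebesgue_on {a..b}"
  define A where "A = (LINT t|?M. (t - a) * (norm (e' t))\<^sup>2)"
  define h where "h t = (if t \<le> a then 0 else ln (b - a) - ln (t - a))" for t
  have wint: "integrable ?M (\<lambda>t. (t - a) * (norm (e' t))\<^sup>2)"
    by (rule integrable_weighted_square[OF e'])
  have bound: "(norm (e t))\<^sup>2 \<le> h t * A" if t: "a < t" "t \<le> b" for t
  proof -
    let ?N = "lebesgue_on {t..b}"
    have sub: "e' square_integrable_on {t..b}"
      by (rule square_integrable_on_subset[OF e']) (use t in auto)
    have [measurable]: "e' \<in> borel_measurable ?N" using sub by (simp add: square_integrable_on_def)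
    have c: "continuous_on {t..b} (\<lambda>s. 1 / sqrt (s - a))" "continuous_on {t..b} (\<lambda>s. sqrt (s - a))"
      "continuous_on {t..b} (\<lambda>s. 1 / (s - a))"
      using t by (auto intro!: continuous_intros)
    note [measurable] = continuous_on_borel_measurable_lebesgue_on[OF c(1)]
      continuous_on_borel_measurable_lebesgue_on[OF c(2)]
    have wint': "integrable ?N (\<lambda>s. (s - a) * (norm (e' s))\<^sup>2)"
      by (rule integrable_lebesgue_on_subset[OF wint]) (use t in auto)
    have eq1: "integrable ?N (\<lambda>s. (1 / sqrt (s - a))\<^sup>2) \<longleftrightarrow> integrable ?N (\<lambda>s. 1 / (s - a))"
      "(\<integral>s. (1 / sqrt (s - a))\<^sup>2 \<partial>?N) = (\<integral>s. 1 / (s - a) \<partial>?N)"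
      using t by (auto intro!: Bochner_Integration.integrable_cong Bochner_Integration.integral_cong simp: power_divide)
    have eq2: "integrable ?N (\<lambda>s. (sqrt (s - a) * norm (e' s))\<^sup>2) \<longleftrightarrow> integrable ?N (\<lambda>s. (s - a) * (norm (e' s))\<^sup>2)"
      "(\<integral>s. (sqrt (s - a) * norm (e' s))\<^sup>2 \<partial>?N) = (\<integral>s. (s - a) * (norm (e' s))\<^sup>2 \<partial>?N)"
      using t by (auto intro!: Bochner_Integration.integrable_cong Bochner_Integration.integral_cong simp: power_mult_distrib)
    have eq3: "(\<integral>s. 1 / sqrt (s - a) * (sqrt (s - a) * norm (e' s)) \<partial>?N) = (\<integral>s. norm (e' s) \<partial>?N)"
      using t by (intro Bochner_Integration.integral_cong) auto
    have "norm (e t) \<le> (\<integral>s. norm (e' s) \<partial>?N)"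
    proof -
      have "- e t = integral\<^sup>L ?N e'" using antiderivD[OF e, of t b] t \<open>e b = 0\<close> by simp
      then have "norm (e t) = norm (integral\<^sup>L ?N e')" by (metis norm_minus_cancel)
      also have "\<dots> \<le> (\<integral>s. norm (e' s) \<partial>?N)" by (rule integral_norm_bound)
      finally show ?thesis .
    qed
    then have "(norm (e t))\<^sup>2 \<le> (\<integral>s. norm (e' s) \<partial>?N)\<^sup>2" by (intro power_mono) auto
    also have "\<dots> = (\<integral>s. 1 / sqrt (s - a) * (sqrt (s - a) * norm (e' s)) \<partial>?N)\<^sup>2" unfolding eq3 ..
    also have "\<dots> \<le> (\<integral>s. (1 / sqrt (s - a))\<^sup>2 \<partial>?N) * (\<integral>s. (sqrt (s - a) * norm (e' s))\<^sup>2 \<partial>?N)"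
    proof (rule Cauchy_Schwarz_integral)
      show "integrable ?N (\<lambda>s. (1 / sqrt (s - a))\<^sup>2)"
        unfolding eq1 by (rule continuous_on_integrable_lebesgue_on[OF c(3)])
      show "integrable ?N (\<lambda>s. (sqrt (s - a) * norm (e' s))\<^sup>2)" unfolding eq2 by (rule wint')
    qed measurable
    also have "\<dots> = (\<integral>s. 1 / (s - a) \<partial>?N) * (\<integral>s. (s - a) * (norm (e' s))\<^sup>2 \<partial>?N)"
      unfolding eq1 eq2 ..
    also have "(\<integral>s. 1 / (s - a) \<partial>?N) = h t"
    proof -
      have "(\<integral>s. 1 / (s - a) \<partial>?N) = ln (b - a) - ln (t - a)"
      proof (rule integral_lebesgue_on_FTC)
        show "((\<lambda>s. ln (s - a)) has_real_derivative 1 / (s - a)) (at s)" if "t \<le> s" for s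
          using that t by (auto intro!: derivative_eq_intros)
      qed (use t c in auto)
      then show ?thesis using t by (simp add: h_def)
    qed
    also have "h t * (\<integral>s. (s - a) * (norm (e' s))\<^sup>2 \<partial>?N) \<le> h t * A"
    proof (rule mult_left_mono)
      show "(\<integral>s. (s - a) * (norm (e' s))\<^sup>2 \<partial>?N) \<le> A"
        unfolding A_def
      proof (rule integral_mono_lebesgue_on_AE[OF wint])
        show "AE s in ?M. 0 \<le> (s - a) * (norm (e' s))\<^sup>2" by (rule AE_I2) auto
      qed (use t in auto)
      show "0 \<le> h t" using t by (auto simp: h_def)
    qed
    finally show ?thesis .
  qed
  have h: "integrable ?M h" "integral\<^sup>L ?M h = b - a"
    unfolding h_def[abs_def] using integrable_ln_quotient[OF \<open>a < b\<close>] integral_ln_quotient[OF \<open>a < b\<close>] by blast+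
  have "(L2_norm {a..b} e)\<^sup>2 \<le> (\<integral>t. h t * A \<partial>?M)"
    unfolding L2_norm_power2
  proof (rule integral_mono_AE)
    show "integrable ?M (\<lambda>t. (norm (e t))\<^sup>2)"
      using antideriv_square_integrable_on[OF e] by (simp add: square_integrable_on_def)
    show "integrable ?M (\<lambda>t. h t * A)" using h by simp
    \<comment> \<open>The logarithmic bound is available only to the right of \<open>a\<close>; that
      single point is null.\<close>
    have "AE t in ?M. t \<noteq> a"
      by (rule AE_lebesgue_on_insert[where S="{a..b} - {a}" and N="{a}"]) (auto intro!: AE_I2)
    moreover have "AE t in ?M. a \<le> t \<and> t \<le> b" by (rule AE_I2) simp
    ultimately show "AE t in ?M. (norm (e t))\<^sup>2 \<le> h t * A"
      by eventually_elim (use bound in auto)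
  qed
  also have "\<dots> = (b - a) * A" using h by simp
  finally show ?thesis unfolding A_def .
qed

lemma weighted_integral_le:
  fixes f :: "real \<Rightarrow> 'a::{banach, second_countable_topology}"
  assumes "a \<le> b" "f square_integrable_on {a..b}"
  shows "(LINT t|lebesgue_on {a..b}. (t - a) * (norm (f t))\<^sup>2) \<le> (b - a) * (L2_norm {a..b} f)\<^sup>2"
proof -
  let ?M = "lebesgue_on {a..b}"
  have f: "integrable ?M (\<lambda>t. (norm (f t))\<^sup>2)" using assms by (simp add: square_integrable_on_def)
  have "(\<integral>t. (t - a) * (norm (f t))\<^sup>2 \<partial>?M) \<le> (\<integral>t. (b - a) * (norm (f t))\<^sup>2 \<partial>?M)"
  proof (rule integral_mono)
    show "integrable ?M (\<lambda>t. (t - a) * (norm (f t))\<^sup>2)"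
      by (rule integrable_weighted_square[OF assms(2)])
    show "integrable ?M (\<lambda>t. (b - a) * (norm (f t))\<^sup>2)" using f by simp
    show "(t - a) * (norm (f t))\<^sup>2 \<le> (b - a) * (norm (f t))\<^sup>2" if "t \<in> space ?M" for t
      using that by (intro mult_right_mono) auto
  qed
  then show ?thesis by (simp add: L2_norm_power2)
qed

text \<open>Bounding the weight \<open>t - a\<close> by \<open>b - a\<close> removes it; this is the
  cost of one Taylor step.\<close>

lemma Poincare_endpoint:
  fixes e :: "real \<Rightarrow> 'a::{banach, second_countable_topology}"
  assumes "a < b" and e: "antideriv a b e e'" and e': "e' square_integrable_on {a..b}" and "e b = 0"
  shows "L2_norm {a..b} e \<le> (b - a) * L2_norm {a..b} e'"
proof (rule power2_le_imp_le)
  have "(L2_norm {a..b} e)\<^sup>2 \<le> (b - a) * ((b - a) * (L2_norm {a..b} e')\<^sup>2)"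
    using weighted_Poincare[OF assms] weighted_integral_le[OF _ e'] \<open>a < b\<close>
    by (smt (verit) mult_left_mono)
  then show "(L2_norm {a..b} e)\<^sup>2 \<le> ((b - a) * L2_norm {a..b} e')\<^sup>2"
    by (simp add: power_mult_distrib power2_eq_square mult_ac)
qed (use \<open>a < b\<close> in simp)

text \<open>Each step approximates the derivative first, shifts by a constant, and integrates. The
  estimate stops at the derivative \<open>r'\<close> of the remainder, since the interpolant is
  corrected through its derivative.\<close>

lemma Taylor_remainder:
  fixes v :: "nat \<Rightarrow> real \<Rightarrow> 'a::{banach, second_countable_topology}"
  assumes "a < b" "\<And>j. j < Suc m \<Longrightarrow> antideriv a b (v j) (v (Suc j))" "v (Suc m) square_integrable_on {a..b}"
  obtains P r' where "P \<in> vpoly (Suc m)" "antideriv a b (\<lambda>t. v 0 t - P t) r'"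
    "r' square_integrable_on {a..b}" "L2_norm {a..b} r' \<le> (b - a) ^ m * L2_norm {a..b} (v (Suc m))"
  using assms(2,3)
proof (induction m arbitrary: v thesis)
  case 0
  show ?case
    by (rule "0.prems"(1)[of "\<lambda>_. 0" "v 1"]) (use "0.prems"(2)[of 0] "0.prems"(3) in auto)
next
  case (Suc m)
  obtain P r' where P: "P \<in> vpoly (Suc m)" and r': "antideriv a b (\<lambda>t. v 1 t - P t) r'"
    "r' square_integrable_on {a..b}" "L2_norm {a..b} r' \<le> (b - a) ^ m * L2_norm {a..b} (v (Suc (Suc m)))"
    using Suc.IH[of "\<lambda>j. v (Suc j)"] Suc.prems(2,3) by auto
  \<comment> \<open>This constant makes the remainder of \<open>v 1\<close> vanish at
    \<open>b\<close>, as the Poincare inequality requires.\<close>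
  let ?c = "v 1 b - P b"
  have Pc: "(\<lambda>t. P t + ?c) \<in> vpoly (Suc m)" by (intro vpoly_add P vpoly_const) simp
  obtain Q where Q: "Q \<in> vpoly (Suc (Suc m))" "antideriv a b Q (\<lambda>t. P t + ?c)"
    using vpoly_antideriv[OF Pc] by metis
  have 1: "antideriv a b (\<lambda>t. v 0 t - Q t) (\<lambda>t. v 1 t - (P t + ?c))"
    using Suc.prems(2)[of 0] by (intro antideriv_diff Q(2)) auto
  have 2: "antideriv a b (\<lambda>t. v 1 t - (P t + ?c)) r'"
    using antideriv_diff[OF r'(1) antideriv_zero[of a b ?c]] by (simp add: diff_diff_eq)
  have "L2_norm {a..b} (\<lambda>t. v 1 t - (P t + ?c)) \<le> (b - a) * L2_norm {a..b} r'"
    by (rule Poincare_endpoint[OF \<open>a < b\<close> 2 r'(2)]) simp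
  also have "\<dots> \<le> (b - a) * ((b - a) ^ m * L2_norm {a..b} (v (Suc (Suc m))))"
    using r'(3) \<open>a < b\<close> by (intro mult_left_mono) auto
  finally have "L2_norm {a..b} (\<lambda>t. v 1 t - (P t + ?c)) \<le> (b - a) ^ Suc m * L2_norm {a..b} (v (Suc (Suc m)))"
    by simp
  then show ?case
    by (rule Suc.prems(1)[OF Q(1) 1 antideriv_square_integrable_on[OF 2]])
qed

text \<open>Normalising the antiderivative at \<open>a\<close> makes it divisible by
  \<open>t - a\<close>, which is how the weight enters the moment conditions.\<close>

lemma pderiv_surj:
  fixes \<psi> :: "real poly"
  obtains \<zeta> where "pderiv \<zeta> = \<psi>" "poly \<zeta> a = 0" "degree \<zeta> \<le> Suc (degree \<psi>)"
proof -
  define \<zeta> where "\<zeta> = (\<Sum>i\<le>degree \<psi>. monom (coeff \<psi> i / real (Suc i)) (Suc i))"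
  have "pderiv (\<Sum>i\<le>n. monom (coeff \<psi> i / real (Suc i)) (Suc i)) = (\<Sum>i\<le>n. monom (coeff \<psi> i) i)" for n
    by (induction n) (simp_all add: pderiv_add pderiv_monom del: of_nat_Suc)
  then have "pderiv \<zeta> = (\<Sum>i\<le>degree \<psi>. monom (coeff \<psi> i) i)"
    unfolding \<zeta>_def .
  then have \<zeta>: "pderiv \<zeta> = \<psi>" by (simp add: poly_as_sum_of_monoms)
  have "degree \<zeta> \<le> Suc (degree \<psi>)"
    unfolding \<zeta>_def by (intro degree_sum_le) (auto intro: order_trans[OF degree_monom_le])
  then have "degree (\<zeta> - [:poly \<zeta> a:]) \<le> Suc (degree \<psi>)"
    by (intro degree_diff_le) auto
  then show ?thesis
    using that[of "\<zeta> - [:poly \<zeta> a:]"] \<zeta> by (simp add: pderiv_diff)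
qed

text \<open>The derivative of the interpolant is the best approximation of \<open>r'\<close> for the weight \<open>t - a\<close>: since
  every polynomial of degree at most \<open>q - 2\<close> is the derivative of some \<open>(t - a) \<eta>(t)\<close>, an integration
  by parts turns weighted orthogonality of the derivative of the error into the moment conditions.\<close>

theorem interpolation_error:
  fixes v :: "nat \<Rightarrow> real \<Rightarrow> 'a::{real_inner, banach, second_countable_topology}"
  assumes "a < b" "1 \<le> m" "m \<le> q"
    and v: "\<And>j. j < m \<Longrightarrow> antideriv a b (v j) (v (Suc j))" "v m square_integrable_on {a..b}"
  obtains p where "p \<in> vpoly q" "p b = v 0 b"
    "\<And>\<psi>. degree \<psi> + 2 \<le> q \<Longrightarrow> (LINT t|lebesgue_on {a..b}. poly \<psi> t *\<^sub>R (v 0 t - p t)) = 0"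
    "L2_norm {a..b} (\<lambda>t. v 0 t - p t) \<le> (b - a) ^ m * L2_norm {a..b} (v m)"
proof -
  obtain m' where m': "m = Suc m'" using \<open>1 \<le> m\<close> by (cases m) auto
  obtain P r' where P: "P \<in> vpoly m" and r: "antideriv a b (\<lambda>t. v 0 t - P t) r'"
    and r': "r' square_integrable_on {a..b}" "L2_norm {a..b} r' \<le> (b - a) ^ m' * L2_norm {a..b} (v m)"
    using Taylor_remainder[of a b m' v] \<open>a < b\<close> v unfolding m' by metis
  \<comment> \<open>\<open>vpoly (q - 1)\<close> means degree at most \<open>q - 2\<close>. For
    \<open>q = 1\<close> the projection is zero and the correction \<open>F\<close> is a constant
    that adjusts the end value.\<close>
  obtain \<phi> where \<phi>: "\<phi> \<in> vpoly (q - 1)"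
    and orth: "\<And>\<psi>. (\<forall>i\<ge>q - 1. coeff \<psi> i = 0) \<Longrightarrow>
        (LINT t|lebesgue_on {a..b}. ((t - a) * poly \<psi> t) *\<^sub>R (r' t - \<phi> t)) = 0"
    and best: "(LINT t|lebesgue_on {a..b}. (t - a) * (norm (r' t - \<phi> t))\<^sup>2)
        \<le> (LINT t|lebesgue_on {a..b}. (t - a) * (norm (r' t))\<^sup>2)"
    by (rule weighted_projection[OF \<open>a < b\<close> r'(1), of "q - 1"]) (rule that)
  obtain F where F: "F \<in> vpoly (Suc (q - 1))" "antideriv a b F \<phi>" "F b = v 0 b - P b"
    using vpoly_antideriv[OF \<phi>] by metis
  define p where "p t = P t + F t" for t
  have p: "p \<in> vpoly q"
    unfolding p_def[abs_def] using F(1) \<open>1 \<le> m\<close> \<open>m \<le> q\<close> by (intro vpoly_add vpoly_mono[OF P]) auto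
  let ?e = "\<lambda>t. v 0 t - p t" and ?e' = "\<lambda>t. r' t - \<phi> t"
  have e: "antideriv a b ?e ?e'"
    using antideriv_diff[OF r F(2)] by (simp add: p_def diff_diff_eq)
  have e': "?e' square_integrable_on {a..b}"
    by (intro square_integrable_on_diff r'(1) continuous_on_square_integrable_on continuous_on_vpoly[OF \<phi>])
  have eb: "?e b = 0" using F(3) by (simp add: p_def)
  \<comment> \<open>One square root of \<open>b - a\<close> comes from the weighted Poincare
    inequality, the other from bounding the weight after the projection has been compared with
    \<open>r'\<close>.\<close>
  have "L2_norm {a..b} ?e \<le> (b - a) * L2_norm {a..b} r'"
  proof (rule power2_le_imp_le)
    have "(L2_norm {a..b} ?e)\<^sup>2 \<le> (b - a) * (LINT t|lebesgue_on {a..b}. (t - a) * (norm (?e' t))\<^sup>2)"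
      by (rule weighted_Poincare[OF \<open>a < b\<close> e e' eb])
    also have "\<dots> \<le> (b - a) * ((b - a) * (L2_norm {a..b} r')\<^sup>2)"
      using order_trans[OF best weighted_integral_le[OF _ r'(1)]] \<open>a < b\<close> by (intro mult_left_mono) auto
    finally show "(L2_norm {a..b} ?e)\<^sup>2 \<le> ((b - a) * L2_norm {a..b} r')\<^sup>2"
      by (simp add: power_mult_distrib power2_eq_square mult_ac)
  qed (use \<open>a < b\<close> in simp)
  also have "\<dots> \<le> (b - a) * ((b - a) ^ m' * L2_norm {a..b} (v m))"
    using r'(2) \<open>a < b\<close> by (intro mult_left_mono) auto
  finally have bound: "L2_norm {a..b} ?e \<le> (b - a) ^ m * L2_norm {a..b} (v m)" by (simp add: m')
  have mom: "(LINT t|lebesgue_on {a..b}. poly \<psi> t *\<^sub>R ?e t) = 0" if \<psi>: "degree \<psi> + 2 \<le> q" for \<psi>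
  proof -
    obtain \<zeta> where \<zeta>: "pderiv \<zeta> = \<psi>" "poly \<zeta> a = 0" "degree \<zeta> \<le> Suc (degree \<psi>)"
      using pderiv_surj by metis
    from \<zeta>(2) obtain \<eta> where \<eta>: "\<zeta> = [:- a, 1:] * \<eta>" by (auto simp: poly_eq_0_iff_dvd)
    \<comment> \<open>Dividing by \<open>t - a\<close> lowers the degree by one, undoing the
      integration: \<open>\<eta>\<close> has degree at most that of \<open>\<psi>\<close>, hence at
      most \<open>q - 2\<close>.\<close>
    have "\<forall>i\<ge>q - 1. coeff \<eta> i = 0"
    proof (cases "\<eta> = 0")
      case False
      then have "degree \<zeta> = Suc (degree \<eta>)" unfolding \<eta> by (subst degree_mult_eq) auto
      then show ?thesis using \<zeta>(3) \<psi> by (auto intro: coeff_eq_0)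
    qed simp
    from orth[OF this] have "(LINT t|lebesgue_on {a..b}. poly \<zeta> t *\<^sub>R ?e' t) = 0"
      by (simp add: \<eta> algebra_simps)
    moreover have "(LINT t|lebesgue_on {a..b}. poly (pderiv \<zeta>) t *\<^sub>R ?e t)
        = poly \<zeta> b *\<^sub>R ?e b - poly \<zeta> a *\<^sub>R ?e a - (LINT t|lebesgue_on {a..b}. poly \<zeta> t *\<^sub>R ?e' t)"
      by (rule integral_by_parts[OF e]) (use \<open>a < b\<close> in \<open>auto intro!: poly_DERIV continuous_intros\<close>)
    ultimately show ?thesis using \<zeta>(1,2) eb by simp
  qed
  show ?thesis
    by (rule that[OF p _ mom bound]) (use eb in auto)
qed

section \<open>Piecewise polynomials and the form D\<close>

lemma meshD:
  assumes "is_mesh T N \<tau>"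
  shows "1 \<le> N" "\<tau> 0 = 0" "\<tau> N = T" "\<And>n. n \<in> {1..N} \<Longrightarrow> \<tau> (n - 1) < \<tau> n"
  using assms by (auto simp: is_mesh_def)

lemma mesh_mono:
  assumes "is_mesh T N \<tau>" "i \<le> j" "j \<le> N"
  shows "\<tau> i \<le> \<tau> j"
  using assms(2,3)
proof (induction j rule: dec_induct)
  case (step j)
  then show ?case using meshD(4)[OF assms(1), of "Suc j"] by simp
qed simp

lemma mesh_subinterval:
  assumes "is_mesh T N \<tau>" "n \<in> {1..N}"
  shows "0 \<le> \<tau> (n - 1)" "\<tau> (n - 1) < \<tau> n" "\<tau> n \<le> T"
  using mesh_mono[OF assms(1), of 0 "n - 1"] mesh_mono[OF assms(1), of n N] assms meshD[OF assms(1)]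
  by auto

lemma mesh_integral_sum:
  fixes f :: "real \<Rightarrow> 'a::{banach, second_countable_topology}"
  assumes mesh: "is_mesh T N \<tau>" and f: "integrable (lebesgue_on {0..T}) f"
  shows "integral\<^sup>L (lebesgue_on {0..T}) f = (\<Sum>n=1..N. integral\<^sup>L (lebesgue_on {\<tau> (n - 1)..\<tau> n}) f)"
proof -
  have "integral\<^sup>L (lebesgue_on {\<tau> 0..\<tau> k}) f = (\<Sum>n=1..k. integral\<^sup>L (lebesgue_on {\<tau> (n - 1)..\<tau> n}) f)"
    if "k \<le> N" for k
    using that
  proof (induction k)
    case 0
    have "integral\<^sup>L (lebesgue_on {\<tau> 0..\<tau> 0}) f = integral\<^sup>L (lebesgue_on {}) f"
      by (rule integral_lebesgue_on_finite_diff[where N="{\<tau> 0}"]) auto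
    then show ?case by (simp add: Bochner_Integration.integral_empty)
  next
    case (Suc k)
    have "integrable (lebesgue_on {\<tau> 0..\<tau> (Suc k)}) f"
      by (rule integrable_lebesgue_on_subset[OF f])
        (use mesh_mono[OF mesh, of "Suc k" N] meshD[OF mesh] Suc.prems in auto)
    moreover have "\<tau> 0 \<le> \<tau> k" "\<tau> k \<le> \<tau> (Suc k)"
      using mesh_mono[OF mesh] Suc.prems by auto
    ultimately have "integral\<^sup>L (lebesgue_on {\<tau> 0..\<tau> (Suc k)}) f
      = integral\<^sup>L (lebesgue_on {\<tau> 0..\<tau> k}) f + integral\<^sup>L (lebesgue_on {\<tau> k..\<tau> (Suc k)}) f"
      by (rule integral_lebesgue_on_combine)
    then show ?case using Suc by simp
  qed
  from this[of N] show ?thesis using meshD[OF mesh] by simp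
qed

lemma Ivl_finite_diff:
  "Ivl \<tau> n \<in> sets lebesgue" "{\<tau> (n - 1)..\<tau> n} \<in> sets lebesgue" "Ivl \<tau> n - {\<tau> (n - 1)..\<tau> n} \<subseteq> {\<tau> (n - 1)}"
  "{\<tau> (n - 1)..\<tau> n} - Ivl \<tau> n \<subseteq> {\<tau> (n - 1)}" "finite {\<tau> (n - 1)}"
  by (auto simp: Ivl_def)

lemma Ioo_finite_diff:
  "{0<..<T::real} \<in> sets lebesgue" "{0..T} \<in> sets lebesgue" "{0<..<T} - {0..T} \<subseteq> {0, T}"
  "{0..T} - {0<..<T} \<subseteq> {0, T}" "finite {0, T}"
  by auto

text \<open>On \<open>(0,T]\<close> the least \<open>n\<close> with \<open>t \<le> \<tau> n\<close>
  is the index of the half-open interval containing \<open>t\<close>; a mesh point thus belongs to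
  the interval on its left.\<close>

definition piecewise :: "(nat \<Rightarrow> real) \<Rightarrow> (nat \<Rightarrow> real \<Rightarrow> 'a) \<Rightarrow> real \<Rightarrow> 'a" where
  "piecewise \<tau> P t = P (LEAST n. t \<le> \<tau> n) t"

lemma piecewise_Ivl:
  assumes "is_mesh T N \<tau>" "n \<in> {1..N}" "t \<in> Ivl \<tau> n"
  shows "piecewise \<tau> P t = P n t"
proof -
  have "(LEAST n. t \<le> \<tau> n) = n"
  proof (rule Least_equality)
    show "t \<le> \<tau> n" using assms(3) by (simp add: Ivl_def)
    fix k assume "t \<le> \<tau> k"
    show "n \<le> k"
    proof (rule ccontr)
      assume "\<not> n \<le> k"
      then have "\<tau> k \<le> \<tau> (n - 1)" using assms(2) by (intro mesh_mono[OF assms(1)]) auto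
      with \<open>t \<le> \<tau> k\<close> assms(3) show False by (simp add: Ivl_def)
    qed
  qed
  then show ?thesis by (simp add: piecewise_def)
qed

lemma right_lim_Ivl:
  fixes Y :: "real \<Rightarrow> 'a::real_normed_vector"
  assumes "\<tau> (n - 1) < \<tau> n" "\<And>t. t \<in> Ivl \<tau> n \<Longrightarrow> Y t = P t" "isCont P (\<tau> (n - 1))"
  shows "right_lim Y (\<tau> (n - 1)) = P (\<tau> (n - 1))"
proof -
  have "(P \<longlongrightarrow> P (\<tau> (n - 1))) (at_right (\<tau> (n - 1)))"
    using assms(3) unfolding isCont_def by (rule tendsto_mono[rotated]) (simp add: at_le)
  moreover have "\<forall>\<^sub>F t in at_right (\<tau> (n - 1)). P t = Y t"
    using eventually_at_right_less[of "\<tau> (n - 1)"] eventually_at_right_real[OF assms(1)]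
    by eventually_elim (use assms(2) in \<open>auto simp: Ivl_def\<close>)
  ultimately have "(Y \<longlongrightarrow> P (\<tau> (n - 1))) (at_right (\<tau> (n - 1)))"
    by (rule Lim_transform_eventually)
  then show ?thesis unfolding right_lim_def by (intro tendsto_Lim) auto
qed

text \<open>At the right end point the derivative is one-sided; it is unique because
  \<open>t\<close> is a limit point of the interval from the left.\<close>

lemma vector_derivative_Ivl:
  fixes Y :: "real \<Rightarrow> 'a::real_normed_vector"
  assumes "\<And>t. t \<in> Ivl \<tau> n \<Longrightarrow> Y t = P t" "(P has_vector_derivative P') (at t)" "t \<in> Ivl \<tau> n"
  shows "vector_derivative Y (at t within Ivl \<tau> n) = P'"
proof (rule vector_derivative_within)
  show "at t within Ivl \<tau> n \<noteq> bot"
  proof -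
    have "t islimpt {\<tau> (n - 1)<..<t}"
      using assms(3) by (intro islimpt_greaterThanLessThan2) (simp add: Ivl_def)
    then have "t islimpt Ivl \<tau> n"
      by (rule islimpt_subset) (use assms(3) in \<open>auto simp: Ivl_def\<close>)
    then show ?thesis by (simp add: trivial_limit_within)
  qed
  have "(P has_vector_derivative P') (at t within Ivl \<tau> n)"
    using assms(2) by (rule has_vector_derivative_at_within)
  then show "(Y has_vector_derivative P') (at t within Ivl \<tau> n)"
    by (rule has_vector_derivative_transform[rotated 2]) (use assms in auto)
qed

lemma sum_1_shift:
  fixes f :: "nat \<Rightarrow> 'a::comm_monoid_add"
  assumes "1 \<le> N"
  shows "(\<Sum>n=1..N. f n) = f 1 + (\<Sum>n=1..N-1. f (Suc n))"
  using assms
proof (induction N rule: dec_induct)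
  case (step N)
  then show ?case by (cases N) (simp_all add: add.assoc)
qed simp

text \<open>The form D for explicitly given pieces and derivatives. The right limits of the jumps
  and the initial term are assigned to the interval on their right, so that only the products with
  the left values couple two intervals.\<close>

definition D_sum ::
  "(nat \<Rightarrow> real) \<Rightarrow> nat \<Rightarrow> (nat \<Rightarrow> real \<Rightarrow> 'h) \<Rightarrow> (nat \<Rightarrow> real \<Rightarrow> 'h) \<Rightarrow> (nat \<Rightarrow> real \<Rightarrow> 'h::real_inner) \<Rightarrow> real" where
  "D_sum \<tau> N P P' R =
     (\<Sum>n=1..N. (LINT t|lebesgue_on {\<tau> (n - 1)..\<tau> n}. P' n t \<bullet> R n t) + P n (\<tau> (n - 1)) \<bullet> R n (\<tau> (n - 1)))
     - (\<Sum>n=1..N-1. P n (\<tau> n) \<bullet> R (Suc n) (\<tau> n))"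

lemma D_form_eq_D_sum:
  fixes P P' R :: "nat \<Rightarrow> real \<Rightarrow> 'h::real_inner"
  assumes mesh: "is_mesh T N \<tau>"
    and Y: "\<And>n t. n \<in> {1..N} \<Longrightarrow> t \<in> Ivl \<tau> n \<Longrightarrow> Y t = P n t"
    and X: "\<And>n t. n \<in> {1..N} \<Longrightarrow> t \<in> Ivl \<tau> n \<Longrightarrow> X t = R n t"
    and P: "\<And>n t. (P n has_vector_derivative P' n t) (at t)" and R: "\<And>n t. isCont (R n) t"
  shows "D_form \<tau> N Y X = D_sum \<tau> N P P' R"
proof -
  have lim: "right_lim Y (\<tau> (n - 1)) = P n (\<tau> (n - 1))" "right_lim X (\<tau> (n - 1)) = R n (\<tau> (n - 1))"
    if "n \<in> {1..N}" for n
    using right_lim_Ivl[OF meshD(4)[OF mesh that] Y[OF that] has_vector_derivative_continuous[OF P]]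
      right_lim_Ivl[OF meshD(4)[OF mesh that] X[OF that] R] by auto
  have int: "(LINT t|lebesgue_on (Ivl \<tau> n). vector_derivative Y (at t within Ivl \<tau> n) \<bullet> X t)
      = (LINT t|lebesgue_on {\<tau> (n - 1)..\<tau> n}. P' n t \<bullet> R n t)" if "n \<in> {1..N}" for n
  proof -
    have "(LINT t|lebesgue_on (Ivl \<tau> n). vector_derivative Y (at t within Ivl \<tau> n) \<bullet> X t)
        = (LINT t|lebesgue_on (Ivl \<tau> n). P' n t \<bullet> R n t)"
      using X[OF that] vector_derivative_Ivl[OF Y[OF that] P]
      by (intro Bochner_Integration.integral_cong refl) simp
    also have "\<dots> = (LINT t|lebesgue_on {\<tau> (n - 1)..\<tau> n}. P' n t \<bullet> R n t)"
      by (rule integral_lebesgue_on_finite_diff[OF Ivl_finite_diff])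
    finally show ?thesis .
  qed
  have 1: "(\<Sum>n=1..N-1. (right_lim Y (\<tau> n) - Y (\<tau> n)) \<bullet> right_lim X (\<tau> n))
      = (\<Sum>n=1..N-1. P (Suc n) (\<tau> n) \<bullet> R (Suc n) (\<tau> n)) - (\<Sum>n=1..N-1. P n (\<tau> n) \<bullet> R (Suc n) (\<tau> n))"
    unfolding sum_subtractf[symmetric]
  proof (rule sum.cong)
    fix n assume n: "n \<in> {1..N-1}"
    then have "\<tau> n \<in> Ivl \<tau> n" using meshD(4)[OF mesh, of n] by (auto simp: Ivl_def)
    then have "Y (\<tau> n) = P n (\<tau> n)" using n by (intro Y) auto
    moreover have "right_lim Y (\<tau> n) = P (Suc n) (\<tau> n)" "right_lim X (\<tau> n) = R (Suc n) (\<tau> n)"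
      using lim[of "Suc n"] n by auto
    ultimately show "(right_lim Y (\<tau> n) - Y (\<tau> n)) \<bullet> right_lim X (\<tau> n)
        = P (Suc n) (\<tau> n) \<bullet> R (Suc n) (\<tau> n) - P n (\<tau> n) \<bullet> R (Suc n) (\<tau> n)"
      by (simp add: inner_diff_left)
  qed simp
  have 2: "(\<Sum>n=1..N. P n (\<tau> (n - 1)) \<bullet> R n (\<tau> (n - 1)))
      = P 1 (\<tau> 0) \<bullet> R 1 (\<tau> 0) + (\<Sum>n=1..N-1. P (Suc n) (\<tau> n) \<bullet> R (Suc n) (\<tau> n))"
  proof -
    show ?thesis
      using sum_1_shift[OF meshD(1)[OF mesh], of "\<lambda>n. P n (\<tau> (n - 1)) \<bullet> R n (\<tau> (n - 1))"] by simp
  qed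
  have "right_lim Y (\<tau> 0) = P 1 (\<tau> 0)" "right_lim X (\<tau> 0) = R 1 (\<tau> 0)"
    using lim[of 1] meshD(1)[OF mesh] by auto
  then show ?thesis
    unfolding D_form_def D_sum_def 1 sum.distrib 2 using int by simp
qed

lemma D_sum_diff:
  fixes P P' Q Q' R :: "nat \<Rightarrow> real \<Rightarrow> 'h::{real_inner, banach, second_countable_topology}"
  assumes "\<And>n. continuous_on UNIV (P' n)" "\<And>n. continuous_on UNIV (Q' n)" "\<And>n. continuous_on UNIV (R n)"
  shows "D_sum \<tau> N (\<lambda>n t. P n t - Q n t) (\<lambda>n t. P' n t - Q' n t) R = D_sum \<tau> N P P' R - D_sum \<tau> N Q Q' R"
proof -
  have "integrable (lebesgue_on {\<tau> (n - 1)..\<tau> n}) (\<lambda>t. F n t \<bullet> R n t)" if "continuous_on UNIV (F n)"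
    for n and F :: "nat \<Rightarrow> real \<Rightarrow> 'h"
    using that assms(3)[of n]
    by (intro continuous_on_integrable_lebesgue_on continuous_on_inner) (auto intro: continuous_on_subset)
  then show ?thesis
    using assms unfolding D_sum_def by (simp add: inner_diff_left sum_subtractf sum.distrib)
qed

text \<open>\<open>x n\<close> and \<open>y n\<close> stand for the values at the left and right end
  of the \<open>n\<close>-th interval. Each coupling is absorbed by half a square from either
  neighbour, and only the half square of the last right end value survives.\<close>

lemma D_sum_lower_bound_aux:
  fixes x y :: "nat \<Rightarrow> 'h::real_inner"
  assumes "1 \<le> N"
  shows "(\<Sum>n=1..N. (norm (y n))\<^sup>2 / 2 + (norm (x n))\<^sup>2 / 2) - (\<Sum>n=1..N-1. y n \<bullet> x (Suc n)) \<ge> (norm (y N))\<^sup>2 / 2"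
  using assms
proof (induction N rule: dec_induct)
  case (step N)
  have "y N \<bullet> x (Suc N) \<le> norm (y N) * norm (x (Suc N))" by (rule norm_cauchy_schwarz)
  also have "\<dots> \<le> (norm (y N))\<^sup>2 / 2 + (norm (x (Suc N)))\<^sup>2 / 2"
    using sum_squares_bound[of "norm (y N)" "norm (x (Suc N))"] by simp
  finally have "y N \<bullet> x (Suc N) \<le> (norm (y N))\<^sup>2 / 2 + (norm (x (Suc N)))\<^sup>2 / 2" .
  moreover have "(\<Sum>n=1..Suc N-1. y n \<bullet> x (Suc n)) = (\<Sum>n=1..N-1. y n \<bullet> x (Suc n)) + y N \<bullet> x (Suc N)"
    using step.hyps(1) by (cases N) auto
  ultimately show ?case using step by simp
qed simp

lemma integral_inner_derivative:
  fixes x :: "real \<Rightarrow> 'h::{real_inner, banach, second_countable_topology}"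
  assumes "\<And>t. (x has_vector_derivative x' t) (at t)" "continuous_on UNIV x'" "a \<le> b"
  shows "(LINT t|lebesgue_on {a..b}. x' t \<bullet> x t) = (norm (x b))\<^sup>2 / 2 - (norm (x a))\<^sup>2 / 2"
proof (rule integral_lebesgue_on_FTC[OF assms(3)])
  show "((\<lambda>t. (norm (x t))\<^sup>2 / 2) has_real_derivative x' t \<bullet> x t) (at t)" for t
  proof -
    have "((\<lambda>t. x t \<bullet> x t) has_derivative (\<lambda>h. x t \<bullet> (h *\<^sub>R x' t) + (h *\<^sub>R x' t) \<bullet> x t)) (at t)"
      using assms(1)[of t] unfolding has_vector_derivative_def by (intro has_derivative_inner)
    then have "((\<lambda>t. x t \<bullet> x t) has_derivative (\<lambda>h. h *\<^sub>R (2 * (x' t \<bullet> x t)))) (at t)"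
      by (simp add: inner_commute mult_2[symmetric] mult.left_commute)
    then have "((\<lambda>t. x t \<bullet> x t) has_real_derivative 2 * (x' t \<bullet> x t)) (at t)"
      by (simp add: has_real_derivative_iff_has_vector_derivative has_vector_derivative_def)
    then have "((\<lambda>t. x t \<bullet> x t / 2) has_real_derivative 2 * (x' t \<bullet> x t) / 2) (at t)"
      by (rule DERIV_cdivide)
    then show ?thesis by (simp add: power2_norm_eq_inner)
  qed
  have "continuous_on {a..b} x"
    using assms(1) by (auto intro!: continuous_at_imp_continuous_on has_vector_derivative_continuous)
  then show "continuous_on {a..b} (\<lambda>t. x' t \<bullet> x t)"
    using assms(2) by (intro continuous_on_inner) (auto intro: continuous_on_subset)
qed

text \<open>The integral of \<open>P' \<bullet> P\<close> is half the difference of the end squares;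
  adding the full square at the left end turns it into half their sum.\<close>

lemma D_sum_lower_bound:
  fixes P P' :: "nat \<Rightarrow> real \<Rightarrow> 'h::{real_inner, banach, second_countable_topology}"
  assumes mesh: "is_mesh T N \<tau>" and P: "\<And>n t. (P n has_vector_derivative P' n t) (at t)"
    and P': "\<And>n. continuous_on UNIV (P' n)"
  shows "D_sum \<tau> N P P' P \<ge> (norm (P N T))\<^sup>2 / 2"
proof -
  have "(LINT t|lebesgue_on {\<tau> (n - 1)..\<tau> n}. P' n t \<bullet> P n t) + P n (\<tau> (n - 1)) \<bullet> P n (\<tau> (n - 1))
      = (norm (P n (\<tau> n)))\<^sup>2 / 2 + (norm (P n (\<tau> (n - 1))))\<^sup>2 / 2" if "n \<in> {1..N}" for n
    using integral_inner_derivative[OF P P', of "\<tau> (n - 1)" "\<tau> n"] meshD(4)[OF mesh that]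
    by (simp add: power2_norm_eq_inner)
  then have "D_sum \<tau> N P P' P = (\<Sum>n=1..N. (norm (P n (\<tau> n)))\<^sup>2 / 2 + (norm (P n (\<tau> (n - 1))))\<^sup>2 / 2)
      - (\<Sum>n=1..N-1. P n (\<tau> n) \<bullet> P (Suc n) (\<tau> n))"
    unfolding D_sum_def by simp
  then show ?thesis
    using D_sum_lower_bound_aux[OF meshD(1)[OF mesh], of "\<lambda>n. P n (\<tau> n)" "\<lambda>n. P n (\<tau> (n - 1))"]
      meshD(3)[OF mesh] by simp
qed

text \<open>Expanding the test polynomial in powers of \<open>t\<close> reduces the claim to scalar
  weights, so that its derivative appears through scalar moments of \<open>v\<close>.
  \<open>monom (real j) (j - 1)\<close> is the derivative of the \<open>j\<close>-th power, also for
  \<open>j = 0\<close>, where it is zero.\<close>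

lemma integral_inner_by_parts:
  fixes v :: "real \<Rightarrow> 'h::{real_inner, banach, second_countable_topology}"
  assumes v: "antideriv a b v w" and "a \<le> b" and R: "\<And>t. R t = (\<Sum>j<q. t ^ j *\<^sub>R c j)"
  shows "(LINT t|lebesgue_on {a..b}. w t \<bullet> R t) = v b \<bullet> R b - v a \<bullet> R a
    - (\<Sum>j<q. (LINT t|lebesgue_on {a..b}. poly (monom (real j) (j - 1)) t *\<^sub>R v t) \<bullet> c j)"
proof -
  let ?M = "lebesgue_on {a..b}"
  have w: "integrable ?M w" by (rule antideriv_integrable[OF v])
  have vi: "integrable ?M v" by (rule continuous_on_integrable_lebesgue_on[OF antideriv_continuous_on[OF v]])
  have i: "integrable ?M (\<lambda>t. \<phi> t *\<^sub>R w t)" "integrable ?M (\<lambda>t. \<phi> t *\<^sub>R v t)" if "continuous_on {a..b} \<phi>" for \<phi>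
    using that w vi by (auto intro: integrable_continuous_scaleR)
  have ci: "continuous_on {a..b} (\<lambda>t. t ^ j)" for j by (intro continuous_intros)
  have "(\<integral>t. w t \<bullet> R t \<partial>?M) = (\<integral>t. (\<Sum>j<q. (t ^ j *\<^sub>R w t) \<bullet> c j) \<partial>?M)"
    by (simp add: R inner_sum_right)
  also have "\<dots> = (\<Sum>j<q. \<integral>t. (t ^ j *\<^sub>R w t) \<bullet> c j \<partial>?M)"
    using i(1)[OF ci] by (intro Bochner_Integration.integral_sum integrable_inner_left) auto
  also have "\<dots> = (\<Sum>j<q. (b ^ j *\<^sub>R v b - a ^ j *\<^sub>R v a - (\<integral>t. poly (monom (real j) (j - 1)) t *\<^sub>R v t \<partial>?M)) \<bullet> c j)"
  proof (rule sum.cong)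
    fix j
    have "(\<integral>t. (real j * t ^ (j - 1)) *\<^sub>R v t \<partial>?M) = b ^ j *\<^sub>R v b - a ^ j *\<^sub>R v a - (\<integral>t. t ^ j *\<^sub>R w t \<partial>?M)"
    proof (rule integral_by_parts[OF v \<open>a \<le> b\<close>])
      show "((\<lambda>t. t ^ j) has_real_derivative real j * t ^ (j - 1)) (at t)" for t
        using DERIV_pow[of j t UNIV] by simp
    qed (intro continuous_intros)
    then have "(\<integral>t. t ^ j *\<^sub>R w t \<partial>?M) = b ^ j *\<^sub>R v b - a ^ j *\<^sub>R v a - (\<integral>t. poly (monom (real j) (j - 1)) t *\<^sub>R v t \<partial>?M)"
      by (simp add: poly_monom algebra_simps)
    moreover have "(\<integral>t. (t ^ j *\<^sub>R w t) \<bullet> c j \<partial>?M) = (\<integral>t. t ^ j *\<^sub>R w t \<partial>?M) \<bullet> c j"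
      using i(1)[OF ci] by (intro integral_inner_left) auto
    ultimately show "(\<integral>t. (t ^ j *\<^sub>R w t) \<bullet> c j \<partial>?M)
      = (b ^ j *\<^sub>R v b - a ^ j *\<^sub>R v a - (\<integral>t. poly (monom (real j) (j - 1)) t *\<^sub>R v t \<partial>?M)) \<bullet> c j" by simp
  qed simp
  also have "\<dots> = v b \<bullet> R b - v a \<bullet> R a
    - (\<Sum>j<q. (\<integral>t. poly (monom (real j) (j - 1)) t *\<^sub>R v t \<partial>?M) \<bullet> c j)"
    by (simp add: inner_diff_left sum_subtractf R inner_sum_right)
  finally show ?thesis .
qed

text \<open>On each interval the error \<open>v - P\<close> vanishes at the right end point and is orthogonal to the
  derivative of every test polynomial. Hence the interpolant satisfies the discrete scheme exactly.\<close>

lemma D_sum_interpolant: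
  fixes v :: "real \<Rightarrow> 'h::{real_inner, banach, second_countable_topology}"
  assumes mesh: "is_mesh T N \<tau>" and v: "antideriv 0 T v w" and w: "w square_integrable_on {0..T}"
    and P: "\<And>n. P n \<in> vpoly q" "\<And>n. P' n \<in> vpoly q'" "\<And>n a b. antideriv a b (P n) (P' n)"
    and end': "\<And>n. n \<in> {1..N} \<Longrightarrow> P n (\<tau> n) = v (\<tau> n)"
    and mom: "\<And>n \<psi>. n \<in> {1..N} \<Longrightarrow> degree \<psi> + 2 \<le> q \<Longrightarrow>
      (LINT t|lebesgue_on {\<tau> (n - 1)..\<tau> n}. poly \<psi> t *\<^sub>R (v t - P n t)) = 0"
    and R: "\<And>n. R n \<in> vpoly q"
  shows "D_sum \<tau> N P P' R = (\<Sum>n=1..N. LINT t|lebesgue_on {\<tau> (n - 1)..\<tau> n}. w t \<bullet> R n t) + v 0 \<bullet> R 1 0"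
proof -
  have step: "(LINT t|lebesgue_on {\<tau> (n - 1)..\<tau> n}. P' n t \<bullet> R n t) + P n (\<tau> (n - 1)) \<bullet> R n (\<tau> (n - 1))
      = (LINT t|lebesgue_on {\<tau> (n - 1)..\<tau> n}. w t \<bullet> R n t) + v (\<tau> (n - 1)) \<bullet> R n (\<tau> (n - 1))"
    if n: "n \<in> {1..N}" for n
  proof -
    let ?M = "lebesgue_on {\<tau> (n - 1)..\<tau> n}"
    note sub = mesh_subinterval[OF mesh n]
    obtain c where c: "\<And>t. R n t = (\<Sum>j<q. t ^ j *\<^sub>R c j)" using R[of n] by (auto simp: vpoly_def)
    have "antideriv (\<tau> (n - 1)) (\<tau> n) v w" by (rule antideriv_subinterval[OF v]) (use sub in auto)
    then have e: "antideriv (\<tau> (n - 1)) (\<tau> n) (\<lambda>t. v t - P n t) (\<lambda>t. w t - P' n t)"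
      using P(3) by (rule antideriv_diff)
    have "(\<Sum>j<q. (\<integral>t. poly (monom (real j) (j - 1)) t *\<^sub>R (v t - P n t) \<partial>?M) \<bullet> c j) = 0"
    proof (rule sum.neutral, rule ballI)
      fix j assume j: "j \<in> {..<q}"
      show "(\<integral>t. poly (monom (real j) (j - 1)) t *\<^sub>R (v t - P n t) \<partial>?M) \<bullet> c j = 0"
      proof (cases "j = 0")
        case False
        \<comment> \<open>Since \<open>j < q\<close>, the derivative of the \<open>j\<close>-th
          power has degree at most \<open>q - 2\<close>, the range covered by the moment
          conditions.\<close>
        have "degree (monom (real j) (j - 1)) \<le> j - 1" by (rule degree_monom_le)
        then have "(\<integral>t. poly (monom (real j) (j - 1)) t *\<^sub>R (v t - P n t) \<partial>?M) = 0"
          using False j by (intro mom[OF n]) auto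
        then show ?thesis by simp
      qed simp
    qed
    then have "(\<integral>t. (w t - P' n t) \<bullet> R n t \<partial>?M) = - ((v (\<tau> (n - 1)) - P n (\<tau> (n - 1))) \<bullet> R n (\<tau> (n - 1)))"
      using integral_inner_by_parts[OF e _ c] sub end'[OF n] by simp
    moreover have "(\<integral>t. (w t - P' n t) \<bullet> R n t \<partial>?M) = (\<integral>t. w t \<bullet> R n t \<partial>?M) - (\<integral>t. P' n t \<bullet> R n t \<partial>?M)"
    proof -
      have sq: "w square_integrable_on {\<tau> (n - 1)..\<tau> n}" "P' n square_integrable_on {\<tau> (n - 1)..\<tau> n}"
        "R n square_integrable_on {\<tau> (n - 1)..\<tau> n}"
        using square_integrable_on_subset[OF w, of "{\<tau> (n - 1)..\<tau> n}"] sub P(2)[of n] R[of n]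
        by (auto intro!: continuous_on_square_integrable_on continuous_on_vpoly)
      show ?thesis
        unfolding inner_diff_left
        by (intro Bochner_Integration.integral_diff integrable_inner_square_integrable sq)
    qed
    ultimately show ?thesis by (simp add: inner_diff_left)
  qed
  have "(\<Sum>n=1..N. v (\<tau> (n - 1)) \<bullet> R n (\<tau> (n - 1))) = v 0 \<bullet> R 1 0 + (\<Sum>n=1..N-1. v (\<tau> n) \<bullet> R (Suc n) (\<tau> n))"
  proof -
    have "(\<Sum>n=1..N. v (\<tau> (n - 1)) \<bullet> R n (\<tau> (n - 1)))
        = v (\<tau> 0) \<bullet> R 1 (\<tau> 0) + (\<Sum>n=1..N-1. v (\<tau> n) \<bullet> R (Suc n) (\<tau> n))"
      using sum_1_shift[OF meshD(1)[OF mesh], of "\<lambda>n. v (\<tau> (n - 1)) \<bullet> R n (\<tau> (n - 1))"] by simp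
    then show ?thesis using meshD(2)[OF mesh] by simp
  qed
  \<comment> \<open>By the end point condition the couplings contain the values of \<open>v\<close>;
    they cancel all left end terms except the initial one.\<close>
  moreover have "(\<Sum>n=1..N-1. P n (\<tau> n) \<bullet> R (Suc n) (\<tau> n)) = (\<Sum>n=1..N-1. v (\<tau> n) \<bullet> R (Suc n) (\<tau> n))"
    using end' by (intro sum.cong) auto
  ultimately show ?thesis
    unfolding D_sum_def using step by (simp add: sum.distrib)
qed

lemma vpoly_derivative:
  fixes f :: "real \<Rightarrow> 'a::{banach, second_countable_topology}"
  assumes "f \<in> vpoly q"
  obtains f' where "f' \<in> vpoly q" "\<And>t. (f has_vector_derivative f' t) (at t)" "\<And>a b. antideriv a b f f'"
proof -
  obtain c where c: "f = (\<lambda>t. \<Sum>j<q. t ^ j *\<^sub>R c j)" using assms by (auto simp: vpoly_def fun_eq_iff)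
  define f' where "f' t = (\<Sum>j<q. (real j * t ^ (j - 1)) *\<^sub>R c j)" for t
  have d: "((\<lambda>t. t ^ j) has_real_derivative real j * t ^ (j - 1)) (at t)" for t j
    using DERIV_pow[of j t UNIV] by simp
  have "f' \<in> vpoly q"
    unfolding f'_def[abs_def]
  proof (rule vpoly_sum)
    fix j assume "j \<in> {..<q}"
    then have "degree (monom (real j) (j - 1)) < q"
      by (intro le_less_trans[OF degree_monom_le]) auto
    from vpoly_poly_scaleR[OF this, of "c j"]
    show "(\<lambda>t. (real j * t ^ (j - 1)) *\<^sub>R c j) \<in> vpoly q" by (simp add: poly_monom)
  qed simp
  moreover have "(f has_vector_derivative f' t) (at t)" for t
    unfolding c f'_def
    using d unfolding has_real_derivative_iff_has_vector_derivative
    by (intro has_vector_derivative_sum bounded_linear.has_vector_derivative[OF bounded_linear_scaleR_left])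
  moreover have "antideriv a b f f'" for a b
    unfolding c f'_def[abs_def]
  proof (rule antideriv_sum)
    show "antideriv a b (\<lambda>t. t ^ j *\<^sub>R c j) (\<lambda>t. (real j * t ^ (j - 1)) *\<^sub>R c j)" for j
      by (rule antideriv_bounded_linear[OF bounded_linear_scaleR_left antideriv_real[OF d]])
        (intro continuous_intros)
  qed simp
  ultimately show ?thesis using that by blast
qed

lemma vpoly_bounded_linear:
  assumes "bounded_linear h" "f \<in> vpoly q"
  shows "(\<lambda>t. h (f t)) \<in> vpoly q"
proof -
  interpret bounded_linear h by fact
  obtain c where "\<And>t. f t = (\<Sum>j<q. t ^ j *\<^sub>R c j)" using assms by (auto simp: vpoly_def)
  then show ?thesis by (intro vpolyI[where c="\<lambda>j. h (c j)"]) (simp add: sum scaleR)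
qed

section \<open>Uniqueness of the interpolant and the constraint\<close>

lemma blinfun_apply_B_op:
  assumes "bounded_bilinear b"
  shows "blinfun_apply (B_op b x) r = b x r"
  unfolding B_op_def
  by (simp add: bounded_linear_Blinfun_apply bounded_bilinear.bounded_linear_right[OF assms])

lemma ker_B_iff:
  assumes "bounded_bilinear b"
  shows "x \<in> ker_B b \<longleftrightarrow> (\<forall>r. b x r = 0)"
proof
  assume "x \<in> ker_B b"
  then have "B_op b x = 0" by (simp add: ker_B_def)
  then show "\<forall>r. b x r = 0" by (simp flip: blinfun_apply_B_op[OF assms])
next
  assume "\<forall>r. b x r = 0"
  then have "B_op b x = 0" by (intro blinfun_eqI) (simp add: blinfun_apply_B_op[OF assms])
  then show "x \<in> ker_B b" by (simp add: ker_B_def)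
qed

lemma subspace_ker_B:
  assumes "bounded_bilinear b"
  shows "subspace (ker_B b)"
  unfolding subspace_def
  by (simp add: ker_B_iff[OF assms] bounded_bilinear.add_left[OF assms] bounded_bilinear.scaleR_left[OF assms]
      bounded_bilinear.zero_left[OF assms])

lemma bounded_bilinear_of_bound:
  fixes a :: "'u::real_normed_vector \<Rightarrow> 'u \<Rightarrow> real"
  assumes "bilinear a" "\<And>x y. \<bar>a x y\<bar> \<le> \<Gamma> * norm x * norm y"
  shows "bounded_bilinear a"
proof
  show "\<exists>K. \<forall>x y. norm (a x y) \<le> norm x * norm y * K"
    using assms(2) by (intro exI[of _ \<Gamma>]) (simp add: mult_ac)
qed (use assms(1) in \<open>simp_all add: bilinear_ladd bilinear_radd bilinear_lmul bilinear_rmul\<close>)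

text \<open>A fixed functional turns a vector-valued polynomial into a real one, for which vanishing
  can be tested by roots or integrals.\<close>

lemma linear_functional_poly:
  assumes "linear L"
  shows "L (\<Sum>j<q. t ^ j *\<^sub>R c j) = poly (\<Sum>j<q. monom (L (c j)) j) t"
proof -
  have "L (\<Sum>j<q. t ^ j *\<^sub>R c j) = (\<Sum>j<q. t ^ j *\<^sub>R L (c j))"
    by (simp add: linear_sum[OF assms] linear_scale[OF assms])
  then show ?thesis by (simp add: poly_sum poly_monom mult.commute)
qed

lemma coeff_sum_monom:
  "coeff (\<Sum>j<q. monom (x j) j) i = (if i < q then x i else 0)"
  by (simp add: coeff_sum coeff_monom if_distrib cong: if_cong)

lemma poly_eq_0_integral_square:
  fixes p :: "real poly"
  assumes "a < b" "(LINT t|lebesgue_on {a..b}. (poly p t)\<^sup>2) = 0"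
  shows "p = 0"
proof (rule poly_eq_0_interval[OF _ assms(1)])
  fix t assume "t \<in> {a<..<b}"
  then have "(poly p t)\<^sup>2 = 0"
    using assms by (intro integral_eq_0_continuous[of a b "\<lambda>t. (poly p t)\<^sup>2"] continuous_intros) auto
  then show "poly p t = 0" by simp
qed

text \<open>A polynomial \<open>(t - b) \<eta>(t)\<close> whose moments against polynomials of degree at most \<open>q - 2\<close> vanish
  is orthogonal to \<open>\<eta>\<close>, and \<open>t - b\<close> has a sign.\<close>

lemma interpolant_unique:
  fixes \<zeta> :: "real poly"
  assumes "a < b" and deg: "\<And>i. q \<le> i \<Longrightarrow> coeff \<zeta> i = 0" and b: "poly \<zeta> b = 0"
    and mom: "\<And>\<psi>. degree \<psi> + 2 \<le> q \<Longrightarrow> (LINT t|lebesgue_on {a..b}. poly \<psi> t * poly \<zeta> t) = 0"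
  shows "\<zeta> = 0"
proof (rule ccontr)
  assume "\<zeta> \<noteq> 0"
  obtain \<eta> where \<eta>: "\<zeta> = [:- b, 1:] * \<eta>" using b by (auto simp: poly_eq_0_iff_dvd)
  with \<open>\<zeta> \<noteq> 0\<close> have "\<eta> \<noteq> 0" by auto
  then have "degree \<zeta> = Suc (degree \<eta>)" unfolding \<eta> by (subst degree_mult_eq) auto
  moreover have "degree \<zeta> < q"
    using deg[of "degree \<zeta>"] \<open>\<zeta> \<noteq> 0\<close> by (metis leading_coeff_0_iff not_le)
  \<comment> \<open>As \<open>\<zeta>\<close> has degree below \<open>q\<close>, its cofactor
    \<open>\<eta>\<close> has degree at most \<open>q - 2\<close> and is an admissible weight in the
    moment condition.\<close>
  ultimately have "(LINT t|lebesgue_on {a..b}. poly \<eta> t * poly \<zeta> t) = 0" by (intro mom) simp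
  moreover have "(\<lambda>t. poly \<eta> t * poly \<zeta> t) = (\<lambda>t. - ((b - t) * (poly \<eta> t)\<^sup>2))"
    by (simp add: \<eta> fun_eq_iff power2_eq_square algebra_simps)
  ultimately have 0: "(LINT t|lebesgue_on {a..b}. (b - t) * (poly \<eta> t)\<^sup>2) = 0" by simp
  have "\<eta> = 0"
  proof (rule poly_eq_0_interval[OF _ \<open>a < b\<close>])
    fix t assume t: "t \<in> {a<..<b}"
    then have "(b - t) * (poly \<eta> t)\<^sup>2 = 0"
      using 0 \<open>a < b\<close>
      by (intro integral_eq_0_continuous[of a b "\<lambda>t. (b - t) * (poly \<eta> t)\<^sup>2"] continuous_intros) auto
    then show "poly \<eta> t = 0" using t by simp
  qed
  with \<open>\<eta> \<noteq> 0\<close> show False by simp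
qed

section \<open>Functions with values in the dual\<close>

text \<open>Membership in \<open>dual_of\<close> bounds the set under the supremum, so that the
  supremum is meaningful; the rest is scaling to the unit ball.\<close>

lemma dual_norm_bound:
  assumes "\<phi> \<in> dual_of V" "subspace V" "v \<in> V"
  shows "\<bar>\<phi> v\<bar> \<le> dual_norm V \<phi> * norm v"
proof -
  obtain C where C: "\<And>x. x \<in> V \<Longrightarrow> \<bar>\<phi> x\<bar> \<le> C * norm x" using assms(1) unfolding dual_of_def by blast
  have scale: "\<phi> (r *\<^sub>R x) = r * \<phi> x" if "x \<in> V" for r x using assms(1) that by (auto simp: dual_of_def)
  have "bdd_above ((\<lambda>v. \<bar>\<phi> v\<bar>) ` {v \<in> V. norm v \<le> 1})"
  proof (rule bdd_aboveI2[where M="\<bar>C\<bar>"])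
    fix x assume "x \<in> {v \<in> V. norm v \<le> 1}"
    then have x: "x \<in> V" "norm x \<le> 1" by auto
    have "\<bar>\<phi> x\<bar> \<le> C * norm x" by (rule C[OF x(1)])
    also have "\<dots> \<le> \<bar>C\<bar> * 1" using x(2) by (intro mult_mono) auto
    finally show "\<bar>\<phi> x\<bar> \<le> \<bar>C\<bar>" by simp
  qed
  then have upper: "\<bar>\<phi> x\<bar> \<le> dual_norm V \<phi>" if "x \<in> V" "norm x \<le> 1" for x
    unfolding dual_norm_def using that by (intro cSUP_upper2[of _ _ x]) auto
  show ?thesis
  proof (cases "v = 0")
    case True
    then show ?thesis using C[OF assms(3)] by simp
  next
    case False
    have "\<bar>\<phi> (inverse (norm v) *\<^sub>R v)\<bar> \<le> dual_norm V \<phi>"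
      by (rule upper) (use assms(2,3) False in \<open>auto intro: subspace_scale\<close>)
    then show ?thesis using False by (simp add: scale[OF assms(3)] abs_mult field_simps)
  qed
qed

lemma dual_of_diff:
  assumes "\<phi> \<in> dual_of V" "\<psi> \<in> dual_of V"
  shows "(\<lambda>v. \<phi> v - \<psi> v) \<in> dual_of V"
proof -
  obtain C D where C: "\<And>x. x \<in> V \<Longrightarrow> \<bar>\<phi> x\<bar> \<le> C * norm x" and D: "\<And>x. x \<in> V \<Longrightarrow> \<bar>\<psi> x\<bar> \<le> D * norm x"
    using assms unfolding dual_of_def by blast
  have "\<bar>\<phi> x - \<psi> x\<bar> \<le> (C + D) * norm x" if "x \<in> V" for x
    using C[OF that] D[OF that] by (simp add: distrib_right)
  then have "\<exists>C. \<forall>x\<in>V. \<bar>\<phi> x - \<psi> x\<bar> \<le> C * norm x" by blast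
  then show ?thesis using assms by (simp add: dual_of_def right_diff_distrib)
qed

text \<open>Evaluation at a fixed \<open>v\<close> turns the approximating simple functions into
  real simple functions, which converge because the dual norm controls the value at
  \<open>v\<close>.\<close>

lemma L2_dual_integrable:
  assumes w: "w \<in> L2_dual S V" and S: "S \<in> lmeasurable" and V: "subspace V" "v \<in> V"
  shows "integrable (lebesgue_on S) (\<lambda>t. w t v)"
proof -
  interpret finite_measure "lebesgue_on S" by (rule finite_measure_lebesgue_on[OF S])
  obtain s where s: "\<And>i. simple_function (lebesgue_on S) (s i)" "\<And>i t. t \<in> S \<Longrightarrow> s i t \<in> dual_of V"
    and lim: "AE t in lebesgue_on S. (\<lambda>i::nat. dual_norm V (\<lambda>v. s i t v - w t v)) \<longlonglongrightarrow> 0"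
    and dual: "AE t in lebesgue_on S. w t \<in> dual_of V"
    and int: "integrable (lebesgue_on S) (\<lambda>t. (dual_norm V (w t))\<^sup>2)"
    using w unfolding L2_dual_def by blast
  have m: "(\<lambda>t. w t v) \<in> borel_measurable (lebesgue_on S)"
  proof (rule borel_measurable_lebesgue_on_AE_LIMSEQ)
    show "(\<lambda>t. s i t v) \<in> borel_measurable (lebesgue_on S)" for i
      using simple_function_compose1[OF s(1), of "\<lambda>\<phi>. \<phi> v"] by (rule borel_measurable_simple_function)
    have "AE t in lebesgue_on S. t \<in> S" by (rule AE_I2) simp
    then show "AE t in lebesgue_on S. (\<lambda>i. s i t v) \<longlonglongrightarrow> w t v"
      using lim dual
    proof eventually_elim
      case (elim t)
      have "(\<lambda>i. s i t v - w t v) \<longlonglongrightarrow> 0"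
      proof (rule Lim_null_comparison)
        show "\<forall>\<^sub>F i in sequentially. norm (s i t v - w t v) \<le> dual_norm V (\<lambda>v. s i t v - w t v) * norm v"
          using dual_norm_bound[OF dual_of_diff[OF s(2)[OF elim(1)] elim(3)] V] by (simp add: always_eventually)
        show "(\<lambda>i. dual_norm V (\<lambda>v. s i t v - w t v) * norm v) \<longlonglongrightarrow> 0"
          using tendsto_mult_left_zero[OF elim(2)] .
      qed
      then show ?case by (simp add: LIM_zero_iff)
    qed
  qed (use S in auto)
  show ?thesis
  proof (rule Bochner_Integration.integrable_bound[OF _ m])
    \<comment> \<open>Integrability is given for the square of the dual norm only;
      \<open>x \<le> 1 + x^2\<close> on a set of finite measure supplies a majorant.\<close>
    show "integrable (lebesgue_on S) (\<lambda>t. (1 + (dual_norm V (w t))\<^sup>2) * norm v)" using int by simp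
    show "AE t in lebesgue_on S. norm (w t v) \<le> norm ((1 + (dual_norm V (w t))\<^sup>2) * norm v)"
      using dual
    proof eventually_elim
      case (elim t)
      have "dual_norm V (w t) \<le> 1 + (dual_norm V (w t))\<^sup>2"
        using sum_squares_bound[of "dual_norm V (w t)" 1] zero_le_power2[of "dual_norm V (w t)"]
        unfolding power_one by linarith
      then have "dual_norm V (w t) * norm v \<le> (1 + (dual_norm V (w t))\<^sup>2) * norm v"
        by (intro mult_right_mono) auto
      with dual_norm_bound[OF elim V] show ?case by simp
    qed
  qed
qed

text \<open>For a fixed \<open>x\<close> the weak derivative in \<open>V'\<close> becomes a
  real-valued one, and uniqueness of densities applies. The exceptional null set depends on
  \<open>x\<close>.\<close>

lemma weak_deriv_dual_AE:
  fixes E :: "'u::{real_normed_vector} \<Rightarrow> 'h::{real_inner, banach, second_countable_topology}"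
    and y v w :: "real \<Rightarrow> 'h"
  assumes "T > 0" and u': "u' \<in> L2_dual {0<..<T} V" and V: "subspace V" "x \<in> V"
    and weak: "is_weak_deriv_dual {0<..<T} E V y u'"
    and y: "y \<in> borel_measurable (lebesgue_on {0..T})" "AE t in lebesgue_on {0..T}. y t = v t"
    and v: "antideriv 0 T v w"
  shows "AE t in lebesgue_on {0..T}. u' t x = w t \<bullet> E x"
proof -
  have vx: "antideriv 0 T (\<lambda>t. v t \<bullet> E x) (\<lambda>t. w t \<bullet> E x)"
    by (rule antideriv_bounded_linear[OF bounded_linear_inner_left v])
  have yx: "(\<lambda>t. y t \<bullet> E x) \<in> borel_measurable (lebesgue_on {0..T})"
    using y(1) by simp
  have ae: "AE t in lebesgue_on {0..T}. y t \<bullet> E x = v t \<bullet> E x"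
    using y(2) by eventually_elim simp
  have 1: "integrable (lebesgue_on {0..T}) (\<lambda>t. y t \<bullet> E x)"
    by (rule iffD2[OF integrable_cong_AE[OF yx _ ae]])
      (use continuous_on_integrable_lebesgue_on[OF antideriv_continuous_on[OF vx]] in auto)
  have 2: "integrable (lebesgue_on {0..T}) (\<lambda>t. u' t x)"
    using L2_dual_integrable[OF u' _ V] by (simp add: integrable_lebesgue_on_finite_diff[OF Ioo_finite_diff])
  have "(LINT t|lebesgue_on {0..T}. deriv \<phi> t *\<^sub>R (y t \<bullet> E x)) = - (LINT t|lebesgue_on {0..T}. \<phi> t *\<^sub>R u' t x)"
    if "\<phi> \<in> test_functions {0<..<T}" for \<phi>
    using weak that V(2) unfolding is_weak_deriv_dual_def
    by (simp add: integral_lebesgue_on_finite_diff[OF Ioo_finite_diff])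
  from weak_derivative_antideriv[OF \<open>T > 0\<close> 1 2 this] obtain z
    where z: "antideriv 0 T z (\<lambda>t. u' t x)" "AE t in lebesgue_on {0..T}. y t \<bullet> E x = z t" by blast
  have "AE t in lebesgue_on {0..T}. z t = v t \<bullet> E x"
    using z(2) ae by eventually_elim simp
  then show ?thesis by (rule antideriv_unique_AE[OF z(1) vx \<open>T > 0\<close>])
qed

text \<open>Both continuous representatives, evaluated at \<open>x\<close>, agree almost everywhere
  and hence in the limit at 0. The initial value is identified only as a functional on
  \<open>V\<close>.\<close>

lemma dual_value_at_0:
  fixes E :: "'u::{real_normed_vector} \<Rightarrow> 'h::real_inner"
  assumes "T > 0" and val: "dual_value_at {0<..<T} E V y 0 y0" and V: "subspace V" "x \<in> V"
    and y: "AE t in lebesgue_on {0..T}. y t = v t" and v: "continuous_on {0..T} v"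
  shows "y0 \<bullet> E x = v 0 \<bullet> E x"
proof -
  have cl: "closure {0<..<T} = {0..T}" using \<open>T > 0\<close> by simp
  obtain z where z: "\<And>t. t \<in> {0..T} \<Longrightarrow> z t \<in> dual_of V"
    "\<And>t. t \<in> {0..T} \<Longrightarrow> ((\<lambda>s. dual_norm V (\<lambda>v. z s v - z t v)) \<longlongrightarrow> 0) (at t within {0..T})"
    "AE t in lebesgue_on {0<..<T}. \<forall>v\<in>V. z t v = y t \<bullet> E v" "\<And>v. v \<in> V \<Longrightarrow> z 0 v = y0 \<bullet> E v"
    using val unfolding dual_value_at_def cl by blast
  have 0: "0 \<in> {0..T}" using \<open>T > 0\<close> by simp
  have "z 0 x = v 0 \<bullet> E x"
  proof (rule tendsto_AE_unique[where x=0 and S="{0..T}"])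
    have "((\<lambda>s. z s x - z 0 x) \<longlongrightarrow> 0) (at 0 within {0..T})"
    proof (rule Lim_null_comparison)
      have "\<forall>\<^sub>F s in at 0 within {0..T}. s \<in> {0..T}" by (simp add: eventually_at_filter)
      then show "\<forall>\<^sub>F s in at 0 within {0..T}. norm (z s x - z 0 x) \<le> dual_norm V (\<lambda>v. z s v - z 0 v) * norm x"
        by eventually_elim (use dual_norm_bound[OF dual_of_diff[OF z(1) z(1)[OF 0]] V] in auto)
      show "((\<lambda>s. dual_norm V (\<lambda>v. z s v - z 0 v) * norm x) \<longlongrightarrow> 0) (at 0 within {0..T})"
        by (rule tendsto_mult_left_zero[OF z(2)[OF 0]])
    qed
    then show "((\<lambda>s. z s x) \<longlongrightarrow> z 0 x) (at 0 within {0..T})" by (simp add: LIM_zero_iff)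
    show "((\<lambda>s. v s \<bullet> E x) \<longlongrightarrow> v 0 \<bullet> E x) (at 0 within {0..T})"
      using v 0 by (intro tendsto_intros) (auto simp: continuous_on_def)
    have "AE t in lebesgue_on {0..T}. \<forall>v\<in>V. z t v = y t \<bullet> E v"
      by (rule AE_lebesgue_on_insert[OF z(3) Ioo_finite_diff(1,2,4,5)])
    then show "AE t in lebesgue_on {0..T}. z t x = v t \<bullet> E x"
      using y by eventually_elim (use V in auto)
    show "\<exists>c d. c < d \<and> {c..d} \<subseteq> {0..T} \<inter> ball 0 e" if "e > 0" for e :: real
      using that \<open>T > 0\<close> by (intro exI[of _ 0] exI[of _ "min T (e / 2)"]) (auto simp: dist_real_def)
  qed simp
  then show ?thesis using z(4)[OF V(2)] by simp
qed

text \<open>The description in \<open>trace_at\<close> is unique because continuous functions that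
  agree almost everywhere on a nondegenerate interval coincide.\<close>

lemma trace_at_eq:
  assumes "a < b" "continuous_on {a..b} v" "AE t in lebesgue_on {a..b}. u t = v t" "x \<in> {a..b}"
  shows "trace_at {a<..<b} u x = v x"
  unfolding trace_at_def
proof (rule the_equality)
  have cl: "closure {a<..<b} = {a..b}" using \<open>a < b\<close> by simp
  have "AE t in lebesgue_on {a<..<b}. u t = v t"
    by (rule AE_lebesgue_on_subset[OF assms(3)]) auto
  then have "AE t in lebesgue_on {a<..<b}. v t = u t" by eventually_elim simp
  then show "\<exists>w. continuous_on (closure {a<..<b}) w \<and> (AE t in lebesgue_on {a<..<b}. w t = u t) \<and> w x = v x"
    using assms(2) unfolding cl by blast
  fix y assume "\<exists>w. continuous_on (closure {a<..<b}) w \<and> (AE t in lebesgue_on {a<..<b}. w t = u t) \<and> w x = y"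
  then obtain w where w: "continuous_on {a..b} w" "AE t in lebesgue_on {a<..<b}. w t = u t" "w x = y"
    unfolding cl by blast
  have "AE t in lebesgue_on {a..b}. w t = u t"
    by (rule AE_lebesgue_on_insert[OF w(2), where N="{a, b}"]) auto
  then have "AE t in lebesgue_on {a..b}. w t = v t" using assms(3) by eventually_elim simp
  then show "y = v x" using continuous_on_AE_eq[OF w(1) assms(2,1) _ assms(4)] w(3) by simp
qed

section \<open>Mesh intervals and piecewise continuous functions\<close>

lemma Ivl_disjoint:
  assumes "is_mesh T N \<tau>" "n \<in> {1..N}" "k \<in> {1..N}" "t \<in> Ivl \<tau> n" "t \<in> Ivl \<tau> k"
  shows "n = k"
  using piecewise_Ivl[OF assms(1,2,4), of "\<lambda>n _. n"] piecewise_Ivl[OF assms(1,3,5), of "\<lambda>n _. n"] by simp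

lemma Ivl_cover:
  assumes "is_mesh T N \<tau>" "t \<in> {0<..T}"
  obtains n where "n \<in> {1..N}" "t \<in> Ivl \<tau> n"
proof -
  have ex: "\<exists>n. t \<le> \<tau> n" using assms meshD(3)[OF assms(1)] by auto
  define n where "n = (LEAST n. t \<le> \<tau> n)"
  have n: "t \<le> \<tau> n" unfolding n_def using ex by (rule LeastI_ex)
  have "n \<le> N" unfolding n_def using assms meshD(3)[OF assms(1)] by (intro Least_le) auto
  moreover have "n \<noteq> 0" using n assms(2) meshD(2)[OF assms(1)] by (intro notI) simp
  moreover have "\<tau> (n - 1) < t"
    using not_less_Least[of "n - 1" "\<lambda>n. t \<le> \<tau> n"] \<open>n \<noteq> 0\<close> unfolding n_def[symmetric] by simp
  ultimately show ?thesis using n by (intro that[of n]) (auto simp: Ivl_def)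
qed

lemma square_integrable_on_sum:
  fixes f :: "'i \<Rightarrow> real \<Rightarrow> 'a::{banach, second_countable_topology}"
  assumes "finite I" "\<And>i. i \<in> I \<Longrightarrow> f i square_integrable_on S"
  shows "(\<lambda>t. \<Sum>i\<in>I. f i t) square_integrable_on S"
  using assms
proof (induction I rule: finite_induct)
  case empty
  then show ?case by (simp add: square_integrable_on_def)
next
  case (insert i I)
  then show ?case using square_integrable_on_add[of "f i" S "\<lambda>t. \<Sum>i\<in>I. f i t"] by simp
qed

text \<open>Nothing is known about \<open>Y\<close> at 0, so \<open>Y\<close> is compared almost
  everywhere with a finite sum of cut-off continuous functions.\<close>

lemma piecewise_square_integrable_on:
  fixes Y :: "real \<Rightarrow> 'a::{banach, second_countable_topology}"
  assumes mesh: "is_mesh T N \<tau>"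
    and Y: "\<And>n t. n \<in> {1..N} \<Longrightarrow> t \<in> Ivl \<tau> n \<Longrightarrow> Y t = P n t"
    and P: "\<And>n. continuous_on {0..T} (P n)"
  shows "Y square_integrable_on {0..T}"
proof -
  define Z where "Z t = (\<Sum>n\<in>{1..N}. indicat_real (Ivl \<tau> n) t *\<^sub>R P n t)" for t
  have "(\<lambda>t. indicat_real (Ivl \<tau> n) t *\<^sub>R P n t) square_integrable_on {0..T}" for n
  proof (rule square_integrable_on_bound[OF continuous_on_square_integrable_on[OF P[of n]], where C=1])
    have [measurable]: "P n \<in> borel_measurable (lebesgue_on {0..T})"
      by (rule continuous_on_borel_measurable_lebesgue_on[OF P])
    have "indicat_real (Ivl \<tau> n) \<in> borel_measurable lebesgue"
      unfolding Ivl_def by (rule borel_measurable_indicator) simp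
    then have [measurable]: "indicat_real (Ivl \<tau> n) \<in> borel_measurable (lebesgue_on {0..T})"
      by (rule measurable_restrict_space1)
    show "(\<lambda>t. indicat_real (Ivl \<tau> n) t *\<^sub>R P n t) \<in> borel_measurable (lebesgue_on {0..T})" by measurable
  qed (auto simp: indicator_def)
  then have Z: "Z square_integrable_on {0..T}"
    unfolding Z_def[abs_def] by (intro square_integrable_on_sum) auto
  have eq: "Y t = Z t" if t: "t \<in> {0<..T}" for t
  proof -
    obtain n where n: "n \<in> {1..N}" "t \<in> Ivl \<tau> n" using Ivl_cover[OF mesh t] by blast
    have "Z t = (\<Sum>k\<in>{1..N}. if k = n then P n t else 0)"
      unfolding Z_def
    proof (rule sum.cong)
      fix k assume "k \<in> {1..N}"
      then have "t \<in> Ivl \<tau> k \<longleftrightarrow> k = n" using n Ivl_disjoint[OF mesh n(1) _ n(2), of k] by blast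
      then show "indicat_real (Ivl \<tau> k) t *\<^sub>R P k t = (if k = n then P n t else 0)"
        by (simp add: indicator_def)
    qed simp
    then show ?thesis using n Y by simp
  qed
  have "AE t in lebesgue_on {0<..T}. Y t = Z t" by (rule AE_I2) (use eq in simp)
  then have ae: "AE t in lebesgue_on {0..T}. Y t = Z t"
    by (rule AE_lebesgue_on_insert[where N="{0}"]) auto
  show ?thesis
  proof (rule square_integrable_on_cong_AE[OF Z _ ae])
    show "Y \<in> borel_measurable (lebesgue_on {0..T})"
      by (rule borel_measurable_lebesgue_on_cong_AE[where f=Z])
        (use Z ae in \<open>auto simp: square_integrable_on_def elim: eventually_mono\<close>)
  qed
qed

lemma L2_norm_mesh_sum:
  assumes mesh: "is_mesh T N \<tau>" and f: "f square_integrable_on {0..T}"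
  shows "(L2_norm {0..T} f)\<^sup>2 = (\<Sum>n=1..N. (L2_norm {\<tau> (n - 1)..\<tau> n} f)\<^sup>2)"
  unfolding L2_norm_power2 using f by (intro mesh_integral_sum[OF mesh]) (simp add: square_integrable_on_def)

lemma integral_Ivl_cong:
  fixes f g :: "real \<Rightarrow> 'a::{banach, second_countable_topology}"
  assumes "\<And>t. t \<in> Ivl \<tau> n \<Longrightarrow> f t = g t"
  shows "integral\<^sup>L (lebesgue_on {\<tau> (n - 1)..\<tau> n}) f = integral\<^sup>L (lebesgue_on {\<tau> (n - 1)..\<tau> n}) g"
  unfolding integral_lebesgue_on_finite_diff[OF Ivl_finite_diff, symmetric]
  by (rule Bochner_Integration.integral_cong) (use assms in auto)

text \<open>For fixed \<open>r\<close> both sides are real polynomials in \<open>t\<close> on the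
  interval, with the same value at the right end and the same moments up to degree
  \<open>q - 2\<close>; \<open>interpolant_unique\<close> applies to their difference.\<close>

lemma is_Iq_constraint:
  fixes b :: "'u::{real_inner, banach, second_countable_topology} \<Rightarrow> 'q::{real_inner, banach} \<Rightarrow> real"
    and g G :: "real \<Rightarrow> ('q \<Rightarrow>\<^sub>L real)"
  assumes b: "bounded_bilinear b" and mesh: "is_mesh T N \<tau>" and G: "is_Iq \<tau> N q g G"
    and g: "AE t in lebesgue_on {0..T}. B_op b (v t) = g t" and v: "continuous_on {0..T} v"
    and n: "n \<in> {1..N}"
    and P: "P \<in> vpoly q" "P (\<tau> n) = v (\<tau> n)"
    and mom: "\<And>\<psi>. degree \<psi> + 2 \<le> q \<Longrightarrow>
      (LINT t|lebesgue_on {\<tau> (n - 1)..\<tau> n}. poly \<psi> t *\<^sub>R (v t - P t)) = 0"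
    and t: "t \<in> Ivl \<tau> n"
  shows "blinfun_apply (G t) r = b (P t) r"
proof -
  interpret b: bounded_bilinear b by fact
  note sub = mesh_subinterval[OF mesh n]
  let ?I = "{\<tau> (n - 1)..\<tau> n}"
  have I: "?I \<subseteq> {0..T}" using sub by auto
  have blr: "bounded_linear (\<lambda>x. b x r)" by (rule b.bounded_linear_left)
  have contv: "continuous_on ?I v" using v I by (rule continuous_on_subset)
  obtain c where c: "\<And>t. t \<in> Ivl \<tau> n \<Longrightarrow> G t = (\<Sum>j<q. t ^ j *\<^sub>R c j)"
    using G n unfolding is_Iq_def Pb_def by blast
  obtain d where d: "\<And>t. P t = (\<Sum>j<q. t ^ j *\<^sub>R d j)" using P(1) by (auto simp: vpoly_def)
  define \<zeta> where "\<zeta> = (\<Sum>j<q. monom (b (d j) r) j) - (\<Sum>j<q. monom (blinfun_apply (c j) r) j)"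
  have \<zeta>: "poly \<zeta> t = b (P t) r - blinfun_apply (G t) r" if "t \<in> Ivl \<tau> n" for t
    using linear_functional_poly[OF bounded_linear.linear[OF blr], of t d q]
      linear_functional_poly[OF bounded_linear.linear[OF blinfun.bounded_linear_left[of r]], of t c q]
    by (simp add: \<zeta>_def c[OF that] d)
  obtain \<phi> where \<phi>: "AE t in lebesgue_on (Ivl \<tau> n). \<phi> t = g t"
    "continuous (at (\<tau> n) within Ivl \<tau> n) \<phi>" "G (\<tau> n) = \<phi> (\<tau> n)"
    and Gmom: "\<And>\<psi> :: real poly. degree \<psi> + 2 \<le> q \<Longrightarrow>
      ((\<lambda>t. poly \<psi> t *\<^sub>R (G t - g t)) has_integral 0) (Ivl \<tau> n)"
    using G n unfolding is_Iq_def by blast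
  have g_I: "AE t in lebesgue_on ?I. B_op b (v t) = g t"
    by (rule AE_lebesgue_on_subset[OF g I]) auto
  have end_n: "\<tau> n \<in> Ivl \<tau> n" using sub by (simp add: Ivl_def)
  \<comment> \<open>The end value of \<open>G\<close> is that of some representative of
    \<open>g\<close> continuous at the mesh point. It is compared with \<open>b (v t) r\<close> by
    taking limits from the left.\<close>
  have "blinfun_apply (\<phi> (\<tau> n)) r = b (v (\<tau> n)) r"
  proof (rule tendsto_AE_unique[where x="\<tau> n" and S="Ivl \<tau> n"])
    show "((\<lambda>t. blinfun_apply (\<phi> t) r) \<longlongrightarrow> blinfun_apply (\<phi> (\<tau> n)) r) (at (\<tau> n) within Ivl \<tau> n)"
      using \<phi>(2) unfolding continuous_within by (intro blinfun.tendsto tendsto_const)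
    have "(v \<longlongrightarrow> v (\<tau> n)) (at (\<tau> n) within ?I)"
      using contv sub by (auto simp: continuous_on_def)
    then have "(v \<longlongrightarrow> v (\<tau> n)) (at (\<tau> n) within Ivl \<tau> n)"
      by (rule tendsto_within_subset) (auto simp: Ivl_def)
    then show "((\<lambda>t. b (v t) r) \<longlongrightarrow> b (v (\<tau> n)) r) (at (\<tau> n) within Ivl \<tau> n)"
      by (intro b.tendsto tendsto_const)
    have "AE t in lebesgue_on (Ivl \<tau> n). B_op b (v t) = g t"
      by (rule AE_lebesgue_on_subset[OF g_I]) (auto simp: Ivl_def)
    with \<phi>(1) show "AE t in lebesgue_on (Ivl \<tau> n). blinfun_apply (\<phi> t) r = b (v t) r"
      by eventually_elim (metis blinfun_apply_B_op[OF b])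
    show "\<exists>c d. c < d \<and> {c..d} \<subseteq> Ivl \<tau> n \<inter> ball (\<tau> n) e" if "e > 0" for e
      using that sub
      by (intro exI[of _ "\<tau> n - min (e / 2) (step \<tau> n / 2)"] exI[of _ "\<tau> n"])
        (auto simp: dist_real_def Ivl_def step_def min_def field_simps split: if_splits)
  qed (simp add: Ivl_def)
  then have end0: "poly \<zeta> (\<tau> n) = 0" using \<zeta>[OF end_n] \<phi>(3) P(2) by simp
  have "\<zeta> = 0"
  proof (rule interpolant_unique[OF sub(2) _ end0])
    show "coeff \<zeta> i = 0" if "q \<le> i" for i using that by (simp add: \<zeta>_def coeff_sum_monom)
    fix \<psi> :: "real poly" assume deg: "degree \<psi> + 2 \<le> q"
    \<comment> \<open>The left end point joins the exceptional set, since \<open>\<zeta>\<close> is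
      tied to \<open>G\<close> only on the half-open interval.\<close>
    have "negligible ({t \<in> ?I. B_op b (v t) \<noteq> g t} \<union> {\<tau> (n - 1)})"
    proof -
      have "AE t in lebesgue. t \<in> ?I \<longrightarrow> B_op b (v t) = g t" using g_I by (simp add: AE_restrict_space_iff)
      then have "{t \<in> space lebesgue. \<not> (t \<in> ?I \<longrightarrow> B_op b (v t) = g t)} \<in> null_sets lebesgue"
        unfolding completion.AE_iff_null_sets .
      moreover have "{t \<in> space lebesgue. \<not> (t \<in> ?I \<longrightarrow> B_op b (v t) = g t)} = {t \<in> ?I. B_op b (v t) \<noteq> g t}"
        by auto
      ultimately have "negligible {t \<in> ?I. B_op b (v t) \<noteq> g t}" by (simp add: negligible_iff_null_sets)
      then show ?thesis by (intro negligible_Un) simp_all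
    qed
    note negl = this
    \<comment> \<open>Evaluation at \<open>r\<close> is bounded and linear, so it passes through the
      gauge integral and turns the moments in \<open>Q'\<close> into real ones.\<close>
    have "((\<lambda>t. blinfun_apply (poly \<psi> t *\<^sub>R (G t - g t)) r) has_integral blinfun_apply 0 r) (Ivl \<tau> n)"
      using has_integral_linear[OF Gmom[OF deg] blinfun.bounded_linear_left[of r]] by (simp add: o_def)
    then have "((\<lambda>t. poly \<psi> t * (blinfun_apply (G t) r - blinfun_apply (g t) r)) has_integral 0) (Ivl \<tau> n)"
      by (simp add: blinfun.scaleR_left blinfun.diff_left)
    then have H1: "((\<lambda>t. poly \<psi> t * (blinfun_apply (G t) r - blinfun_apply (g t) r)) has_integral 0) ?I"
    proof (rule iffD1[OF has_integral_spike_set_eq, rotated 2])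
      let ?f = "\<lambda>t. poly \<psi> t * (blinfun_apply (G t) r - blinfun_apply (g t) r)"
      show "negligible {t \<in> Ivl \<tau> n - ?I. ?f t \<noteq> 0}" "negligible {t \<in> ?I - Ivl \<tau> n. ?f t \<noteq> 0}"
        by (rule negligible_subset[OF negligible_sing[of "\<tau> (n - 1)"]]; force simp: Ivl_def)+
    qed
    have vi: "integrable (lebesgue_on ?I) (\<lambda>t. poly \<psi> t *\<^sub>R (v t - P t))"
      by (intro continuous_on_integrable_lebesgue_on continuous_intros contv continuous_on_vpoly[OF P(1)])
    have "(LINT t|lebesgue_on ?I. b (poly \<psi> t *\<^sub>R (v t - P t)) r) = b 0 r"
      using integral_bounded_linear[OF blr vi] mom[OF deg] by simp
    then have "((\<lambda>t. b (poly \<psi> t *\<^sub>R (v t - P t)) r) has_integral 0) ?I"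
      using has_integral_integral_lebesgue_on[OF integrable_bounded_linear[OF blr vi]] by (simp add: b.zero_left)
    then have "((\<lambda>t. poly \<psi> t * (b (v t) r - b (P t) r)) has_integral 0) ?I"
      by (simp add: b.scaleR_left b.diff_left)
    from has_integral_add[OF H1 this]
    have "((\<lambda>t. poly \<psi> t * (blinfun_apply (G t) r - blinfun_apply (g t) r)
        + poly \<psi> t * (b (v t) r - b (P t) r)) has_integral 0) ?I" by simp
    then have "((\<lambda>t. - (poly \<psi> t * poly \<zeta> t)) has_integral 0) ?I"
    proof (rule has_integral_spike[OF negl, rotated])
      fix t assume t: "t \<in> ?I - ({t \<in> ?I. B_op b (v t) \<noteq> g t} \<union> {\<tau> (n - 1)})"
      then have "t \<in> Ivl \<tau> n" "B_op b (v t) = g t" by (auto simp: Ivl_def)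
      then have "blinfun_apply (g t) r = b (v t) r" by (metis blinfun_apply_B_op[OF b])
      then show "- (poly \<psi> t * poly \<zeta> t) = poly \<psi> t * (blinfun_apply (G t) r - blinfun_apply (g t) r)
        + poly \<psi> t * (b (v t) r - b (P t) r)"
        by (simp add: \<zeta>[OF \<open>t \<in> Ivl \<tau> n\<close>] algebra_simps)
    qed
    from has_integral_neg[OF this] have "((\<lambda>t. poly \<psi> t * poly \<zeta> t) has_integral 0) ?I" by simp
    moreover have "((\<lambda>t. poly \<psi> t * poly \<zeta> t) has_integral (LINT t|lebesgue_on ?I. poly \<psi> t * poly \<zeta> t)) ?I"
      by (rule has_integral_integral_lebesgue_on)
        (auto intro!: continuous_on_integrable_lebesgue_on continuous_intros)
    ultimately show "(LINT t|lebesgue_on ?I. poly \<psi> t * poly \<zeta> t) = 0"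
      by (rule has_integral_unique[symmetric])
  qed
  then show ?thesis using \<zeta>[OF t] by simp
qed

lemma integral_Ivl_restrict:
  fixes h :: "real \<Rightarrow> real"
  assumes "is_mesh T N \<tau>" "n \<in> {1..N}"
  shows "(LINT t|lebesgue_on {0<..<T}. (if t \<in> Ivl \<tau> n then h t else 0))
    = integral\<^sup>L (lebesgue_on {\<tau> (n - 1)..\<tau> n}) h"
proof -
  have "(LINT t|lebesgue_on {0<..<T}. (if t \<in> Ivl \<tau> n then h t else 0))
      = integral\<^sup>L (lebesgue_on (Ivl \<tau> n \<inter> {0<..<T})) h"
    by (rule Lebesgue_Measure.integral_restrict_Int) (auto simp: Ivl_def)
  also have "\<dots> = integral\<^sup>L (lebesgue_on {\<tau> (n - 1)..\<tau> n}) h"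
    using mesh_subinterval[OF assms]
    by (intro integral_lebesgue_on_finite_diff[where N="{\<tau> (n - 1), \<tau> n}"]) (auto simp: Ivl_def)
  finally show ?thesis .
qed

text \<open>Testing with the defect itself: for fixed \<open>r\<close> the real polynomial
  \<open>b (W t - P t) r\<close> is used as the factor of \<open>r\<close> in the test function,
  which makes the integral of its square vanish.\<close>

lemma discrete_constraint:
  fixes b :: "'u::{real_inner, banach, second_countable_topology} \<Rightarrow> 'q::{real_inner, banach} \<Rightarrow> real"
    and G :: "real \<Rightarrow> ('q \<Rightarrow>\<^sub>L real)"
  assumes b: "bounded_bilinear b" and mesh: "is_mesh T N \<tau>" and n: "n \<in> {1..N}"
    and test: "\<And>R. R \<in> Pb \<tau> N q UNIV \<Longrightarrow> (LINT t|lebesgue_on {0<..<T}. b (U t) (R t))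
      = (LINT t|lebesgue_on {0<..<T}. blinfun_apply (G t) (R t))"
    and U: "\<And>t. t \<in> Ivl \<tau> n \<Longrightarrow> U t = W t" and P: "P \<in> vpoly q"
    and x: "\<And>t. W t - P t = (\<Sum>j<q. t ^ j *\<^sub>R d j)"
    and G: "\<And>t r. t \<in> Ivl \<tau> n \<Longrightarrow> blinfun_apply (G t) r = b (P t) r" and "j < q"
  shows "d j \<in> ker_B b"
proof -
  interpret b: bounded_bilinear b by fact
  note sub = mesh_subinterval[OF mesh n]
  let ?M = "lebesgue_on {\<tau> (n - 1)..\<tau> n}"
  have "b (d j) r = 0" for r
  proof -
    have lin: "linear (\<lambda>x. b x r)" by (rule bounded_linear.linear[OF b.bounded_linear_left])
    define \<zeta> where "\<zeta> = (\<Sum>j<q. monom (b (d j) r) j)"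
    have \<zeta>: "poly \<zeta> t = b (W t) r - b (P t) r" for t
      using linear_functional_poly[OF lin, of t d q] by (simp add: \<zeta>_def b.diff_left flip: x)
    have contP: "continuous_on S (\<lambda>t. b (P t) r)" for S
      by (intro b.continuous_on continuous_on_const continuous_on_vpoly[OF P])
    \<comment> \<open>Cutting off outside one mesh interval keeps \<open>R\<close> a piecewise
      polynomial and localises the constraint to that interval.\<close>
    define R where "R t = (if t \<in> Ivl \<tau> n then poly \<zeta> t *\<^sub>R r else 0)" for t
    have "R \<in> Pb \<tau> N q UNIV"
      unfolding Pb_def
    proof safe
      fix k assume k: "k \<in> {1..N}"
      show "\<exists>c. (\<forall>j<q. c j \<in> UNIV) \<and> (\<forall>t\<in>Ivl \<tau> k. R t = (\<Sum>j<q. t ^ j *\<^sub>R c j))"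
      proof (cases "k = n")
        case True
        have "R t = (\<Sum>j<q. t ^ j *\<^sub>R (b (d j) r *\<^sub>R r))" if "t \<in> Ivl \<tau> k" for t
          using that True by (simp add: R_def \<zeta>_def poly_sum poly_monom scaleR_sum_left mult.commute)
        then show ?thesis by (intro exI[of _ "\<lambda>j. b (d j) r *\<^sub>R r"]) simp
      next
        case False
        then have "t \<notin> Ivl \<tau> n" if "t \<in> Ivl \<tau> k" for t
          using Ivl_disjoint[OF mesh k n that] by blast
        then have "R t = (\<Sum>j<q. t ^ j *\<^sub>R 0)" if "t \<in> Ivl \<tau> k" for t
          using that by (simp add: R_def)
        then show ?thesis by (intro exI[of _ "\<lambda>_. 0"]) simp
      qed
    qed
    note test = test[OF this]
    have "(\<lambda>t. b (U t) (R t)) = (\<lambda>t. if t \<in> Ivl \<tau> n then poly \<zeta> t * b (W t) r else 0)"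
      by (auto simp: R_def U b.scaleR_right b.zero_right fun_eq_iff)
    moreover have "(\<lambda>t. blinfun_apply (G t) (R t)) = (\<lambda>t. if t \<in> Ivl \<tau> n then poly \<zeta> t * b (P t) r else 0)"
      by (auto simp: R_def G blinfun.scaleR_right fun_eq_iff)
    ultimately have eq: "(LINT t|?M. poly \<zeta> t * b (W t) r) = (LINT t|?M. poly \<zeta> t * b (P t) r)"
      using test by (simp add: integral_Ivl_restrict[OF mesh n])
    have i: "integrable ?M (\<lambda>t. poly \<zeta> t * b (P t) r)" "integrable ?M (\<lambda>t. (poly \<zeta> t)\<^sup>2)"
      by (intro continuous_on_integrable_lebesgue_on continuous_intros contP)+
    have "(\<lambda>t. poly \<zeta> t * b (W t) r) = (\<lambda>t. poly \<zeta> t * b (P t) r + (poly \<zeta> t)\<^sup>2)"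
      by (simp add: \<zeta> fun_eq_iff power2_eq_square algebra_simps)
    with eq i have "(LINT t|?M. (poly \<zeta> t)\<^sup>2) = 0" by simp
    then have "\<zeta> = 0" by (rule poly_eq_0_integral_square[OF sub(2)])
    then have "coeff \<zeta> j = 0" by simp
    then show ?thesis using \<open>j < q\<close> by (simp add: \<zeta>_def coeff_sum_monom)
  qed
  then show ?thesis by (simp add: ker_B_iff[OF b])
qed

text \<open>Elements of \<open>dual_of\<close> are linear on \<open>V\<close> only, so every partial
  sum has to be kept inside \<open>V\<close>.\<close>

lemma dual_of_sum:
  assumes "\<phi> \<in> dual_of V" "subspace V" "\<And>j. j < q \<Longrightarrow> d j \<in> V"
  shows "\<phi> (\<Sum>j<q. t ^ j *\<^sub>R d j) = (\<Sum>j<q. t ^ j * \<phi> (d j))"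
  using assms(3)
proof (induction q)
  case 0
  have "\<phi> (0 *\<^sub>R 0) = 0 * \<phi> 0" using assms(1) subspace_0[OF assms(2)] unfolding dual_of_def by blast
  then show ?case by simp
next
  case (Suc q)
  have "(\<Sum>j<q. t ^ j *\<^sub>R d j) \<in> V" "t ^ q *\<^sub>R d q \<in> V" "d q \<in> V"
    using assms(2) Suc.prems by (auto intro!: subspace_sum subspace_scale)
  then have "\<phi> ((\<Sum>j<q. t ^ j *\<^sub>R d j) + t ^ q *\<^sub>R d q) = \<phi> (\<Sum>j<q. t ^ j *\<^sub>R d j) + t ^ q * \<phi> (d q)"
    using assms(1) by (simp add: dual_of_def)
  then show ?case using Suc by simp
qed

text \<open>The first bound drops \<open>h\<close>; the second maximises
  \<open>\<Gamma> * e * x - \<gamma> * x^2\<close> over \<open>x\<close>, with maximum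
  \<open>(\<Gamma> * e)^2 / (4 * \<gamma>)\<close>.\<close>

lemma stability_estimate:
  fixes h e x \<gamma> \<Gamma> :: real
  assumes "h \<ge> 0" "e \<ge> 0" "x \<ge> 0" "\<gamma> > 0" "\<Gamma> > 0" and energy: "h\<^sup>2 / 2 + \<gamma> * x\<^sup>2 \<le> \<Gamma> * e * x"
  shows "x \<le> \<Gamma> / \<gamma> * e" "h \<le> \<Gamma> / sqrt (2 * \<gamma>) * e"
proof -
  show "x \<le> \<Gamma> / \<gamma> * e"
  proof (cases "x = 0")
    case False
    with assms have "x > 0" by simp
    have "\<gamma> * x\<^sup>2 \<le> \<Gamma> * e * x" using energy zero_le_power2[of h] by linarith
    then have "(\<gamma> * x) * x \<le> (\<Gamma> * e) * x" by (simp only: power2_eq_square mult.assoc)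
    with \<open>x > 0\<close> have "\<gamma> * x \<le> \<Gamma> * e" by simp
    then show ?thesis using \<open>\<gamma> > 0\<close> by (simp add: field_simps)
  qed (use assms in simp)
  \<comment> \<open>The completed square whose root is the maximiser
    \<open>x = \<Gamma> * e / (2 * \<gamma>)\<close>.\<close>
  have sq: "0 \<le> (2 * \<gamma> * x - \<Gamma> * e)\<^sup>2" by simp
  have "h\<^sup>2 * (2 * \<gamma>) = \<gamma> * 4 * (h\<^sup>2 / 2)" by simp
  also have "\<dots> \<le> \<gamma> * 4 * (\<Gamma> * e * x - \<gamma> * x\<^sup>2)"
    using energy \<open>\<gamma> > 0\<close> by (intro mult_left_mono) auto
  also have "\<dots> \<le> (\<Gamma> * e)\<^sup>2"
    using sq by (simp add: power2_eq_square algebra_simps)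
  finally have "h\<^sup>2 * (2 * \<gamma>) \<le> (\<Gamma> * e)\<^sup>2" .
  then have "(h * sqrt (2 * \<gamma>))\<^sup>2 \<le> (\<Gamma> * e)\<^sup>2" using \<open>\<gamma> > 0\<close> by (simp add: power_mult_distrib)
  then have "h * sqrt (2 * \<gamma>) \<le> \<Gamma> * e" by (rule power2_le_imp_le) (use assms in simp)
  then show "h \<le> \<Gamma> / sqrt (2 * \<gamma>) * e" using \<open>\<gamma> > 0\<close> by (simp add: field_simps)
qed

lemma mesh_sum_le_max_step:
  assumes mesh: "is_mesh T N \<tau>" and f: "f square_integrable_on {0..T}"
  shows "sqrt (\<Sum>n=1..N. step \<tau> n ^ (2 * m) * (L2_norm {\<tau> (n - 1)..\<tau> n} f)\<^sup>2)
    \<le> max_step \<tau> N ^ m * L2_norm {0..T} f"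
proof -
  have step: "0 \<le> step \<tau> n" "step \<tau> n \<le> max_step \<tau> N" if "n \<in> {1..N}" for n
    using meshD(4)[OF mesh that] that unfolding step_def max_step_def by (auto intro!: Max_ge simp: step_def)
  then have pos: "0 \<le> max_step \<tau> N" using meshD(1)[OF mesh] by (metis atLeastAtMost_iff order_refl order_trans)
  have "(\<Sum>n=1..N. step \<tau> n ^ (2 * m) * (L2_norm {\<tau> (n - 1)..\<tau> n} f)\<^sup>2)
      \<le> (\<Sum>n=1..N. max_step \<tau> N ^ (2 * m) * (L2_norm {\<tau> (n - 1)..\<tau> n} f)\<^sup>2)"
    using step by (intro sum_mono mult_right_mono power_mono) auto
  also have "\<dots> = (max_step \<tau> N ^ m * L2_norm {0..T} f)\<^sup>2"
    by (simp add: power_mult_distrib L2_norm_mesh_sum[OF mesh f] sum_distrib_left mult.commute power_mult)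
  finally show ?thesis using pos by (intro real_le_lsqrt) (auto intro!: sum_nonneg mult_nonneg_nonneg zero_le_power step)
qed

section \<open>The error estimate\<close>

theorem theorem4p2:
  fixes E :: "'u::{real_inner, banach, second_countable_topology}
                \<Rightarrow> 'h::{real_inner, banach, second_countable_topology}"
    and b :: "'u \<Rightarrow> 'q::{real_inner, banach} \<Rightarrow> real"
    and a :: "'u \<Rightarrow> 'u \<Rightarrow> real"
    and \<gamma> \<Gamma> T :: real
    and \<tau> :: "nat \<Rightarrow> real" and N q m :: nat
    and f :: "real \<Rightarrow> 'u \<Rightarrow> real" and g :: "real \<Rightarrow> ('q \<Rightarrow>\<^sub>L real)" and u0 :: 'h
    and u U :: "real \<Rightarrow> 'u"
  assumes "bounded_linear E" and "inj E" and "closure (range E) = UNIV"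
    and "bounded_bilinear b" and "surj (B_op b)"
    and "bilinear a" and "\<And>x y. a x y = a y x"
    and "\<gamma> > 0" and "\<Gamma> > 0"
    and "\<And>x y. \<bar>a x y\<bar> \<le> \<Gamma> * norm x * norm y"
    and "\<And>v. v \<in> ker_B b \<Longrightarrow> a v v \<ge> \<gamma> * (norm v)\<^sup>2"
    and "T > 0" and "is_mesh T N \<tau>" and "q \<ge> 1"
    and "f \<in> L2_dual {0<..<T} (ker_B b)" and "g \<in> L2 {0<..<T}"
    and "CP E a b T f g u0 u"
    and "DCP E a b T \<tau> N q f g u0 U"
    and "1 \<le> m" and "m \<le> q" and "u \<in> Hm {0<..<T} m"
  shows "err_const q \<gamma> \<Gamma> > 0
    \<and> norm (E (trace_at {0<..<T} u T) - E (U T)) + L2_norm {0<..<T} (\<lambda>t. u t - U t)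
      \<le> err_const q \<gamma> \<Gamma> * sqrt (\<Sum>n=1..N. step \<tau> n ^ (2 * m)
                                  * (L2_norm (Ivl \<tau> n) (weak_deriv {0<..<T} m u))\<^sup>2)
    \<and> err_const q \<gamma> \<Gamma> * sqrt (\<Sum>n=1..N. step \<tau> n ^ (2 * m)
                                  * (L2_norm (Ivl \<tau> n) (weak_deriv {0<..<T} m u))\<^sup>2)
      \<le> err_const q \<gamma> \<Gamma> * max_step \<tau> N ^ m * L2_norm {0<..<T} (weak_deriv {0<..<T} m u)"
proof -
  note E = assms(1) and b = assms(4) and pos = assms(8,9) and a_bound = assms(10) and coercive = assms(11)
    and T = assms(12) and mesh = assms(13)
  interpret E: bounded_linear E by (rule E)
  have a: "bounded_bilinear a" by (rule bounded_bilinear_of_bound[OF assms(6) a_bound])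
  interpret a: bounded_bilinear a by (rule a)
  let ?V = "ker_B b" and ?M = "lebesgue_on {0..T}"
  have V: "subspace ?V" by (rule subspace_ker_B[OF b])

  \<comment> \<open>Continuous representatives and the data of (CP)\<close>
  obtain v where v: "\<And>j. j < m \<Longrightarrow> antideriv 0 T (v j) (v (Suc j))"
    and uv: "AE t in ?M. u t = v 0 t"
    and vm: "v m = weak_deriv {0<..<T} m u" and vm_sq: "v m square_integrable_on {0..T}"
    by (rule Hm_antideriv_chain[OF T assms(19,21)]) (rule that)
  have v01: "antideriv 0 T (v 0) (v 1)" using v[of 0] assms(19) by simp
  have v0_cont: "continuous_on {0..T} (v 0)" by (rule antideriv_continuous_on[OF v01])
  have v0_sq: "v 0 square_integrable_on {0..T}" by (rule antideriv_square_integrable_on[OF v01])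
  \<comment> \<open>For \<open>m = 1\<close> the function \<open>v 1\<close> is the weak derivative
    itself and merely square integrable; for larger \<open>m\<close> it is continuous.\<close>
  have v1_sq: "v 1 square_integrable_on {0..T}"
  proof (cases "m = 1")
    case True
    then show ?thesis using vm_sq by simp
  next
    case False
    then have "antideriv 0 T (v 1) (v (Suc 1))" using assms(19) by (intro v) simp
    then show ?thesis by (rule antideriv_square_integrable_on)
  qed

  have CP: "u \<in> L2 {0<..<T}" "dual_value_at {0<..<T} E ?V (\<lambda>t. E (u t)) 0 u0"
    "AE t in lebesgue_on {0<..<T}. B_op b (u t) = g t"
    using assms(17) by (auto simp: CP_def)
  obtain u' where u': "u' \<in> L2_dual {0<..<T} ?V"
    "is_weak_deriv_dual {0<..<T} E ?V (\<lambda>t. E (u t)) u'"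
    "AE t in lebesgue_on {0<..<T}. \<forall>v\<in>?V. u' t v + a (u t) v = f t v"
    using assms(17) unfolding CP_def by blast
  have u_meas: "u \<in> borel_measurable ?M"
    using L2_square_integrable_on[OF CP(1)] borel_measurable_lebesgue_on_finite_diff[OF Ioo_finite_diff]
    by (auto simp: square_integrable_on_def)

  \<comment> \<open>The interpolant on each mesh interval\<close>
  define is_interpolant where "is_interpolant n p \<longleftrightarrow> p \<in> vpoly q \<and> (n \<in> {1..N} \<longrightarrow> p (\<tau> n) = v 0 (\<tau> n) \<and>
      (\<forall>\<psi>. degree \<psi> + 2 \<le> q \<longrightarrow>
        (LINT t|lebesgue_on {\<tau> (n - 1)..\<tau> n}. poly \<psi> t *\<^sub>R (v 0 t - p t)) = 0) \<and>
      L2_norm {\<tau> (n - 1)..\<tau> n} (\<lambda>t. v 0 t - p t)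
        \<le> step \<tau> n ^ m * L2_norm {\<tau> (n - 1)..\<tau> n} (v m))" for n and p :: "real \<Rightarrow> 'u"
  have "\<exists>p. is_interpolant n p" for n
  proof (cases "n \<in> {1..N}")
    case True
    note sub = mesh_subinterval[OF mesh True]
    obtain p where "p \<in> vpoly q" "p (\<tau> n) = v 0 (\<tau> n)"
      "\<And>\<psi>. degree \<psi> + 2 \<le> q \<Longrightarrow> (LINT t|lebesgue_on {\<tau> (n - 1)..\<tau> n}. poly \<psi> t *\<^sub>R (v 0 t - p t)) = 0"
      "L2_norm {\<tau> (n - 1)..\<tau> n} (\<lambda>t. v 0 t - p t) \<le> (\<tau> n - \<tau> (n - 1)) ^ m * L2_norm {\<tau> (n - 1)..\<tau> n} (v m)"
    proof (rule interpolation_error[OF sub(2) assms(19,20)])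
      show "antideriv (\<tau> (n - 1)) (\<tau> n) (v j) (v (Suc j))" if "j < m" for j
        by (rule antideriv_subinterval[OF v[OF that]]) (use sub in auto)
      show "v m square_integrable_on {\<tau> (n - 1)..\<tau> n}"
        by (rule square_integrable_on_subset[OF vm_sq]) (use sub in auto)
    qed (rule that)
    then show ?thesis unfolding is_interpolant_def step_def by blast
  next
    case False
    then show ?thesis unfolding is_interpolant_def by (intro exI[of _ "\<lambda>_. 0"]) auto
  qed
  then obtain p where p: "\<And>n. is_interpolant n (p n)" by metis
  have p_vpoly: "p n \<in> vpoly q" for n using p[of n] by (simp add: is_interpolant_def)
  have p_end: "p n (\<tau> n) = v 0 (\<tau> n)" if "n \<in> {1..N}" for n
    using p[of n] that by (simp add: is_interpolant_def)
  have p_mom: "(LINT t|lebesgue_on {\<tau> (n - 1)..\<tau> n}. poly \<psi> t *\<^sub>R (v 0 t - p n t)) = 0"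
    if "n \<in> {1..N}" "degree \<psi> + 2 \<le> q" for n \<psi>
    using p[of n] that unfolding is_interpolant_def by blast
  have p_err: "L2_norm {\<tau> (n - 1)..\<tau> n} (\<lambda>t. v 0 t - p n t) \<le> step \<tau> n ^ m * L2_norm {\<tau> (n - 1)..\<tau> n} (v m)"
    if "n \<in> {1..N}" for n
    using p[of n] that unfolding is_interpolant_def by blast

  \<comment> \<open>The discrete solution and its polynomial pieces\<close>
  have DCP: "U \<in> Pb \<tau> N q UNIV"
    "\<And>X. X \<in> Pb \<tau> N q ?V \<Longrightarrow> K_form E a T \<tau> N U X
      = (LINT t|lebesgue_on {0<..<T}. f t (X t)) + u0 \<bullet> E (right_lim X 0)"
    using assms(18) unfolding DCP_def by blast+
  obtain G where G: "is_Iq \<tau> N q g G"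
    "\<And>R. R \<in> Pb \<tau> N q UNIV \<Longrightarrow> (LINT t|lebesgue_on {0<..<T}. b (U t) (R t))
      = (LINT t|lebesgue_on {0<..<T}. blinfun_apply (G t) (R t))"
    using assms(18) unfolding DCP_def by blast
  have "\<exists>Y. Y \<in> vpoly q \<and> (n \<in> {1..N} \<longrightarrow> (\<forall>t\<in>Ivl \<tau> n. U t = Y t)) \<and> (n \<notin> {1..N} \<longrightarrow> Y = p n)" for n
  proof (cases "n \<in> {1..N}")
    case True
    then obtain c where "\<forall>t\<in>Ivl \<tau> n. U t = (\<Sum>j<q. t ^ j *\<^sub>R c j)"
      using DCP(1) unfolding Pb_def by blast
    then show ?thesis
      using True by (intro exI[of _ "\<lambda>t. \<Sum>j<q. t ^ j *\<^sub>R c j"]) (auto intro: vpolyI)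
  qed (use p_vpoly in auto)
  then obtain Y where Y: "\<And>n. Y n \<in> vpoly q" "\<And>n t. n \<in> {1..N} \<Longrightarrow> t \<in> Ivl \<tau> n \<Longrightarrow> U t = Y n t"
    "\<And>n. n \<notin> {1..N} \<Longrightarrow> Y n = p n" by metis

  \<comment> \<open>The difference of discrete solution and interpolant lies in the kernel\<close>
  define x where "x n t = Y n t - p n t" for n t
  have x_vpoly: "x n \<in> vpoly q" for n
    using vpoly_add[OF Y(1)[of n] vpoly_bounded_linear[OF bounded_linear_minus[OF bounded_linear_ident] p_vpoly[of n]]]
    by (simp add: x_def[abs_def])
  have "\<exists>d. \<forall>t. x n t = (\<Sum>j<q. t ^ j *\<^sub>R d j)" for n using x_vpoly[of n] by (simp add: vpoly_def)
  then obtain d where d: "\<And>n t. x n t = (\<Sum>j<q. t ^ j *\<^sub>R d n j)" by metis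
  have g_ae: "AE t in ?M. B_op b (v 0 t) = g t"
    using AE_lebesgue_on_insert[OF CP(3) Ioo_finite_diff(1,2,4,5)] uv by eventually_elim simp
  \<comment> \<open>Membership is needed for the coefficients and not just for the values, because
    \<open>Pb\<close> restricts the coefficients.\<close>
  have d_ker: "d n j \<in> ?V" if n: "n \<in> {1..N}" and "j < q" for n j
    using discrete_constraint[OF b mesh n G(2) Y(2)[OF n] p_vpoly[of n] _
        is_Iq_constraint[OF b mesh G(1) g_ae v0_cont n p_vpoly p_end[OF n] p_mom[OF n]] \<open>j < q\<close>]
      d[of n] by (simp add: x_def)
  have x_ker: "x n t \<in> ?V" if "n \<in> {1..N}" for n t
    unfolding d by (intro subspace_sum[OF V] subspace_scale[OF V] d_ker that) simp

  \<comment> \<open>The difference as an admissible test function\<close>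
  define X where "X = piecewise \<tau> x"
  have X: "X t = x n t" if "n \<in> {1..N}" "t \<in> Ivl \<tau> n" for n t
    unfolding X_def using piecewise_Ivl[OF mesh that] .
  have X_ker: "X t \<in> ?V" if "t \<in> {0<..T}" for t
    using Ivl_cover[OF mesh that] X x_ker by metis
  have X_Pb: "X \<in> Pb \<tau> N q ?V"
    unfolding Pb_def
  proof safe
    fix n assume n: "n \<in> {1..N}"
    show "\<exists>c. (\<forall>j<q. c j \<in> ?V) \<and> (\<forall>t\<in>Ivl \<tau> n. X t = (\<Sum>j<q. t ^ j *\<^sub>R c j))"
      using X[OF n] d_ker[OF n] d[of n] by (intro exI[of _ "d n"]) auto
  qed

  \<comment> \<open>Derivatives of the pieces and their images in H\<close>
  have ex_deriv: "\<exists>f'. f' \<in> vpoly q \<and> (\<forall>t. (f has_vector_derivative f' t) (at t)) \<and> (\<forall>a b. antideriv a b f f')"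
    if "f \<in> vpoly q" for f :: "real \<Rightarrow> 'u"
    by (rule vpoly_derivative[OF that]) blast
  obtain Y' where Y': "\<And>n. Y' n \<in> vpoly q" "\<And>n t. (Y n has_vector_derivative Y' n t) (at t)"
    using ex_deriv[OF Y(1)] by metis
  obtain p' where p': "\<And>n. p' n \<in> vpoly q" "\<And>n t. (p n has_vector_derivative p' n t) (at t)"
    "\<And>n a b. antideriv a b (p n) (p' n)"
    using ex_deriv[OF p_vpoly] by metis
  define x' where "x' n t = Y' n t - p' n t" for n t

  have E_cont: "continuous_on S (\<lambda>t. E (h t))" if "h \<in> vpoly q" for h S
    by (intro E.continuous_on continuous_on_vpoly[OF that])
  have x_deriv: "((\<lambda>t. E (x n t)) has_vector_derivative E (x' n t)) (at t)" for n t
    unfolding x_def x'_def by (intro E.has_vector_derivative has_vector_derivative_diff Y'(2) p'(2))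
  have x'_cont: "continuous_on UNIV (\<lambda>t. E (x' n t))" for n
    unfolding x'_def E.diff by (intro continuous_on_diff E_cont Y'(1) p'(1))
  have x_isCont: "isCont (\<lambda>t. E (x n t)) t" for n t
    using E_cont[OF x_vpoly, of UNIV n] by (simp add: continuous_on_eq_continuous_at)

  \<comment> \<open>Integrability of the terms in the energy identity\<close>
  have U_sq: "U square_integrable_on {0..T}"
    by (rule piecewise_square_integrable_on[where P=Y, OF mesh Y(2)]) (assumption | rule continuous_on_vpoly[OF Y(1)])+
  have X_sq: "X square_integrable_on {0..T}"
    by (rule piecewise_square_integrable_on[where P=x, OF mesh X]) (assumption | rule continuous_on_vpoly[OF x_vpoly])+
  \<comment> \<open>On each mesh interval \<open>X\<close> is \<open>U\<close> minus the
    interpolant, so \<open>e\<close> is the interpolation error, written as one function on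
    \<open>[0,T]\<close>.\<close>
  define e where "e t = v 0 t - U t + X t" for t
  have e_sq: "e square_integrable_on {0..T}"
    unfolding e_def[abs_def] by (intro square_integrable_on_add square_integrable_on_diff v0_sq U_sq X_sq)
  have a_int: "integrable ?M (\<lambda>t. a (y t) (z t))"
    if "y square_integrable_on {0..T}" "z square_integrable_on {0..T}" for y z :: "real \<Rightarrow> 'u"
  proof (rule Bochner_Integration.integrable_bound)
    show "integrable ?M (\<lambda>t. \<Gamma> * (norm (y t) * norm (z t)))"
      using integrable_norm_mult_square_integrable[OF that] by simp
    have "(\<lambda>x. a (fst x) (snd x)) \<in> borel_measurable borel"
      by (intro borel_measurable_continuous_onI a.continuous_on continuous_intros)
    moreover have "(\<lambda>t. (y t, z t)) \<in> borel_measurable ?M"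
      using that by (intro borel_measurable_Pair) (auto simp: square_integrable_on_def)
    ultimately have "(\<lambda>t. a (fst (y t, z t)) (snd (y t, z t))) \<in> borel_measurable ?M"
      by (rule measurable_compose[rotated])
    then show "(\<lambda>t. a (y t) (z t)) \<in> borel_measurable ?M" by simp
    show "AE t in ?M. norm (a (y t) (z t)) \<le> norm (\<Gamma> * (norm (y t) * norm (z t)))"
      using a_bound pos(2) by (simp add: mult.assoc)
  qed
  have E_sq: "(\<lambda>t. E (y t)) square_integrable_on {0..T}" if "y square_integrable_on {0..T}" for y
    by (rule square_integrable_on_bounded_linear[OF E that])

  \<comment> \<open>The continuous equation tested with the discrete difference\<close>
  have f_ae: "AE t in ?M. f t (X t) = E (v 1 t) \<bullet> E (X t) + a (v 0 t) (X t)"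
  proof -
    \<comment> \<open>The null set for the weak derivative depends on the test vector. All values of
      \<open>X\<close> are combinations of the finitely many coefficients \<open>d n j\<close>, so a
      finite union of null sets suffices.\<close>
    have "AE t in ?M. \<forall>n\<in>{1..N}. \<forall>j\<in>{..<q}. u' t (d n j) = E (v 1 t) \<bullet> E (d n j)"
    proof (intro AE_finite_allI)
      fix n j assume nj: "n \<in> {1..N}" "j \<in> {..<q}"
      show "AE t in ?M. u' t (d n j) = E (v 1 t) \<bullet> E (d n j)"
      proof (rule weak_deriv_dual_AE[OF T u'(1) V _ u'(2)])
        show "d n j \<in> ?V" using d_ker nj by simp
        have "E \<in> borel_measurable borel"
          by (intro borel_measurable_continuous_onI linear_continuous_on[OF E])
        then show "(\<lambda>t. E (u t)) \<in> borel_measurable ?M"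
          by (rule measurable_compose[OF u_meas])
        show "AE t in ?M. E (u t) = E (v 0 t)" using uv by eventually_elim simp
        show "antideriv 0 T (\<lambda>t. E (v 0 t)) (\<lambda>t. E (v 1 t))" by (rule antideriv_bounded_linear[OF E v01])
      qed
    qed auto
    moreover have "AE t in ?M. u' t \<in> dual_of ?V"
      using u'(1) AE_lebesgue_on_insert[OF _ Ioo_finite_diff(1,2,4,5)] by (auto simp: L2_dual_def)
    moreover have "AE t in ?M. \<forall>v\<in>?V. u' t v + a (u t) v = f t v"
      by (rule AE_lebesgue_on_insert[OF u'(3) Ioo_finite_diff(1,2,4,5)])
    moreover have "AE t in ?M. t \<in> {0<..T}"
      by (rule AE_lebesgue_on_insert[where S="{0<..T}" and N="{0}"]) (auto intro!: AE_I2)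
    ultimately show ?thesis
      using uv
    proof eventually_elim
      case (elim t)
      obtain n where n: "n \<in> {1..N}" "t \<in> Ivl \<tau> n" using Ivl_cover[OF mesh elim(4)] by blast
      have Xt: "X t = (\<Sum>j<q. t ^ j *\<^sub>R d n j)" using X[OF n] d by simp
      have "u' t (X t) = (\<Sum>j<q. t ^ j * u' t (d n j))"
        unfolding Xt by (rule dual_of_sum[OF elim(2) V d_ker[OF n(1)]])
      also have "\<dots> = (\<Sum>j<q. t ^ j * (E (v 1 t) \<bullet> E (d n j)))"
        using elim(1) n(1) by simp
      also have "\<dots> = E (v 1 t) \<bullet> E (X t)"
        unfolding Xt by (simp add: E.sum E.scaleR inner_sum_right)
      finally show ?case using elim(3,5) X_ker[OF elim(4)] by auto
    qed
  qed

  have Ev1X: "integrable ?M (\<lambda>t. E (v 1 t) \<bullet> E (X t))"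
    by (intro integrable_inner_square_integrable E_sq v1_sq X_sq)
  have f_int: "(LINT t|lebesgue_on {0<..<T}. f t (X t))
      = (\<Sum>n=1..N. LINT t|lebesgue_on {\<tau> (n - 1)..\<tau> n}. E (v 1 t) \<bullet> E (x n t)) + (LINT t|?M. a (v 0 t) (X t))"
  proof -
    have rhs: "integrable ?M (\<lambda>t. E (v 1 t) \<bullet> E (X t) + a (v 0 t) (X t))"
      using Ev1X a_int[OF v0_sq X_sq] by simp
    have "(LINT t|lebesgue_on {0<..<T}. f t (X t)) = (LINT t|?M. f t (X t))"
      by (rule integral_lebesgue_on_finite_diff[OF Ioo_finite_diff])
    also have "\<dots> = (LINT t|?M. E (v 1 t) \<bullet> E (X t) + a (v 0 t) (X t))"
    proof (rule integral_cong_AE[OF _ _ f_ae])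
      show m: "(\<lambda>t. E (v 1 t) \<bullet> E (X t) + a (v 0 t) (X t)) \<in> borel_measurable ?M" using rhs by simp
      \<comment> \<open>Measurability of this pairing is inherited from the right hand side of
        \<open>f_ae\<close>, by completeness of the measure.\<close>
      show "(\<lambda>t. f t (X t)) \<in> borel_measurable ?M"
        by (rule borel_measurable_lebesgue_on_cong_AE[OF m]) (use f_ae in \<open>auto elim: eventually_mono\<close>)
    qed
    also have "\<dots> = (LINT t|?M. E (v 1 t) \<bullet> E (X t)) + (LINT t|?M. a (v 0 t) (X t))"
      using Ev1X a_int[OF v0_sq X_sq] by simp
    also have "(LINT t|?M. E (v 1 t) \<bullet> E (X t))
        = (\<Sum>n=1..N. LINT t|lebesgue_on {\<tau> (n - 1)..\<tau> n}. E (v 1 t) \<bullet> E (X t))"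
      by (rule mesh_integral_sum[OF mesh Ev1X])
    also have "\<dots> = (\<Sum>n=1..N. LINT t|lebesgue_on {\<tau> (n - 1)..\<tau> n}. E (v 1 t) \<bullet> E (x n t))"
      using X by (intro sum.cong refl integral_Ivl_cong) simp
    finally show ?thesis .
  qed

  \<comment> \<open>The initial value tested with the discrete difference\<close>
  have one: "1 \<in> {1..N}" using meshD(1)[OF mesh] by simp
  have u0: "u0 \<bullet> E (right_lim X 0) = E (v 0 0) \<bullet> E (x 1 0)"
  proof -
    have "right_lim X (\<tau> (1 - 1)) = x 1 (\<tau> (1 - 1))"
      using meshD(4)[OF mesh one] X[OF one] continuous_on_vpoly[OF x_vpoly, of UNIV 1]
      by (intro right_lim_Ivl) (auto simp: continuous_on_eq_continuous_at)
    then have "right_lim X 0 = x 1 0" using meshD(2)[OF mesh] by simp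
    moreover have "u0 \<bullet> E (x 1 0) = E (v 0 0) \<bullet> E (x 1 0)"
    proof (rule dual_value_at_0[OF T CP(2) V x_ker[OF one]])
      show "AE t in ?M. E (u t) = E (v 0 t)" using uv by eventually_elim simp
      show "continuous_on {0..T} (\<lambda>t. E (v 0 t))" by (rule E.continuous_on[OF v0_cont])
    qed
    ultimately show ?thesis by simp
  qed

  \<comment> \<open>Error equation and energy identity\<close>
  let ?Ex = "\<lambda>n t. E (x n t)" and ?Ex' = "\<lambda>n t. E (x' n t)"
  have D_U: "D_form \<tau> N (\<lambda>t. E (U t)) (\<lambda>t. E (X t)) = D_sum \<tau> N (\<lambda>n t. E (Y n t)) (\<lambda>n t. E (Y' n t)) ?Ex"
    using Y(2) X x_isCont by (intro D_form_eq_D_sum[OF mesh] E.has_vector_derivative Y'(2)) simp_all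
  have D_p: "D_sum \<tau> N (\<lambda>n t. E (p n t)) (\<lambda>n t. E (p' n t)) ?Ex
      = (\<Sum>n=1..N. LINT t|lebesgue_on {\<tau> (n - 1)..\<tau> n}. E (v 1 t) \<bullet> E (x n t)) + E (v 0 0) \<bullet> E (x 1 0)"
  proof (rule D_sum_interpolant[OF mesh antideriv_bounded_linear[OF E v01] E_sq[OF v1_sq]])
    fix n \<psi> assume n: "n \<in> {1..N}" and \<psi>: "degree (\<psi> :: real poly) + 2 \<le> q"
    note sub = mesh_subinterval[OF mesh n]
    have "integrable (lebesgue_on {\<tau> (n - 1)..\<tau> n}) (\<lambda>t. poly \<psi> t *\<^sub>R (v 0 t - p n t))"
      using sub by (intro continuous_on_integrable_lebesgue_on continuous_intros continuous_on_vpoly[OF p_vpoly]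
          continuous_on_subset[OF v0_cont]) auto
    \<comment> \<open>The moment conditions hold in U; applying the bounded linear embedding under
      the integral carries them over to H.\<close>
    from integral_bounded_linear[OF E this]
    show "(LINT t|lebesgue_on {\<tau> (n - 1)..\<tau> n}. poly \<psi> t *\<^sub>R (E (v 0 t) - E (p n t))) = 0"
      using p_mom[OF n \<psi>] by (simp add: E.scaleR E.diff E.zero)
  qed (use p_vpoly x_vpoly p' p_end in \<open>auto intro!: vpoly_bounded_linear[OF E] antideriv_bounded_linear[OF E]\<close>)
  have D_x: "D_sum \<tau> N ?Ex ?Ex' ?Ex = D_sum \<tau> N (\<lambda>n t. E (Y n t)) (\<lambda>n t. E (Y' n t)) ?Ex
      - D_sum \<tau> N (\<lambda>n t. E (p n t)) (\<lambda>n t. E (p' n t)) ?Ex"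
    unfolding x_def x'_def E.diff
    by (rule D_sum_diff) (intro continuous_on_diff E_cont Y(1) Y'(1) p'(1) p_vpoly)+

  have a_U: "(LINT t|lebesgue_on {0<..<T}. a (U t) (X t)) = (LINT t|?M. a (U t) (X t))"
    by (rule integral_lebesgue_on_finite_diff[OF Ioo_finite_diff])
  \<comment> \<open>The interpolant reproduces exactly the integrals with \<open>v 1\<close> and the
    initial term that (DCP) receives from \<open>f\<close> and \<open>u0\<close>; subtraction leaves
    only the terms with \<open>a\<close>.\<close>
  have "D_sum \<tau> N ?Ex ?Ex' ?Ex = (LINT t|?M. a (v 0 t) (X t)) - (LINT t|?M. a (U t) (X t))"
    using DCP(2)[OF X_Pb] unfolding K_form_def D_U f_int u0 a_U D_x D_p by simp
  also have "\<dots> = (LINT t|?M. a (e t) (X t)) - (LINT t|?M. a (X t) (X t))"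
    using a_int[OF v0_sq X_sq] a_int[OF U_sq X_sq] a_int[OF X_sq X_sq]
    by (simp add: e_def a.add_left a.diff_left)
  finally have energy: "D_sum \<tau> N ?Ex ?Ex' ?Ex + (LINT t|?M. a (X t) (X t)) = (LINT t|?M. a (e t) (X t))" by simp

  \<comment> \<open>Stability\<close>
  let ?e = "L2_norm {0..T} e" and ?x = "L2_norm {0..T} X" and ?h = "norm (E (x N T))"
  have "?h\<^sup>2 / 2 + \<gamma> * ?x\<^sup>2 \<le> \<Gamma> * ?e * ?x"
  proof -
    have "?h\<^sup>2 / 2 \<le> D_sum \<tau> N ?Ex ?Ex' ?Ex"
      by (rule D_sum_lower_bound[OF mesh x_deriv x'_cont])
    moreover have "\<gamma> * ?x\<^sup>2 \<le> (LINT t|?M. a (X t) (X t))"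
    proof -
      have Xi: "integrable ?M (\<lambda>t. (norm (X t))\<^sup>2)" using X_sq by (simp add: square_integrable_on_def)
      have "(LINT t|?M. \<gamma> * (norm (X t))\<^sup>2) \<le> (LINT t|?M. a (X t) (X t))"
      proof (rule integral_mono_AE[OF _ a_int[OF X_sq X_sq]])
        have "AE t in ?M. t \<in> {0<..T}"
          by (rule AE_lebesgue_on_insert[where S="{0<..T}" and N="{0}"]) (auto intro!: AE_I2)
        then show "AE t in ?M. \<gamma> * (norm (X t))\<^sup>2 \<le> a (X t) (X t)"
          by eventually_elim (rule coercive[OF X_ker])
      qed (use Xi in simp)
      then show ?thesis by (simp add: L2_norm_power2)
    qed
    moreover have "(LINT t|?M. a (e t) (X t)) \<le> \<Gamma> * ?e * ?x"
    proof -
      have "(LINT t|?M. a (e t) (X t)) \<le> (LINT t|?M. \<Gamma> * (norm (e t) * norm (X t)))"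
      proof (rule integral_mono[OF a_int[OF e_sq X_sq]])
        show "a (e t) (X t) \<le> \<Gamma> * (norm (e t) * norm (X t))" for t
          using a_bound[of "e t" "X t"] by (simp add: mult.assoc)
      qed (use integrable_norm_mult_square_integrable[OF e_sq X_sq] in simp)
      also have "\<dots> \<le> \<Gamma> * (?e * ?x)"
        using integral_norm_mult_le[OF e_sq X_sq] pos(2) by simp
      finally show ?thesis by (simp add: mult.assoc)
    qed
    ultimately show ?thesis using energy by simp
  qed
  from stability_estimate[OF _ _ _ pos this]
  have x_le: "?x \<le> \<Gamma> / \<gamma> * ?e" and h_le: "?h \<le> \<Gamma> / sqrt (2 * \<gamma>) * ?e" by simp_all

  \<comment> \<open>Interpolation error summed over the mesh\<close>
  define S where "S = sqrt (\<Sum>n=1..N. step \<tau> n ^ (2 * m) * (L2_norm {\<tau> (n - 1)..\<tau> n} (v m))\<^sup>2)"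
  have e_le: "?e \<le> S"
    unfolding S_def
  proof (rule real_le_rsqrt)
    have "?e\<^sup>2 = (\<Sum>n=1..N. (L2_norm {\<tau> (n - 1)..\<tau> n} e)\<^sup>2)" by (rule L2_norm_mesh_sum[OF mesh e_sq])
    also have "\<dots> \<le> (\<Sum>n=1..N. step \<tau> n ^ (2 * m) * (L2_norm {\<tau> (n - 1)..\<tau> n} (v m))\<^sup>2)"
    proof (rule sum_mono)
      fix n assume n: "n \<in> {1..N}"
      have "(LINT t|lebesgue_on {\<tau> (n - 1)..\<tau> n}. (norm (e t))\<^sup>2)
          = (LINT t|lebesgue_on {\<tau> (n - 1)..\<tau> n}. (norm (v 0 t - p n t))\<^sup>2)"
        using X[OF n] Y(2)[OF n] by (intro integral_Ivl_cong) (simp add: e_def x_def)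
      then have "L2_norm {\<tau> (n - 1)..\<tau> n} e = L2_norm {\<tau> (n - 1)..\<tau> n} (\<lambda>t. v 0 t - p n t)"
        by (simp add: L2_norm_def)
      then have "(L2_norm {\<tau> (n - 1)..\<tau> n} e)\<^sup>2 \<le> (step \<tau> n ^ m * L2_norm {\<tau> (n - 1)..\<tau> n} (v m))\<^sup>2"
        using p_err[OF n] by (intro power_mono) auto
      then show "(L2_norm {\<tau> (n - 1)..\<tau> n} e)\<^sup>2 \<le> step \<tau> n ^ (2 * m) * (L2_norm {\<tau> (n - 1)..\<tau> n} (v m))\<^sup>2"
        by (simp add: power_mult_distrib power_mult[symmetric] mult.commute)
    qed
    finally show "?e\<^sup>2 \<le> (\<Sum>n=1..N. step \<tau> n ^ (2 * m) * (L2_norm {\<tau> (n - 1)..\<tau> n} (v m))\<^sup>2)" .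
  qed

  \<comment> \<open>Assembling the error bound\<close>
  let ?C = "1 + \<Gamma> / \<gamma> + \<Gamma> / sqrt (2 * \<gamma>)"
  have C_pos: "?C > 0" using pos by (intro add_pos_pos divide_pos_pos) auto
  have const_pos: "err_const q \<gamma> \<Gamma> > 0" using C_pos \<open>q \<ge> 1\<close> by (simp add: err_const_def)
  have S_nonneg: "S \<ge> 0" using e_le L2_norm_nonneg[of "{0..T}" e] by linarith

  \<comment> \<open>\<open>T\<close> is the right end of the last interval, where the interpolant
    equals \<open>v\<close>; the error at \<open>T\<close> is therefore entirely that of the
    discrete difference.\<close>
  have end_err: "norm (E (trace_at {0<..<T} u T) - E (U T)) = ?h"
  proof -
    have N: "N \<in> {1..N}" using meshD(1)[OF mesh] by simp
    have "trace_at {0<..<T} u T = v 0 T" by (rule trace_at_eq[OF T v0_cont uv]) (use T in simp)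
    moreover have "U T = Y N T"
      using Y(2)[OF N, of T] meshD(3)[OF mesh] meshD(4)[OF mesh N] by (auto simp: Ivl_def)
    moreover have "p N T = v 0 T" using p_end[OF N] meshD(3)[OF mesh] by simp
    ultimately show ?thesis by (simp add: x_def E.diff norm_minus_commute)
  qed
  have L2_err: "L2_norm {0<..<T} (\<lambda>t. u t - U t) \<le> ?e + ?x"
  proof -
    have [measurable]: "u \<in> borel_measurable ?M" "U \<in> borel_measurable ?M" "v 0 \<in> borel_measurable ?M"
      using u_meas U_sq v0_sq by (auto simp: square_integrable_on_def)
    have "L2_norm {0<..<T} (\<lambda>t. u t - U t) = L2_norm {0..T} (\<lambda>t. u t - U t)"
      by (rule L2_norm_finite_diff[OF Ioo_finite_diff])
    also have "\<dots> = L2_norm {0..T} (\<lambda>t. v 0 t - U t)"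
    proof (rule L2_norm_cong_AE)
      show "AE t in ?M. u t - U t = v 0 t - U t" using uv by eventually_elim simp
    qed measurable
    also have "\<dots> = L2_norm {0..T} (\<lambda>t. e t + - X t)" by (simp add: e_def)
    also have "\<dots> \<le> ?e + L2_norm {0..T} (\<lambda>t. - X t)"
      by (rule L2_norm_triangle[OF e_sq square_integrable_on_minus[OF X_sq]])
    finally show ?thesis by (simp add: L2_norm_def)
  qed
  have "norm (E (trace_at {0<..<T} u T) - E (U T)) + L2_norm {0<..<T} (\<lambda>t. u t - U t) \<le> ?C * ?e"
    using end_err L2_err x_le h_le by (simp add: distrib_right)
  also have "\<dots> \<le> ?C * S" using e_le C_pos by simp
  \<comment> \<open>\<open>err_const\<close> is \<open>?C\<close> multiplied by \<open>q\<close>,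
    and \<open>q \<ge> 1\<close>.\<close>
  also have "\<dots> \<le> err_const q \<gamma> \<Gamma> * S"
    unfolding err_const_def using C_pos S_nonneg \<open>q \<ge> 1\<close> by (intro mult_right_mono) auto
  finally have main: "norm (E (trace_at {0<..<T} u T) - E (U T)) + L2_norm {0<..<T} (\<lambda>t. u t - U t)
      \<le> err_const q \<gamma> \<Gamma> * S" .

  have S_eq: "S = sqrt (\<Sum>n=1..N. step \<tau> n ^ (2 * m) * (L2_norm (Ivl \<tau> n) (weak_deriv {0<..<T} m u))\<^sup>2)"
  proof -
    have "L2_norm (Ivl \<tau> n) w = L2_norm {\<tau> (n - 1)..\<tau> n} w" for n and w :: "real \<Rightarrow> 'u"
      by (rule L2_norm_finite_diff[OF Ivl_finite_diff])
    then show ?thesis by (simp only: S_def vm)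
  qed
  have "S \<le> max_step \<tau> N ^ m * L2_norm {0..T} (v m)"
    unfolding S_def by (rule mesh_sum_le_max_step[OF mesh vm_sq])
  then have "err_const q \<gamma> \<Gamma> * S \<le> err_const q \<gamma> \<Gamma> * (max_step \<tau> N ^ m * L2_norm {0..T} (v m))"
    using const_pos by simp
  then have "err_const q \<gamma> \<Gamma> * S
      \<le> err_const q \<gamma> \<Gamma> * max_step \<tau> N ^ m * L2_norm {0<..<T} (weak_deriv {0<..<T} m u)"
    unfolding vm L2_norm_finite_diff[OF Ioo_finite_diff] by (simp add: mult.assoc)
  then show ?thesis using main const_pos unfolding S_eq by blast
qed

end
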